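(* The inner angles of any geodesic triangle in $\Sigma$ add up to at most $\pi$.
   Context: Let $H$ be a complex, infinite dimensional, separable Hilbert space, $\mathsf{HS}\subset B(H)$ the ideal of Hilbert-Schmidt operators. Let $\mathcal H_{\mathbb C}=\{a+\lambda: a\in\mathsf{HS},\lambda\in\mathbb C\}$ with inner product $\langle a+\lambda,b+\beta\rangle_2=4\,\mathrm{tr}(ab^* )+\lambda\overline\beta$, and $\mathcal H_{\mathbb R}=\{a+\lambda: a=a^*\in\mathsf{HS},\lambda\in\mathbb R\}$, a real Hilbert space. $\Sigma$ is the set of positive invertible operators in $\mathcal H_{\mathbb R}$, an open subset of $\mathcal H_{\mathbb R}$ with $T_p\Sigma=\mathcal H_{\mathbb R}$, and with Riemannian metric $\langle x,y\rangle_p=\langle xp^{-1},p^{-1}y\rangle_2$, i.e. $\|x\|_p=\|p^{-1/2}xp^{-1/2}\|_2$. The geodesic joining $p,q\in\Sigma$ is $\gamma_{pq}(t)=p^{1/2}(p^{-1/2}qp^{-1/2})^tp^{1/2}$. A geodesic triangle consists of three points (vertices) and the geodesics joining them; the inner angle at a vertex $p$ is the angle, in $(T_p\Sigma,\langle\cdot,\cdot\rangle_p)$, between the initial velocities of the two sides issuing from $p$. *)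

theory Defs
  imports "HOL-Analysis.Analysis" "HOL-Computational_Algebra.Polynomial"
begin

section \<open>Complex Hilbert spaces\<close>

text \<open>A complex Hilbert space is presented on top of its underlying real Hilbert space, so
  that norm, completeness and topology are the library's. The complex inner product is linear in
  the first argument and its real part is the real inner product; definiteness and compatibility
  with the norm are therefore inherited from the class \<open>real_inner\<close>.\<close>

class complex_hilbert = real_inner + complete_space +
  fixes scaleC :: "complex \<Rightarrow> 'a \<Rightarrow> 'a"  (infixr "*\<^sub>C" 75)
    and cinner :: "'a \<Rightarrow> 'a \<Rightarrow> complex"
  assumes scaleC_add_right: "c *\<^sub>C (x + y) = c *\<^sub>C x + c *\<^sub>C y"
    and scaleC_add_left: "(c + d) *\<^sub>C x = c *\<^sub>C x + d *\<^sub>C x"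
    and scaleC_scaleC: "c *\<^sub>C d *\<^sub>C x = (c * d) *\<^sub>C x"
    and scaleC_of_real: "complex_of_real r *\<^sub>C x = r *\<^sub>R x"
    and cinner_add_left: "cinner (x + y) z = cinner x z + cinner y z"
    and cinner_scaleC_left: "cinner (c *\<^sub>C x) y = c * cinner x y"
    and cinner_commute: "cinner x y = cnj (cinner y x)"
    and Re_cinner: "Re (cinner x y) = inner x y"

lemma vector_space_scaleC: "vector_space (scaleC :: complex \<Rightarrow> 'a \<Rightarrow> 'a::complex_hilbert)"
proof
  show "1 *\<^sub>C x = x" for x :: 'a
    using scaleC_of_real[of 1 x] by simp
qed (simp_all add: scaleC_add_right scaleC_add_left scaleC_scaleC)

abbreviation cspan :: "'a::complex_hilbert set \<Rightarrow> 'a set" where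
  "cspan \<equiv> module.span scaleC"

lemma norm_scaleC: "norm (c *\<^sub>C x) = cmod c * norm (x :: 'a::complex_hilbert)"
proof -
  have sq: "cinner y y = complex_of_real ((norm y)\<^sup>2)" for y :: 'a
    using cinner_commute[of y y] Re_cinner[of y y]
    by (auto simp: complex_eq_iff power2_norm_eq_inner)
  have "cinner (c *\<^sub>C x) (c *\<^sub>C x) = c * cnj (c * cinner x x)"
    by (metis cinner_commute cinner_scaleC_left)
  also have "\<dots> = (c * cnj c) * complex_of_real ((norm x)\<^sup>2)"
    unfolding sq by simp
  also have "\<dots> = complex_of_real ((cmod c * norm x)\<^sup>2)"
    unfolding complex_norm_square[symmetric] power_mult_distrib by simp
  finally have "complex_of_real ((norm (c *\<^sub>C x))\<^sup>2) = complex_of_real ((cmod c * norm x)\<^sup>2)"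
    unfolding sq .
  then have "(norm (c *\<^sub>C x))\<^sup>2 = (cmod c * norm x)\<^sup>2"
    using of_real_eq_iff by blast
  then show ?thesis
    by (simp add: power2_eq_iff_nonneg)
qed

definition infinite_dimensional :: "'a::complex_hilbert itself \<Rightarrow> bool" where
  "infinite_dimensional _ \<longleftrightarrow> (\<nexists>B :: 'a set. finite B \<and> cspan B = UNIV)"

definition separable :: "'a::complex_hilbert itself \<Rightarrow> bool" where
  "separable _ \<longleftrightarrow> (\<exists>D :: 'a set. countable D \<and> closure D = UNIV)"

definition orthonormal_basis :: "'a::complex_hilbert set \<Rightarrow> bool" where
  "orthonormal_basis E \<longleftrightarrow>
     (\<forall>x\<in>E. \<forall>y\<in>E. cinner x y = (if x = y then 1 else 0)) \<and> closure (cspan E) = UNIV"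


section \<open>Bounded operators\<close>

text \<open>The elements of \<open>'a \<Rightarrow>\<^sub>L 'a\<close> are bounded but only real-linear; \<open>B(H)\<close> is the set
  of the complex-linear ones.\<close>

definition bounded_ops :: "('a::complex_hilbert \<Rightarrow>\<^sub>L 'a) set" where
  "bounded_ops = {T. \<forall>c x. blinfun_apply T (c *\<^sub>C x) = c *\<^sub>C blinfun_apply T x}"

lift_definition scalar_op :: "complex \<Rightarrow> 'a::complex_hilbert \<Rightarrow>\<^sub>L 'a" is "\<lambda>c x. c *\<^sub>C x"
proof
  fix c :: complex
  show "c *\<^sub>C (x + y) = c *\<^sub>C x + c *\<^sub>C y" for x y :: 'a
    by (rule scaleC_add_right)
  show "c *\<^sub>C r *\<^sub>R x = r *\<^sub>R c *\<^sub>C x" for r and x :: 'a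
    by (metis mult.commute scaleC_of_real scaleC_scaleC)
  show "\<exists>K. \<forall>x::'a. norm (c *\<^sub>C x) \<le> norm x * K"
    by (intro exI[of _ "cmod c"]) (simp add: norm_scaleC mult.commute)
qed

definition adj :: "('a::complex_hilbert \<Rightarrow>\<^sub>L 'a) \<Rightarrow> ('a \<Rightarrow>\<^sub>L 'a)" where
  "adj T = (THE S. S \<in> bounded_ops \<and>
     (\<forall>x y. cinner (blinfun_apply T x) y = cinner x (blinfun_apply S y)))"

definition op_invertible :: "('a::complex_hilbert \<Rightarrow>\<^sub>L 'a) \<Rightarrow> bool" where
  "op_invertible T \<longleftrightarrow> (\<exists>S\<in>bounded_ops. S o\<^sub>L T = id_blinfun \<and> T o\<^sub>L S = id_blinfun)"

definition op_inv :: "('a::complex_hilbert \<Rightarrow>\<^sub>L 'a) \<Rightarrow> ('a \<Rightarrow>\<^sub>L 'a)" where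
  "op_inv T = (THE S. S \<in> bounded_ops \<and> S o\<^sub>L T = id_blinfun \<and> T o\<^sub>L S = id_blinfun)"

definition op_positive :: "('a::complex_hilbert \<Rightarrow>\<^sub>L 'a) \<Rightarrow> bool" where
  "op_positive T \<longleftrightarrow> (\<forall>x. cinner (blinfun_apply T x) x \<in> \<real> \<and> 0 \<le> Re (cinner (blinfun_apply T x) x))"

definition op_spectrum :: "('a::complex_hilbert \<Rightarrow>\<^sub>L 'a) \<Rightarrow> complex set" where
  "op_spectrum T = {z. \<not> op_invertible (T - scalar_op z)}"

primrec op_power :: "('a::complex_hilbert \<Rightarrow>\<^sub>L 'a) \<Rightarrow> nat \<Rightarrow> ('a \<Rightarrow>\<^sub>L 'a)" where
  "op_power T 0 = id_blinfun"
| "op_power T (Suc n) = T o\<^sub>L op_power T n"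

definition op_poly :: "real poly \<Rightarrow> ('a::complex_hilbert \<Rightarrow>\<^sub>L 'a) \<Rightarrow> ('a \<Rightarrow>\<^sub>L 'a)" where
  "op_poly P T = (\<Sum>i\<le>degree P. coeff P i *\<^sub>R op_power T i)"

text \<open>The continuous functional calculus of a self-adjoint operator (whose spectrum is real):
  \<open>f(T)\<close> is the norm limit of \<open>P\<^sub>n(T)\<close> for every sequence of polynomials \<open>P\<^sub>n\<close>
  converging to \<open>f\<close> uniformly on the spectrum of \<open>T\<close>.\<close>

definition op_fun :: "(real \<Rightarrow> real) \<Rightarrow> ('a::complex_hilbert \<Rightarrow>\<^sub>L 'a) \<Rightarrow> ('a \<Rightarrow>\<^sub>L 'a)" where
  "op_fun f T = (THE S. \<forall>P :: nat \<Rightarrow> real poly.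
     uniform_limit {x. complex_of_real x \<in> op_spectrum T} (\<lambda>n x. poly (P n) x) f sequentially \<longrightarrow>
     (\<lambda>n. op_poly (P n) T) \<longlonglongrightarrow> S)"

definition op_powr :: "('a::complex_hilbert \<Rightarrow>\<^sub>L 'a) \<Rightarrow> real \<Rightarrow> ('a \<Rightarrow>\<^sub>L 'a)" where
  "op_powr T t = op_fun (\<lambda>x. x powr t) T"


section \<open>Hilbert-Schmidt operators and their extension by scalars\<close>

definition hilbert_schmidt :: "('a::complex_hilbert \<Rightarrow>\<^sub>L 'a) set" where
  "hilbert_schmidt = {T \<in> bounded_ops.
     \<exists>E. orthonormal_basis E \<and> (\<lambda>e. (norm (blinfun_apply T e))\<^sup>2) summable_on E}"

text \<open>The value of the trace of a trace class operator (here: a product of two Hilbert-Schmidt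
  operators) does not depend on the orthonormal basis.\<close>

definition op_trace :: "('a::complex_hilbert \<Rightarrow>\<^sub>L 'a) \<Rightarrow> complex" where
  "op_trace T = (THE z. \<forall>E. orthonormal_basis E \<longrightarrow>
     ((\<lambda>e. cinner (blinfun_apply T e) e) has_sum z) E)"

definition HC :: "('a::complex_hilbert \<Rightarrow>\<^sub>L 'a) set" where
  "HC = {a + scalar_op c | a c. a \<in> hilbert_schmidt}"

definition HR :: "('a::complex_hilbert \<Rightarrow>\<^sub>L 'a) set" where
  "HR = {a + scalar_op (complex_of_real r) | a r. a \<in> hilbert_schmidt \<and> adj a = a}"

text \<open>In infinite dimension the decomposition \<open>x = a + \<lambda>\<close> of \<open>x \<in> HC\<close> is unique.\<close>

definition scalar_part :: "('a::complex_hilbert \<Rightarrow>\<^sub>L 'a) \<Rightarrow> complex" where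
  "scalar_part x = (THE c. x - scalar_op c \<in> hilbert_schmidt)"

definition hs_part :: "('a::complex_hilbert \<Rightarrow>\<^sub>L 'a) \<Rightarrow> ('a \<Rightarrow>\<^sub>L 'a)" where
  "hs_part x = x - scalar_op (scalar_part x)"

definition inner2 :: "('a::complex_hilbert \<Rightarrow>\<^sub>L 'a) \<Rightarrow> ('a \<Rightarrow>\<^sub>L 'a) \<Rightarrow> complex" where
  "inner2 x y = 4 * op_trace (hs_part x o\<^sub>L adj (hs_part y)) + scalar_part x * cnj (scalar_part y)"

definition norm2 :: "('a::complex_hilbert \<Rightarrow>\<^sub>L 'a) \<Rightarrow> real" where
  "norm2 x = sqrt (Re (inner2 x x))"


section \<open>The manifold of positive invertible operators\<close>

definition Sigma_mfd :: "('a::complex_hilbert \<Rightarrow>\<^sub>L 'a) set" where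
  "Sigma_mfd = {p \<in> HR. op_positive p \<and> op_invertible p}"

text \<open>For \<open>x, y \<in> HR\<close> the inner product below is a real number; \<open>Re\<close> only changes the type.\<close>

definition riem_metric ::
    "('a::complex_hilbert \<Rightarrow>\<^sub>L 'a) \<Rightarrow> ('a \<Rightarrow>\<^sub>L 'a) \<Rightarrow> ('a \<Rightarrow>\<^sub>L 'a) \<Rightarrow> real" where
  "riem_metric p x y = Re (inner2 (x o\<^sub>L op_inv p) (op_inv p o\<^sub>L y))"

definition riem_norm :: "('a::complex_hilbert \<Rightarrow>\<^sub>L 'a) \<Rightarrow> ('a \<Rightarrow>\<^sub>L 'a) \<Rightarrow> real" where
  "riem_norm p x = sqrt (riem_metric p x x)"

definition geodesic ::
    "('a::complex_hilbert \<Rightarrow>\<^sub>L 'a) \<Rightarrow> ('a \<Rightarrow>\<^sub>L 'a) \<Rightarrow> real \<Rightarrow> ('a \<Rightarrow>\<^sub>L 'a)" where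
  "geodesic p q t = op_powr p (1/2) o\<^sub>L
     op_powr (op_powr p (-1/2) o\<^sub>L q o\<^sub>L op_powr p (-1/2)) t o\<^sub>L op_powr p (1/2)"

text \<open>The derivative at \<open>0\<close> of a curve defined on \<open>[0,1]\<close>, with respect to the norm of the
  Hilbert space \<open>HR\<close> (and not the operator norm carried by \<open>'a \<Rightarrow>\<^sub>L 'a\<close>).\<close>

definition initial_velocity :: "(real \<Rightarrow> ('a::complex_hilbert \<Rightarrow>\<^sub>L 'a)) \<Rightarrow> ('a \<Rightarrow>\<^sub>L 'a)" where
  "initial_velocity g = (THE v. v \<in> HR \<and>
     ((\<lambda>t. norm2 ((1 / t) *\<^sub>R (g t - g 0) - v)) \<longlongrightarrow> 0) (at 0 within {0..1}))"

definition riem_angle ::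
    "('a::complex_hilbert \<Rightarrow>\<^sub>L 'a) \<Rightarrow> ('a \<Rightarrow>\<^sub>L 'a) \<Rightarrow> ('a \<Rightarrow>\<^sub>L 'a) \<Rightarrow> real" where
  "riem_angle p v w = arccos (riem_metric p v w / (riem_norm p v * riem_norm p w))"

definition inner_angle ::
    "('a::complex_hilbert \<Rightarrow>\<^sub>L 'a) \<Rightarrow> ('a \<Rightarrow>\<^sub>L 'a) \<Rightarrow> ('a \<Rightarrow>\<^sub>L 'a) \<Rightarrow> real" where
  "inner_angle p q r =
     riem_angle p (initial_velocity (geodesic p q)) (initial_velocity (geodesic p r))"

text \<open>The vertices are distinct: the angle at \<open>p\<close> makes sense only if both sides issuing from
  \<open>p\<close> have a nonzero initial velocity. The three vertices may lie on one geodesic.\<close>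

definition geodesic_triangle ::
    "('a::complex_hilbert \<Rightarrow>\<^sub>L 'a) \<Rightarrow> ('a \<Rightarrow>\<^sub>L 'a) \<Rightarrow> ('a \<Rightarrow>\<^sub>L 'a) \<Rightarrow> bool" where
  "geodesic_triangle p q r \<longleftrightarrow>
     p \<in> Sigma_mfd \<and> q \<in> Sigma_mfd \<and> r \<in> Sigma_mfd \<and> p \<noteq> q \<and> q \<noteq> r \<and> r \<noteq> p"

end

theory Submission
  imports Defs
begin

text \<open>It suffices to prove the law of cosines as an inequality,
  \<open>d(q,r)\<^sup>2 \<ge> d(p,q)\<^sup>2 + d(p,r)\<^sup>2 - 2 d(p,q) d(p,r) cos \<angle>\<^sub>p\<close>: every angle is then at most the
  corresponding angle of the Euclidean triangle with the same side lengths. By invariance this says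
  that \<open>exp\<close> increases distances: \<open>\<bar>Y - X\<bar> \<le> \<bar>Z\<bar>\<close> whenever \<open>e\<^sup>X = g g*\<close> and \<open>e\<^sup>Y = g e\<^sup>Z g*\<close>.

  The matrix of \<open>ln B - ln A\<close> with respect to an eigenbasis of \<open>A\<close> (eigenvalues \<open>\<alpha>\<close>) and one of
  \<open>B\<close> (eigenvalues \<open>\<beta>\<close>) is that of \<open>B - A\<close> times difference quotients of \<open>ln\<close>, which are at most
  \<open>1 / sqrt (\<alpha> \<beta>)\<close>. Hence \<open>\<bar>ln B - ln A\<bar> \<le> \<bar>A\<^sup>-\<^sup>1\<^sup>/\<^sup>2 (B - A) B\<^sup>-\<^sup>1\<^sup>/\<^sup>2\<bar>\<close> in the Hilbert-Schmidt norm,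
  and for \<open>A = g g*\<close>, \<open>B = g e\<^sup>Z g*\<close> the right-hand side is \<open>\<bar>2 sinh (Z/2)\<bar>\<close> by unitary invariance.
  Cutting the geodesic \<open>t \<mapsto> g e\<^bsup>tZ\<^esup> g*\<close> into \<open>n\<close> pieces improves the bound for its endpoints to
  \<open>n \<bar>2 sinh (Z/2n)\<bar>\<close>, which tends to \<open>\<bar>Z\<bar>\<close>. No derivative of the logarithm of an operator is
  needed.\<close>

section \<open>Complex inner products and orthonormal systems\<close>

text \<open>Why cutting is needed: a single comparison of matrix entries yields the norm of 2 sinh
  (Z/2), in general larger than that of Z. But it applies again from every point of the path, with g
  replaced by g e^(sZ/2). Over a step of length h it loses at most a factor exp (h M), with M
  bounding the eigenvalues of Z in absolute value, and this tends to 1.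

  Elements of \<open>Sigma_mfd\<close> are \<open>l *\<^sub>R P\<close> with l > 0 and P - 1
  Hilbert-Schmidt. The scalars form a flat factor: they enter sides and angles through logarithms of
  ratios, for which the law of cosines is an equality. In the other factor initial velocities become
  logarithms of P^(-1/2) Q P^(-1/2).

  Since P - 1 is compact, an orthonormal eigenbasis turns functional calculus into arithmetic on
  eigenvalues, and Lipschitz bounds there into Hilbert-Schmidt bounds. The latter are indispensable,
  as initial velocities are limits in \<open>norm2\<close>, which operator norm estimates do not
  control.\<close>

lemma scaleC_zero_left [simp]: "0 *\<^sub>C (x::'a::complex_hilbert) = 0"
  using scaleC_of_real[of 0 x] by simp

lemma scaleC_zero_right [simp]: "c *\<^sub>C (0::'a::complex_hilbert) = 0"
  by (metis norm_eq_zero norm_scaleC norm_zero mult_zero_right)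

lemma cinner_self: "cinner x x = complex_of_real ((norm (x::'a::complex_hilbert))\<^sup>2)"
  using cinner_commute[of x x] Re_cinner[of x x]
  by (auto simp: complex_eq_iff power2_norm_eq_inner)

lemma cinner_add_right: "cinner x (y + z) = cinner x y + cinner (x::'a::complex_hilbert) z"
  by (metis cinner_add_left cinner_commute complex_cnj_add)

lemma cinner_scaleC_right: "cinner x (c *\<^sub>C y) = cnj c * cinner (x::'a::complex_hilbert) y"
  by (metis cinner_scaleC_left cinner_commute complex_cnj_mult)

lemma cinner_scaleR_left: "cinner (r *\<^sub>R x) y = r *\<^sub>R cinner (x::'a::complex_hilbert) y"
  by (metis cinner_scaleC_left scaleC_of_real scaleR_conv_of_real)

lemma cinner_scaleR_right: "cinner x (r *\<^sub>R y) = r *\<^sub>R cinner (x::'a::complex_hilbert) y"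
  by (metis cinner_commute cinner_scaleR_left complex_cnj_scaleR)

text \<open>Multiplying x by a unimodular scalar makes the inner product real and nonnegative, which
  reduces the claim to the real Cauchy-Schwarz inequality.\<close>

lemma cmod_cinner_le: "cmod (cinner x y) \<le> norm x * norm (y::'a::complex_hilbert)"
proof (cases "cinner x y = 0")
  case False
  define c where "c = cnj (cinner x y) / cmod (cinner x y)"
  have c: "cmod c = 1" using False by (simp add: c_def norm_divide)
  have "cinner x y * cnj (cinner x y) = complex_of_real (cmod (cinner x y)) * complex_of_real (cmod (cinner x y))"
    by (simp only: complex_norm_square[symmetric] power2_eq_square of_real_mult)
  then have "cinner (c *\<^sub>C x) y = cmod (cinner x y)"
    using False by (simp add: cinner_scaleC_left c_def mult.commute)
  then have "cmod (cinner x y) = inner (c *\<^sub>C x) y"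
    by (metis Re_cinner Re_complex_of_real)
  also have "\<dots> \<le> norm (c *\<^sub>C x) * norm y" by (rule norm_cauchy_schwarz)
  finally show ?thesis by (simp add: norm_scaleC c)
qed simp

lemma bounded_linear_cinner_left: "bounded_linear (\<lambda>x. cinner x (y::'a::complex_hilbert))"
  by (rule bounded_linear_intro[where K = "norm y"])
     (simp_all add: cinner_add_left cinner_scaleR_left cmod_cinner_le)

lemma bounded_linear_cinner_right: "bounded_linear (\<lambda>y. cinner (x::'a::complex_hilbert) y)"
  by (rule bounded_linear_intro[where K = "norm x"])
     (simp_all add: cinner_add_right cinner_scaleR_right,
      metis cmod_cinner_le mult.commute)

lemmas cinner_diff_left = linear_diff[OF bounded_linear.linear[OF bounded_linear_cinner_left]]
  and cinner_diff_right = linear_diff[OF bounded_linear.linear[OF bounded_linear_cinner_right]]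
  and cinner_zero_left [simp] = linear_0[OF bounded_linear.linear[OF bounded_linear_cinner_left]]
  and cinner_zero_right [simp] = linear_0[OF bounded_linear.linear[OF bounded_linear_cinner_right]]
  and cinner_sum_left = linear_sum[OF bounded_linear.linear[OF bounded_linear_cinner_left]]
  and cinner_sum_right = linear_sum[OF bounded_linear.linear[OF bounded_linear_cinner_right]]
  and tendsto_cinner_left = bounded_linear.tendsto[OF bounded_linear_cinner_left]

lemma cinner_eqI:
  fixes x y :: "'a::complex_hilbert"
  assumes "\<And>z. cinner x z = cinner y z"
  shows "x = y"
proof -
  have "cinner (x - y) (x - y) = 0" using assms by (simp add: cinner_diff_left)
  then show ?thesis by (simp add: cinner_self)
qed

lemma cmod_cinner_commute: "cmod (cinner x y) = cmod (cinner (y::'a::complex_hilbert) x)"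
  by (metis cinner_commute complex_mod_cnj)

section \<open>Orthonormal systems: Bessel, Riesz-Fischer, Parseval\<close>

definition orthonormal :: "'a::complex_hilbert set \<Rightarrow> bool" where
  "orthonormal E \<longleftrightarrow> (\<forall>x\<in>E. \<forall>y\<in>E. cinner x y = (if x = y then 1 else 0))"

text \<open>Totality instead of density of the span: a maximal orthonormal system of eigenvectors
  yields it directly, and it is what allows comparing vectors coefficientwise.\<close>

definition onb :: "'a::complex_hilbert set \<Rightarrow> bool" where
  "onb E \<longleftrightarrow> orthonormal E \<and> (\<forall>x. (\<forall>e\<in>E. cinner x e = 0) \<longrightarrow> x = 0)"

lemma orthonormal_norm: "orthonormal E \<Longrightarrow> e \<in> E \<Longrightarrow> norm e = 1"
  using cinner_self[of e] abs_norm_cancel[of e] unfolding orthonormal_def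
  by (auto simp: abs_square_eq_1 simp flip: of_real_power)

lemma orthonormal_basis_imp_onb:
  assumes "orthonormal_basis E"
  shows "onb E"
  unfolding onb_def
proof (intro conjI allI impI)
  show "orthonormal E" using assms by (simp add: orthonormal_def orthonormal_basis_def)
  fix x assume x: "\<forall>e\<in>E. cinner x e = 0"
  interpret C: vector_space "scaleC :: complex \<Rightarrow> 'a \<Rightarrow> 'a" by (rule vector_space_scaleC)
  have "cinner x y = 0" if "y \<in> cspan E" for y
    using that by (induction rule: C.span_induct_alt)
      (simp_all add: x cinner_add_right cinner_scaleC_right)
  then have "cspan E \<subseteq> (\<lambda>y. cinner x y) -` {0}" by auto
  moreover have "closed ((\<lambda>y. cinner x y) -` {0})"
    by (intro continuous_closed_vimage closed_singleton
        linear_continuous_at[OF bounded_linear_cinner_right])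
  ultimately have "closure (cspan E) \<subseteq> (\<lambda>y. cinner x y) -` {0}"
    by (rule closure_minimal)
  then have "cinner x x = 0" using assms by (auto simp: orthonormal_basis_def)
  then show "x = 0" by (simp add: cinner_self)
qed

lemma onb_eqI:
  assumes "onb E" "\<And>e. e \<in> E \<Longrightarrow> cinner x e = cinner y e"
  shows "x = y"
  using assms unfolding onb_def by (metis cinner_diff_left right_minus_eq)

lemma cinner_orthonormal_sum:
  assumes "orthonormal E" "finite F" "F \<subseteq> E" "e \<in> E"
  shows "cinner (\<Sum>f\<in>F. c f *\<^sub>C f) e = (if e \<in> F then c e else 0)"
proof -
  have "cinner (\<Sum>f\<in>F. c f *\<^sub>C f) e = (\<Sum>f\<in>F. if f = e then c f else 0)"
    unfolding cinner_sum_left cinner_scaleC_left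
    using assms by (intro sum.cong) (auto simp: orthonormal_def)
  then show ?thesis using assms(2) by simp
qed

lemma norm_orthonormal_sum:
  assumes "orthonormal E" "finite F" "F \<subseteq> E"
  shows "(norm (\<Sum>f\<in>F. c f *\<^sub>C f))\<^sup>2 = (\<Sum>f\<in>F. (cmod (c f))\<^sup>2)"
proof -
  have "cinner (\<Sum>f\<in>F. c f *\<^sub>C f) (\<Sum>f\<in>F. c f *\<^sub>C f)
      = (\<Sum>e\<in>F. cnj (c e) * (if e \<in> F then c e else 0))"
    unfolding cinner_sum_right cinner_scaleC_right
    using assms
    by (intro sum.cong refl arg_cong2[where f = "(*)"] cinner_orthonormal_sum[OF assms]) auto
  also have "\<dots> = (\<Sum>e\<in>F. complex_of_real ((cmod (c e))\<^sup>2))"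
    by (intro sum.cong refl) (simp add: complex_norm_square mult.commute del: of_real_power)
  finally show ?thesis
    unfolding cinner_self of_real_sum[symmetric] of_real_eq_iff .
qed

lemma bessel:
  assumes "orthonormal E" "finite F" "F \<subseteq> E"
  shows "(\<Sum>f\<in>F. (cmod (cinner x f))\<^sup>2) \<le> (norm x)\<^sup>2"
proof -
  define p where "p = (\<Sum>f\<in>F. cinner x f *\<^sub>C f)"
  have np: "(norm p)\<^sup>2 = (\<Sum>f\<in>F. (cmod (cinner x f))\<^sup>2)"
    unfolding p_def by (rule norm_orthonormal_sum[OF assms])
  have "cinner x p = (\<Sum>f\<in>F. cnj (cinner x f) * cinner x f)"
    unfolding p_def cinner_sum_right cinner_scaleC_right ..
  also have "\<dots> = complex_of_real (\<Sum>f\<in>F. (cmod (cinner x f))\<^sup>2)"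
    unfolding of_real_sum by (intro sum.cong refl) (metis complex_norm_square mult.commute)
  finally have "inner x p = (norm p)\<^sup>2" unfolding np
    by (metis Re_cinner Re_complex_of_real)
  then have "(norm (x - p))\<^sup>2 = (norm x)\<^sup>2 - (norm p)\<^sup>2"
    by (simp add: power2_norm_eq_inner inner_diff inner_commute)
  then show ?thesis unfolding np[symmetric] by (metis diff_ge_0_iff_ge zero_le_power2)
qed

lemma summable_on_bounded_nonneg:
  fixes f :: "'b \<Rightarrow> real"
  assumes "\<And>x. x \<in> A \<Longrightarrow> 0 \<le> f x" "\<And>F. finite F \<Longrightarrow> F \<subseteq> A \<Longrightarrow> sum f F \<le> K"
  shows "f summable_on A"
  using assms by (intro nonneg_bdd_above_summable_on bdd_aboveI[where M = K]) auto

text \<open>Riesz--Fischer. The vector is a limit of finite partial sums, which avoids unconditional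
  sums of vectors.\<close>

lemma riesz_fischer:
  fixes E :: "'a::complex_hilbert set"
  assumes E: "orthonormal E" and c: "((\<lambda>e. (cmod (c e))\<^sup>2) has_sum K) E"
  shows "\<exists>x. (\<forall>e\<in>E. cinner x e = c e) \<and> (norm x)\<^sup>2 = K"
proof -
  let ?q = "\<lambda>e. (cmod (c e))\<^sup>2"
  have "\<exists>F. finite F \<and> F \<subseteq> E \<and> dist (sum ?q F) K \<le> 1 / real (Suc n)" for n
    by (rule has_sum_finite_approximation[OF c]) simp
  then obtain F where F: "\<And>n. finite (F n)" "\<And>n. F n \<subseteq> E"
      "\<And>n. dist (sum ?q (F n)) K \<le> 1 / real (Suc n)" by metis
  define X where "X A = (\<Sum>e\<in>A. c e *\<^sub>C e)" for A
  \<comment> \<open>A finite set disjoint from \<open>F n\<close> carries at most the mass that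
    \<open>F n\<close> misses.\<close>
  have tail: "sum ?q A \<le> 1 / real (Suc n)" if "finite A" "A \<subseteq> E" "A \<inter> F n = {}" for A n
  proof -
    have "sum ?q A + sum ?q (F n) = sum ?q (A \<union> F n)"
      using that F by (subst sum.union_disjoint) auto
    also have "\<dots> \<le> K"
      using that F by (intro finite_sum_le_has_sum[OF c]) auto
    finally show ?thesis using F(3)[of n] by (auto simp: dist_real_def)
  qed
  have nX: "norm (X A) \<le> sqrt (1 / real (Suc n))" if "finite A" "A \<subseteq> E" "A \<inter> F n = {}" for A n
    using tail[OF that] norm_orthonormal_sum[OF E that(1,2), of c]
    by (metis X_def real_le_rsqrt)
  have d0: "(\<lambda>n. sqrt (1 / real (Suc n))) \<longlonglongrightarrow> sqrt 0"
    by (intro tendsto_intros LIMSEQ_inverse_real_of_nat[unfolded inverse_eq_divide])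
  have "Cauchy (\<lambda>n. X (F n))"
  proof (rule metric_CauchyI)
    fix r :: real assume "r > 0"
    then have "\<forall>\<^sub>F n in sequentially. sqrt (1 / real (Suc n)) < r / 2"
      using d0 by (intro order_tendstoD(2)[OF d0]) auto
    then obtain N where N: "\<And>n. n \<ge> N \<Longrightarrow> sqrt (1 / real (Suc n)) < r / 2"
      by (auto simp: eventually_sequentially)
    have "dist (X (F m)) (X (F n)) < r" if "m \<ge> N" "n \<ge> N" for m n
    proof -
      \<comment> \<open>The common part cancels in the difference, and each remainder avoids one of
        the two index sets, so \<open>nX\<close> applies to it.\<close>
      have s: "X (F m) = X (F m \<inter> F n) + X (F m - F n)" "X (F n) = X (F m \<inter> F n) + X (F n - F m)"
        using F(1) sum.Int_Diff[of "F m" _ "F n"] sum.Int_Diff[of "F n" _ "F m"]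
        by (auto simp: X_def Int_commute)
      have "norm (X (F m - F n) - X (F n - F m)) \<le> norm (X (F m - F n)) + norm (X (F n - F m))"
        by (rule norm_triangle_ineq4)
      also have "\<dots> \<le> sqrt (1 / real (Suc n)) + sqrt (1 / real (Suc m))"
        using F by (intro add_mono nX) auto
      finally show ?thesis using N that unfolding dist_norm s
        by (smt (verit, best) add_diff_cancel_left field_sum_of_halves)
    qed
    then show "\<exists>M. \<forall>m\<ge>M. \<forall>n\<ge>M. dist (X (F m)) (X (F n)) < r" by blast
  qed
  then obtain x where x: "(\<lambda>n. X (F n)) \<longlonglongrightarrow> x"
    using Cauchy_convergent_iff convergent_def by blast
  have "cinner x e = c e" if e: "e \<in> E" for e
  proof -
    have "cmod (cinner (X (F n)) e - c e) \<le> sqrt (1 / real (Suc n))" for n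
    proof (cases "e \<in> F n")
      case True
      have "cinner (X (F n)) e = c e"
        unfolding X_def using cinner_orthonormal_sum[OF E F(1) F(2) e, of c] True by simp
      then show ?thesis by simp
    next
      case False
      have "cinner (X (F n)) e = 0"
        unfolding X_def using cinner_orthonormal_sum[OF E F(1) F(2) e, of c] False by simp
      moreover have "(cmod (c e))\<^sup>2 \<le> 1 / real (Suc n)"
        using tail[of "{e}" n] e False by simp
      ultimately show ?thesis using real_le_rsqrt[of "cmod (c e)"] by simp
    qed
    then have lim: "(\<lambda>n. cinner (X (F n)) e - c e) \<longlonglongrightarrow> 0"
      by (intro Lim_null_comparison[OF always_eventually d0[unfolded real_sqrt_zero]]) blast
    show ?thesis
      by (rule LIMSEQ_unique[OF tendsto_cinner_left[OF x] LIM_zero_cancel[OF lim]])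
  qed
  moreover have "(norm x)\<^sup>2 = K"
  proof -
    have "(\<lambda>n. (norm (X (F n)))\<^sup>2) \<longlonglongrightarrow> (norm x)\<^sup>2" using x by (intro tendsto_intros)
    then have lim: "(\<lambda>n. sum ?q (F n)) \<longlonglongrightarrow> (norm x)\<^sup>2"
      unfolding X_def norm_orthonormal_sum[OF E F(1,2)] .
    have "(\<lambda>n. sum ?q (F n)) \<longlonglongrightarrow> K"
      using F(3) by (intro metric_tendsto_imp_tendsto[OF LIMSEQ_inverse_real_of_nat])
        (auto simp: dist_real_def inverse_eq_divide)
    with lim show ?thesis by (rule LIMSEQ_unique)
  qed
  ultimately show ?thesis by blast
qed

text \<open>Bessel makes the coefficients square summable; the vector that Riesz-Fischer builds from
  them is x by totality, and its norm is known.\<close>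

lemma parseval:
  assumes "onb E"
  shows "((\<lambda>e. (cmod (cinner x e))\<^sup>2) has_sum (norm x)\<^sup>2) E"
proof -
  have E: "orthonormal E" using assms by (simp add: onb_def)
  have s: "(\<lambda>e. (cmod (cinner x e))\<^sup>2) summable_on E"
    by (rule summable_on_bounded_nonneg) (auto intro: bessel[OF E])
  obtain y where y: "\<forall>e\<in>E. cinner y e = cinner x e"
      "(norm y)\<^sup>2 = infsum (\<lambda>e. (cmod (cinner x e))\<^sup>2) E"
    using riesz_fischer[OF E has_sum_infsum[OF s]] by blast
  have "y = x" using y by (intro onb_eqI[OF assms]) auto
  then show ?thesis using has_sum_infsum[OF s] y by simp
qed

section \<open>Adjoints and diagonal operators\<close>

lemma has_sum_diff:
  fixes f g :: "'b \<Rightarrow> 'c::real_normed_vector"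
  assumes "(f has_sum a) A" "(g has_sum b) A"
  shows "((\<lambda>x. f x - g x) has_sum a - b) A"
  using has_sum_add[OF assms(1)
      has_sum_bounded_linear[OF bounded_linear_minus[OF bounded_linear_ident] assms(2)]] by simp

lemma polarization: "inner x y = ((norm (x + y))\<^sup>2 - (norm (x - y))\<^sup>2) / (4::real)"
  for x y :: "'a::real_inner"
  by (simp add: power2_norm_eq_inner inner_add inner_diff inner_commute)

text \<open>Polarization reduces this to Parseval for u + v and u - v.\<close>

lemma inner_has_sum:
  assumes "onb E"
  shows "((\<lambda>e. Re (cinner u e * cnj (cinner v e))) has_sum inner u v) E"
proof -
  have "((\<lambda>e. ((cmod (cinner (u + v) e))\<^sup>2 - (cmod (cinner (u - v) e))\<^sup>2) / 4) has_sum inner u v) E"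
    unfolding polarization by (intro has_sum_divide_const has_sum_diff parseval assms)
  moreover have "((cmod (cinner (u + v) e))\<^sup>2 - (cmod (cinner (u - v) e))\<^sup>2) / 4
      = Re (cinner u e * cnj (cinner v e))" for e
    unfolding cinner_add_left cinner_diff_left cmod_power2
    by (simp add: power2_eq_square algebra_simps)
  ultimately show ?thesis by simp
qed

text \<open>Complex identities thereby follow from real ones, the imaginary part being a real inner
  product with a rotated vector.\<close>

lemma Im_cinner: "Im (cinner x y) = inner x (\<i> *\<^sub>C y)" for x y :: "'a::complex_hilbert"
  by (simp add: Re_cinner[symmetric] cinner_scaleC_right)

lemmas blinfun_simps = blinfun.add_left blinfun.diff_left blinfun.scaleR_left blinfun.minus_left
  blinfun.add_right blinfun.diff_right blinfun.scaleR_right blinfun.minus_right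

lemma blinfun_compose_assoc: "(A o\<^sub>L B) o\<^sub>L C = A o\<^sub>L (B o\<^sub>L C)"
  by (rule blinfun_eqI) simp

text \<open>A relation, because \<open>adj\<close> is a description that says nothing before
  existence is shown; the relation passes through sums and products on its own.\<close>

definition adjp :: "('a::complex_hilbert \<Rightarrow>\<^sub>L 'a) \<Rightarrow> ('a \<Rightarrow>\<^sub>L 'a) \<Rightarrow> bool" where
  "adjp T S \<longleftrightarrow> (\<forall>x y. cinner (T x) y = cinner x (S y))"

lemma adjpD: "adjp T S \<Longrightarrow> cinner (blinfun_apply T x) y = cinner x (blinfun_apply S y)"
  by (simp add: adjp_def)

lemma adjp_sym:
  assumes "adjp T S" shows "adjp S T"
  unfolding adjp_def
proof (intro allI)
  show "cinner (S x) y = cinner x (T y)" for x y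
    unfolding cinner_commute[of "S x" y] cinner_commute[of x "T y"] adjpD[OF assms] ..
qed

text \<open>\<open>cinner\<close> is complex linear in its first argument, and the adjoint relation
  moves T away from there.\<close>

lemma adjp_bounded_ops:
  assumes "adjp T S" shows "T \<in> bounded_ops"
proof -
  have "T (c *\<^sub>C x) = c *\<^sub>C T x" for c x
    by (rule cinner_eqI) (simp only: adjpD[OF assms] cinner_scaleC_left)
  then show ?thesis by (simp add: bounded_ops_def)
qed

lemma adjp_unique:
  assumes "adjp T S" "adjp T S'" shows "S = S'"
proof (rule blinfun_eqI, rule cinner_eqI)
  show "cinner (S x) z = cinner (S' x) z" for x z
    using assms[THEN adjp_sym] by (simp add: adjp_def)
qed

lemma adj_eqI:
  assumes "adjp T S" shows "adj T = S"
  unfolding adj_def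
proof (rule the_equality)
  show "S \<in> bounded_ops \<and> (\<forall>x y. cinner (T x) y = cinner x (S y))"
    using assms adjp_bounded_ops[OF adjp_sym[OF assms]] by (simp add: adjp_def)
  show "R = S" if "R \<in> bounded_ops \<and> (\<forall>x y. cinner (T x) y = cinner x (R y))" for R
    using that by (intro adjp_unique[OF _ assms]) (simp add: adjp_def)
qed

lemma adjp_add: "adjp T S \<Longrightarrow> adjp T' S' \<Longrightarrow> adjp (T + T') (S + S')"
  by (simp add: adjp_def blinfun_simps cinner_add_left cinner_add_right)

lemma adjp_diff: "adjp T S \<Longrightarrow> adjp T' S' \<Longrightarrow> adjp (T - T') (S - S')"
  by (simp add: adjp_def blinfun_simps cinner_diff_left cinner_diff_right)

lemma adjp_scaleR: "adjp T S \<Longrightarrow> adjp (r *\<^sub>R T) (r *\<^sub>R S)"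
  by (simp add: adjp_def blinfun_simps cinner_scaleR_left cinner_scaleR_right)

lemma adjp_compose: "adjp T S \<Longrightarrow> adjp T' S' \<Longrightarrow> adjp (T o\<^sub>L T') (S' o\<^sub>L S)"
  by (simp add: adjp_def)

lemma adjp_id: "adjp id_blinfun id_blinfun"
  by (simp add: adjp_def)

lemma bounded_opsD: "T \<in> bounded_ops \<Longrightarrow> blinfun_apply T (c *\<^sub>C x) = c *\<^sub>C blinfun_apply T x"
  by (simp add: bounded_ops_def)

lemma scaleR_scaleC: "r *\<^sub>R c *\<^sub>C (x::'a::complex_hilbert) = c *\<^sub>C r *\<^sub>R x"
  by (metis mult.commute scaleC_of_real scaleC_scaleC)

lemma scalar_op_of_real: "scalar_op (complex_of_real r) = r *\<^sub>R id_blinfun"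
  by (rule blinfun_eqI) (simp add: scalar_op.rep_eq scaleC_of_real blinfun_simps)

lemma bounded_ops_add: "T \<in> bounded_ops \<Longrightarrow> S \<in> bounded_ops \<Longrightarrow> T + S \<in> bounded_ops"
  by (simp add: bounded_ops_def blinfun_simps scaleC_add_right)

lemma bounded_ops_scaleR: "T \<in> bounded_ops \<Longrightarrow> r *\<^sub>R T \<in> bounded_ops"
  by (simp add: bounded_ops_def blinfun_simps scaleR_scaleC)

lemma bounded_ops_compose: "T \<in> bounded_ops \<Longrightarrow> S \<in> bounded_ops \<Longrightarrow> T o\<^sub>L S \<in> bounded_ops"
  by (simp add: bounded_ops_def)

lemma bounded_ops_id: "id_blinfun \<in> bounded_ops"
  by (simp add: bounded_ops_def)

lemma bounded_ops_scalar: "scalar_op c \<in> bounded_ops"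
  by (simp add: bounded_ops_def scalar_op.rep_eq scaleC_scaleC mult.commute)

text \<open>Common source of diagonal operators and of adjoints. Riesz-Fischer provides each image
  vector; totality makes the choice linear.\<close>

lemma operator_from_coefficients:
  fixes h :: "'a::complex_hilbert \<Rightarrow> 'a \<Rightarrow> complex"
  assumes E: "onb E"
    and add: "\<And>x y e. e \<in> E \<Longrightarrow> h (x + y) e = h x e + h y e"
    and scale: "\<And>c x e. e \<in> E \<Longrightarrow> h (c *\<^sub>C x) e = c * h x e"
    and bound: "\<And>x F. finite F \<Longrightarrow> F \<subseteq> E \<Longrightarrow> (\<Sum>e\<in>F. (cmod (h x e))\<^sup>2) \<le> (norm x * K)\<^sup>2"
    and K: "K \<ge> 0"
  shows "\<exists>S\<in>bounded_ops. \<forall>x. \<forall>e\<in>E. cinner (blinfun_apply S x) e = h x e"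
proof -
  have "\<exists>z. (\<forall>e\<in>E. cinner z e = h x e) \<and> norm z \<le> norm x * K" for x
  proof -
    have s: "(\<lambda>e. (cmod (h x e))\<^sup>2) summable_on E"
      by (rule summable_on_bounded_nonneg[OF _ bound[of _ x]]) auto
    obtain z where z: "\<forall>e\<in>E. cinner z e = h x e" "(norm z)\<^sup>2 = infsum (\<lambda>e. (cmod (h x e))\<^sup>2) E"
      using riesz_fischer[OF _ has_sum_infsum[OF s]] E unfolding onb_def by blast
    have "(norm z)\<^sup>2 \<le> (norm x * K)\<^sup>2"
      unfolding z(2) using s by (intro infsum_le_finite_sums) (auto intro: bound)
    then have "norm z \<le> norm x * K" using K by (simp add: power2_le_iff_abs_le)
    then show ?thesis using z(1) by blast
  qed
  then obtain f where f: "\<And>x e. e \<in> E \<Longrightarrow> cinner (f x) e = h x e" "\<And>x. norm (f x) \<le> norm x * K"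
    by metis
  have sR: "f (r *\<^sub>R x) = r *\<^sub>R f x" for r x
    by (rule onb_eqI[OF E]) (simp add: f scale cinner_scaleC_left flip: scaleC_of_real)
  have "bounded_linear f"
  proof (rule bounded_linear_intro[OF _ sR f(2)])
    show "f (x + y) = f x + f y" for x y
      by (rule onb_eqI[OF E]) (simp add: f add cinner_add_left)
  qed
  then have app: "blinfun_apply (Blinfun f) = f" by (rule bounded_linear_Blinfun_apply)
  have "f (c *\<^sub>C x) = c *\<^sub>C f x" for c x
    by (rule onb_eqI[OF E]) (simp add: f scale cinner_scaleC_left)
  then have "Blinfun f \<in> bounded_ops" by (simp add: bounded_ops_def app)
  then show ?thesis using f(1) app by (intro bexI[of _ "Blinfun f"]) auto
qed

section \<open>Diagonal operators\<close>

text \<open>An operator that is diagonal in \<open>E\<close>, expressed through its coefficients: this makes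
  uniqueness and self-adjointness immediate from totality of \<open>E\<close>.\<close>

definition diag :: "'a::complex_hilbert set \<Rightarrow> ('a \<Rightarrow> real) \<Rightarrow> ('a \<Rightarrow>\<^sub>L 'a) \<Rightarrow> bool" where
  "diag E \<phi> T \<longleftrightarrow> (\<forall>x. \<forall>e\<in>E. cinner (T x) e = complex_of_real (\<phi> e) * cinner x e)"

lemma diagD: "diag E \<phi> T \<Longrightarrow> e \<in> E \<Longrightarrow> cinner (blinfun_apply T x) e = complex_of_real (\<phi> e) * cinner x e"
  by (simp add: diag_def)

lemma diag_unique:
  assumes "onb E" "diag E \<phi> T" "diag E \<psi> S" "\<And>e. e \<in> E \<Longrightarrow> \<phi> e = \<psi> e"
  shows "T = S"
  by (rule blinfun_eqI, rule onb_eqI[OF assms(1)])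
     (simp add: diagD[OF assms(2)] diagD[OF assms(3)] assms(4))

lemma diag_apply:
  assumes "onb E" "diag E \<phi> T" "e \<in> E"
  shows "blinfun_apply T e = \<phi> e *\<^sub>R e"
  using assms(1,3)
  by (intro onb_eqI[OF assms(1)])
     (auto simp: diagD[OF assms(2)] cinner_scaleR_left onb_def orthonormal_def scaleR_conv_of_real)

lemma diag_compose: "diag E \<phi> T \<Longrightarrow> diag E \<psi> S \<Longrightarrow> diag E (\<lambda>e. \<phi> e * \<psi> e) (T o\<^sub>L S)"
  by (simp add: diag_def)

lemma diag_add: "diag E \<phi> T \<Longrightarrow> diag E \<psi> S \<Longrightarrow> diag E (\<lambda>e. \<phi> e + \<psi> e) (T + S)"
  by (simp add: diag_def blinfun_simps cinner_add_left algebra_simps)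

lemma diag_diff: "diag E \<phi> T \<Longrightarrow> diag E \<psi> S \<Longrightarrow> diag E (\<lambda>e. \<phi> e - \<psi> e) (T - S)"
  by (simp add: diag_def blinfun_simps cinner_diff_left algebra_simps)

lemma diag_scaleR: "diag E \<phi> T \<Longrightarrow> diag E (\<lambda>e. r * \<phi> e) (r *\<^sub>R T)"
  by (simp add: diag_def blinfun_simps cinner_scaleR_left scaleR_conv_of_real)

lemma diag_id: "diag E (\<lambda>_. 1) id_blinfun"
  by (simp add: diag_def)

lemma diag_zero: "diag E (\<lambda>_. 0) 0"
  by (simp add: diag_def)

lemma diag_sum: "(\<And>i. i \<in> I \<Longrightarrow> diag E (\<phi> i) (T i)) \<Longrightarrow> diag E (\<lambda>e. \<Sum>i\<in>I. \<phi> i e) (\<Sum>i\<in>I. T i)"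
  by (induction I rule: infinite_finite_induct) (auto simp: diag_zero intro: diag_add)

text \<open>The coefficients are real, so real parts agree term by term in
  \<open>inner_has_sum\<close>; imaginary parts follow by \<open>Im_cinner\<close>, as T commutes
  with multiplication by i.\<close>

lemma diag_selfadj:
  assumes "onb E" "diag E \<phi> T" shows "adjp T T"
proof -
  have e: "cinner (T x) e = cinner x (T e)" if "e \<in> E" for x e
    using that diag_apply[OF assms that] diagD[OF assms(2) that]
    by (simp add: cinner_scaleR_right scaleR_conv_of_real)
  have c: "T (z *\<^sub>C x) = z *\<^sub>C T x" for z x
    by (rule onb_eqI[OF assms(1)]) (simp add: diagD[OF assms(2)] cinner_scaleC_left)
  have r: "inner (T x) y = inner x (T y)" for x y
  proof -
    have "Re (cinner (T x) e * cnj (cinner y e)) = Re (cinner x e * cnj (cinner (T y) e))"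
      if "e \<in> E" for e by (simp add: diagD[OF assms(2) that] algebra_simps)
    then show ?thesis
      using inner_has_sum[OF assms(1), of "T x" y] inner_has_sum[OF assms(1), of x "T y"]
      by (metis (no_types, lifting) has_sum_cong has_sum_unique)
  qed
  show ?thesis unfolding adjp_def
    by (auto simp: complex_eq_iff Re_cinner Im_cinner r c[symmetric])
qed

lemma diag_bounded_ops: "onb E \<Longrightarrow> diag E \<phi> T \<Longrightarrow> T \<in> bounded_ops"
  using diag_selfadj adjp_bounded_ops by blast

lemma diag_exists:
  assumes E: "onb E" and b: "\<And>e. e \<in> E \<Longrightarrow> \<bar>\<phi> e\<bar> \<le> K"
  shows "\<exists>T. diag E \<phi> T"
proof -
  \<comment> \<open>For empty \<open>E\<close> nothing forces K to be nonnegative.\<close>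
  have K: "\<bar>\<phi> e\<bar> \<le> \<bar>K\<bar>" if "e \<in> E" for e using b[OF that] by linarith
  have "\<exists>S\<in>bounded_ops. \<forall>x. \<forall>e\<in>E. cinner (blinfun_apply S x) e = complex_of_real (\<phi> e) * cinner x e"
  proof (rule operator_from_coefficients[OF E, where K = "\<bar>K\<bar>"])
    fix x F assume F: "finite F" "F \<subseteq> E"
    have "(\<Sum>e\<in>F. (cmod (complex_of_real (\<phi> e) * cinner x e))\<^sup>2)
        \<le> (\<Sum>e\<in>F. \<bar>K\<bar>\<^sup>2 * (cmod (cinner x e))\<^sup>2)"
      unfolding norm_mult power_mult_distrib
      using F K by (intro sum_mono mult_right_mono power_mono) auto
    also have "\<dots> = \<bar>K\<bar>\<^sup>2 * (\<Sum>e\<in>F. (cmod (cinner x e))\<^sup>2)" by (rule sum_distrib_left[symmetric])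
    also have "\<dots> \<le> \<bar>K\<bar>\<^sup>2 * (norm x)\<^sup>2"
      using F E by (intro mult_left_mono bessel[of E]) (auto simp: onb_def)
    finally show "(\<Sum>e\<in>F. (cmod (complex_of_real (\<phi> e) * cinner x e))\<^sup>2) \<le> (norm x * \<bar>K\<bar>)\<^sup>2"
      by (simp add: power_mult_distrib mult.commute)
  qed (simp_all add: cinner_add_left cinner_scaleC_left algebra_simps)
  then show ?thesis unfolding diag_def by blast
qed

lemma norm_diag_le:
  assumes E: "onb E" and D: "diag E \<phi> T" and b: "\<And>e. e \<in> E \<Longrightarrow> \<bar>\<phi> e\<bar> \<le> K" and K: "K \<ge> 0"
  shows "norm T \<le> K"
proof (rule norm_blinfun_bound[OF K])
  fix x
  have "((\<lambda>e. (cmod (cinner (T x) e))\<^sup>2) has_sum (norm (T x))\<^sup>2) E" by (rule parseval[OF E])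
  moreover have "((\<lambda>e. K\<^sup>2 * (cmod (cinner x e))\<^sup>2) has_sum K\<^sup>2 * (norm x)\<^sup>2) E"
    by (intro has_sum_cmult_right parseval[OF E])
  moreover have "(cmod (cinner (T x) e))\<^sup>2 \<le> K\<^sup>2 * (cmod (cinner x e))\<^sup>2" if "e \<in> E" for e
    using b[OF that] unfolding diagD[OF D that] norm_mult power_mult_distrib
    by (intro mult_right_mono power_mono) auto
  ultimately have "(norm (T x))\<^sup>2 \<le> K\<^sup>2 * (norm x)\<^sup>2" by (rule has_sum_mono)
  then have "(norm (T x))\<^sup>2 \<le> (K * norm x)\<^sup>2" by (simp add: power_mult_distrib)
  then show "norm (T x) \<le> K * norm x" by (rule power2_le_imp_le) (simp add: K)
qed

text \<open>The coefficients of S y must be those of y against T e. The adjoint relation then holds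
  for x in the basis and extends to the closed span, which is why density and not just totality is
  assumed.\<close>

lemma adjp_exists:
  fixes T :: "'a::complex_hilbert \<Rightarrow>\<^sub>L 'a" and E :: "'a set"
  assumes E: "orthonormal_basis E" and T: "T \<in> bounded_ops"
  shows "\<exists>S. adjp T S"
proof -
  have onb: "onb E" and on: "orthonormal E"
    using orthonormal_basis_imp_onb[OF E] by (auto simp: onb_def)
  interpret C: vector_space "scaleC :: complex \<Rightarrow> 'a \<Rightarrow> 'a" by (rule vector_space_scaleC)
  have "\<exists>S\<in>bounded_ops. \<forall>y::'a. \<forall>e\<in>E. cinner (blinfun_apply S y) e = cinner y (T e)"
  proof (rule operator_from_coefficients[OF onb, where K = "norm T"])
    fix y F assume F: "finite F" "F \<subseteq> E"
    define s where "s = (\<Sum>e\<in>F. (cmod (cinner y (T e)))\<^sup>2)"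
    \<comment> \<open>Test vector: its squared norm s is also the inner product of y with T z, so s
      is at most |y| |T| |z|, and one factor |z| cancels.\<close>
    define z where "z = (\<Sum>e\<in>F. cinner y (T e) *\<^sub>C e)"
    have nz: "(norm z)\<^sup>2 = s" unfolding z_def s_def by (rule norm_orthonormal_sum[OF on F])
    have "T z = (\<Sum>e\<in>F. cinner y (T e) *\<^sub>C T e)"
      unfolding z_def blinfun.sum_right bounded_opsD[OF T] ..
    then have "cinner y (T z) = (\<Sum>e\<in>F. cnj (cinner y (T e)) * cinner y (T e))"
      by (simp add: cinner_sum_right cinner_scaleC_right)
    also have "\<dots> = complex_of_real s"
      unfolding s_def of_real_sum by (intro sum.cong refl) (metis complex_norm_square mult.commute)
    finally have "cmod (cinner y (T z)) = \<bar>s\<bar>" by simp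
    then have "\<bar>s\<bar> \<le> norm y * norm (T z)" using cmod_cinner_le[of y "T z"] by simp
    also have "\<dots> \<le> norm y * (norm T * norm z)" by (intro mult_left_mono norm_blinfun) auto
    finally have *: "norm z * norm z \<le> (norm y * norm T) * norm z"
      by (simp add: nz[symmetric] power2_eq_square algebra_simps)
    have "norm z \<le> norm y * norm T"
    proof (cases "norm z = 0")
      case False
      then have "0 < norm z" by simp
      then show ?thesis using mult_le_cancel_right_pos * by blast
    qed simp
    then show "s \<le> (norm y * norm T)\<^sup>2" unfolding nz[symmetric] by (rule power_mono) simp
  qed (simp_all add: cinner_add_left cinner_scaleC_left)
  then obtain S where S: "\<And>y e. e \<in> E \<Longrightarrow> cinner (blinfun_apply S y) e = cinner y (T e)" by blast
  have "cinner (T x) y = cinner x (S y)" for x y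
  proof -
    let ?Z = "{x. cinner (T x) y - cinner x (S y) = 0}"
    have "x \<in> ?Z" if "x \<in> cspan E" for x
      using that
    proof (induction rule: C.span_induct_alt)
      case (step c e z)
      have "cinner (T e) y = cinner e (S y)"
        unfolding cinner_commute[of "T e" y] cinner_commute[of e "S y"] S[OF step(1)] ..
      then show ?case using step(2)
        by (simp add: blinfun_simps bounded_opsD[OF T] cinner_add_left cinner_scaleC_left)
    qed simp
    moreover have "closed ?Z"
      by (intro closed_Collect_eq continuous_intros
          linear_continuous_on[OF bounded_linear_compose[OF bounded_linear_cinner_left blinfun.bounded_linear_right]]
          linear_continuous_on[OF bounded_linear_cinner_left])
    ultimately have "closure (cspan E) \<subseteq> ?Z" by (intro closure_minimal) auto
    then show ?thesis using E by (auto simp: orthonormal_basis_def)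
  qed
  then show ?thesis unfolding adjp_def by blast
qed

section \<open>Hilbert-Schmidt operators\<close>

text \<open>Both sums are the double sum of |cinner (T e) f|^2, taken in the two orders. Basis
  independence and invariance under adjoints both come from here.\<close>

lemma adjp_hs_has_sum:
  assumes E: "onb E" and F: "onb F" and ST: "adjp T S"
    and s: "((\<lambda>e. (norm (blinfun_apply T e))\<^sup>2) has_sum s) E"
  shows "((\<lambda>f. (norm (blinfun_apply S f))\<^sup>2) has_sum s) F"
proof -
  let ?g = "\<lambda>(e,f). (cmod (cinner (T e) f))\<^sup>2"
  have inner: "((\<lambda>f. ?g (e, f)) has_sum (norm (T e))\<^sup>2) F" for e
    using parseval[OF F, of "T e"] by simp
  have "?g summable_on E \<times> F"
    using s by (intro summable_on_SigmaI[OF inner]) (auto simp: summable_on_def)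
  then have "(?g has_sum s) (E \<times> F)"
    using has_sum_SigmaI[OF inner s] by blast
  then have "((\<lambda>(f,e). ?g (e,f)) has_sum s) (F \<times> E)" by (subst (asm) has_sum_swap)
  moreover have "((\<lambda>e. (\<lambda>(f,e). ?g (e,f)) (f, e)) has_sum (norm (S f))\<^sup>2) E" for f
    using parseval[OF E, of "S f"] by (simp add: adjpD[OF ST] cmod_cinner_commute)
  ultimately show ?thesis by (rule has_sum_SigmaD)
qed

text \<open>A quadratic polynomial in t without negative values has nonpositive discriminant; this
  is the core of Cauchy-Schwarz for \<open>ip\<close>.\<close>

lemma discriminant_nonneg:
  fixes a b c :: real
  assumes "\<And>t. 0 \<le> a + 2 * t * b + t\<^sup>2 * c" and a: "0 \<le> a" and c: "0 \<le> c"
  shows "\<bar>b\<bar> \<le> sqrt a * sqrt c"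
proof -
  have "b\<^sup>2 \<le> a * c"
  proof (cases "c = 0")
    case True
    have "b = 0"
    proof (rule ccontr)
      assume "b \<noteq> 0"
      \<comment> \<open>At this t the linear polynomial takes the value -1.\<close>
      then have "2 * (- (a + 1) / (2 * b)) * b = - (a + 1)" by simp
      moreover have "0 \<le> a + 2 * t * b" for t using assms(1)[of t] True by simp
      ultimately have "0 \<le> a + - (a + 1)" by metis
      then show False by simp
    qed
    then show ?thesis using True by simp
  next
    case False
    then have "c > 0" using c by simp
    then have "a + 2 * (- b / c) * b + (- b / c)\<^sup>2 * c = (a * c - b\<^sup>2) / c"
      by (simp add: field_simps power2_eq_square)
    then have "0 \<le> (a * c - b\<^sup>2) / c" using assms(1)[of "- b / c"] by simp
    then show ?thesis using \<open>c > 0\<close> by (simp add: zero_le_divide_iff)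
  qed
  then have "sqrt (b\<^sup>2) \<le> sqrt (a * c)" by (rule real_sqrt_le_mono)
  then show ?thesis by (simp add: real_sqrt_mult)
qed

text \<open>A basis is fixed to give \<open>N\<close> a concrete value, shown in
  \<open>hs_has_sum\<close> to be independent of it. Its infinity excludes nonzero scalars from the
  Hilbert-Schmidt class.\<close>

locale hs_space =
  fixes E0 :: "'a::complex_hilbert set"
  assumes basis: "orthonormal_basis E0" and infinite_basis: "infinite E0"
begin

lemma onb0: "onb E0"
  using basis by (rule orthonormal_basis_imp_onb)

lemma adjp_adj: "T \<in> bounded_ops \<Longrightarrow> adjp T (adj T)" for T :: "'a \<Rightarrow>\<^sub>L 'a"
  using adjp_exists[OF basis] adj_eqI by metis

text \<open>The Hilbert-Schmidt norm. A non-summable family would give the default value 0, so the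
  estimates establish membership in \<open>hilbert_schmidt\<close> as well.\<close>

definition N :: "('a \<Rightarrow>\<^sub>L 'a) \<Rightarrow> real" where
  "N T = sqrt (infsum (\<lambda>e. (norm (blinfun_apply T e))\<^sup>2) E0)"

lemma hs_bounded_ops: "T \<in> hilbert_schmidt \<Longrightarrow> T \<in> bounded_ops" for T :: "'a \<Rightarrow>\<^sub>L 'a"
  by (simp add: hilbert_schmidt_def)

text \<open>Passing to the adjoint twice returns to T while the basis changes from F to
  \<open>E0\<close>.\<close>

lemma has_sum_imp_hs:
  assumes T: "T \<in> bounded_ops" and F: "onb F"
    and s: "((\<lambda>e. (norm (blinfun_apply T e))\<^sup>2) has_sum s) F"
  shows "T \<in> hilbert_schmidt" and "(N T)\<^sup>2 = s"
proof -
  have A: "adjp T (adj T)" by (rule adjp_adj[OF T])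
  have "((\<lambda>e. (norm (adj T e))\<^sup>2) has_sum s) E0" by (rule adjp_hs_has_sum[OF F onb0 A s])
  then have h: "((\<lambda>e. (norm (T e))\<^sup>2) has_sum s) E0"
    by (rule adjp_hs_has_sum[OF onb0 onb0 adjp_sym[OF A]])
  then show "T \<in> hilbert_schmidt" using basis T by (auto simp: hilbert_schmidt_def summable_on_def)
  have "0 \<le> s" using h by (rule has_sum_nonneg) auto
  then show "(N T)\<^sup>2 = s" unfolding N_def using infsumI[OF h] by simp
qed

lemma hs_has_sum:
  assumes T: "T \<in> hilbert_schmidt" and F: "onb F"
  shows "((\<lambda>e. (norm (blinfun_apply T e))\<^sup>2) has_sum (N T)\<^sup>2) F"
proof -
  obtain E where E: "orthonormal_basis E" "(\<lambda>e. (norm (T e))\<^sup>2) summable_on E"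
    using T by (auto simp: hilbert_schmidt_def)
  have b: "T \<in> bounded_ops" by (rule hs_bounded_ops[OF T])
  have A: "adjp T (adj T)" by (rule adjp_adj[OF b])
  note h = has_sum_infsum[OF E(2)] and onbE = orthonormal_basis_imp_onb[OF E(1)]
  have "((\<lambda>e. (norm (adj T e))\<^sup>2) has_sum (N T)\<^sup>2) E"
    unfolding has_sum_imp_hs(2)[OF b onbE h] by (rule adjp_hs_has_sum[OF onbE onbE A h])
  then show ?thesis by (rule adjp_hs_has_sum[OF onbE F adjp_sym[OF A]])
qed

lemma N_nonneg: "0 \<le> N T"
  by (simp add: N_def infsum_nonneg)

text \<open>Domination on one basis, chosen freely, is enough; later this is usually an
  eigenbasis.\<close>

lemma hs_le:
  assumes T: "T \<in> bounded_ops" and S: "S \<in> hilbert_schmidt" and F: "onb F" and c: "0 \<le> c"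
    and le: "\<And>e. e \<in> F \<Longrightarrow> norm (blinfun_apply T e) \<le> c * norm (blinfun_apply S e)"
  shows "T \<in> hilbert_schmidt" and "N T \<le> c * N S"
proof -
  have S': "((\<lambda>e. c\<^sup>2 * (norm (S e))\<^sup>2) has_sum c\<^sup>2 * (N S)\<^sup>2) F"
    by (intro has_sum_cmult_right hs_has_sum S F)
  have le2: "(norm (T e))\<^sup>2 \<le> c\<^sup>2 * (norm (S e))\<^sup>2" if "e \<in> F" for e
    using power_mono[OF le[OF that] norm_ge_zero, of 2] by (simp add: power_mult_distrib)
  have "(\<lambda>e. (norm (T e))\<^sup>2) summable_on F"
    by (rule summable_on_comparison_test[OF has_sum_imp_summable[OF S'] le2]) simp_all
  then have T': "((\<lambda>e. (norm (T e))\<^sup>2) has_sum infsum (\<lambda>e. (norm (T e))\<^sup>2) F) F" by simp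
  show "T \<in> hilbert_schmidt" by (rule has_sum_imp_hs(1)[OF T F T'])
  have "(N T)\<^sup>2 \<le> c\<^sup>2 * (N S)\<^sup>2"
    unfolding has_sum_imp_hs(2)[OF T F T'] using T' S' le2 by (rule has_sum_mono)
  then have "(N T)\<^sup>2 \<le> (c * N S)\<^sup>2" by (simp add: power_mult_distrib)
  then show "N T \<le> c * N S" by (rule power2_le_imp_le) (simp add: c N_nonneg)
qed

lemma hs_zero: "(0 :: 'a \<Rightarrow>\<^sub>L 'a) \<in> hilbert_schmidt" "N 0 = 0"
proof -
  have z: "((\<lambda>e. (norm (blinfun_apply 0 e))\<^sup>2) has_sum 0) E0" by simp
  have "(0 :: 'a \<Rightarrow>\<^sub>L 'a) \<in> bounded_ops" by (simp add: bounded_ops_def)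
  from has_sum_imp_hs[OF this onb0 z] show "(0 :: 'a \<Rightarrow>\<^sub>L 'a) \<in> hilbert_schmidt" "N 0 = 0" by auto
qed

text \<open>T vanishes on \<open>E0\<close>, so all coefficients of its adjoint vanish, and totality
  applies to the adjoint.\<close>

lemma N_eq_0:
  assumes T: "T \<in> hilbert_schmidt" and "N T = 0" shows "T = 0"
proof -
  have "(norm (T e))\<^sup>2 = 0" if "e \<in> E0" for e
    using hs_has_sum[OF T onb0] assms(2) that
    by (intro nonneg_has_sum_le_0D[where f = "\<lambda>e. (norm (T e))\<^sup>2"]) auto
  then have d: "diag E0 (\<lambda>_. 0) (adj T)"
    using adjpD[OF adjp_sym[OF adjp_adj[OF hs_bounded_ops[OF T]]]] by (auto simp: diag_def)
  have "adj T = 0" by (rule diag_unique[OF onb0 d diag_zero]) auto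
  then have "adjp 0 T" using adjp_sym[OF adjp_adj[OF hs_bounded_ops[OF T]]] by simp
  moreover have "adjp 0 (0 :: 'a \<Rightarrow>\<^sub>L 'a)" by (simp add: adjp_def)
  ultimately show ?thesis by (rule adjp_unique)
qed

lemma hs_adj:
  assumes "T \<in> hilbert_schmidt" "adjp T S"
  shows "S \<in> hilbert_schmidt" "N S = N T"
proof -
  have h: "((\<lambda>e. (norm (S e))\<^sup>2) has_sum (N T)\<^sup>2) E0"
    by (rule adjp_hs_has_sum[OF onb0 onb0 assms(2) hs_has_sum[OF assms(1) onb0]])
  note has_sum_imp_hs[OF adjp_bounded_ops[OF adjp_sym[OF assms(2)]] onb0 h]
  then show "S \<in> hilbert_schmidt" "N S = N T" using N_nonneg by auto
qed

lemma hs_compose_left: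
  assumes "B \<in> bounded_ops" "T \<in> hilbert_schmidt"
  shows "B o\<^sub>L T \<in> hilbert_schmidt" "N (B o\<^sub>L T) \<le> norm B * N T"
  using hs_le[OF bounded_ops_compose[OF assms(1) hs_bounded_ops[OF assms(2)]] assms(2) onb0,
      of "norm B"]
  by (simp_all add: norm_blinfun)

text \<open>A right factor moves the basis vectors and admits no termwise estimate; adjoints turn it
  into a left factor.\<close>

lemma hs_compose_right:
  assumes "T \<in> hilbert_schmidt" "adjp B B'"
  shows "T o\<^sub>L B \<in> hilbert_schmidt" "N (T o\<^sub>L B) \<le> norm B' * N T"
proof -
  have A: "adjp T (adj T)" by (rule adjp_adj[OF hs_bounded_ops[OF assms(1)]])
  note C = adjp_sym[OF adjp_compose[OF A assms(2)]]
  note H = hs_compose_left[OF adjp_bounded_ops[OF adjp_sym[OF assms(2)]] hs_adj(1)[OF assms(1) A]]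
  show "T o\<^sub>L B \<in> hilbert_schmidt" "N (T o\<^sub>L B) \<le> norm B' * N T"
    using hs_adj[OF H(1) C] H(2) hs_adj(2)[OF assms(1) A] by auto
qed

lemma N_isometry_left:
  assumes "\<And>x. norm (blinfun_apply U x) = norm x" "U \<in> bounded_ops" "T \<in> hilbert_schmidt"
  shows "N (U o\<^sub>L T) = N T"
  unfolding N_def by (simp add: assms(1))

lemma hs_scaleR:
  assumes "T \<in> hilbert_schmidt"
  shows "r *\<^sub>R T \<in> hilbert_schmidt" "N (r *\<^sub>R T) = \<bar>r\<bar> * N T"
proof -
  have "((\<lambda>e. r\<^sup>2 * (norm (T e))\<^sup>2) has_sum r\<^sup>2 * (N T)\<^sup>2) E0"
    by (intro has_sum_cmult_right hs_has_sum assms onb0)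
  then have h: "((\<lambda>e. (norm ((r *\<^sub>R T) e))\<^sup>2) has_sum (r * N T)\<^sup>2) E0"
    by (simp add: blinfun_simps power_mult_distrib)
  note H = has_sum_imp_hs[OF bounded_ops_scaleR[OF hs_bounded_ops[OF assms]] onb0 h]
  show "r *\<^sub>R T \<in> hilbert_schmidt" by (rule H)
  show "N (r *\<^sub>R T) = \<bar>r\<bar> * N T"
    using H(2) N_nonneg[of T] N_nonneg[of "r *\<^sub>R T"]
    by (metis abs_mult abs_of_nonneg power2_eq_iff_nonneg abs_ge_zero mult_nonneg_nonneg power2_abs)
qed

lemma hs_add:
  fixes T S :: "'a \<Rightarrow>\<^sub>L 'a"
  assumes "T \<in> hilbert_schmidt" "S \<in> hilbert_schmidt"
  shows "T + S \<in> hilbert_schmidt"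
proof -
  have le: "(norm ((T + S) e))\<^sup>2 \<le> 2 * (norm (T e))\<^sup>2 + 2 * (norm (S e))\<^sup>2" for e
  proof -
    have "(norm (T e + S e))\<^sup>2 \<le> (norm (T e) + norm (S e))\<^sup>2"
      by (intro power_mono norm_triangle_ineq) auto
    also have "\<dots> \<le> 2 * (norm (T e))\<^sup>2 + 2 * (norm (S e))\<^sup>2"
      using zero_le_power2[of "norm (T e) - norm (S e)"] by (simp add: power2_eq_square algebra_simps)
    finally show ?thesis by (simp add: blinfun_simps)
  qed
  have hs: "((\<lambda>e. 2 * (norm (T e))\<^sup>2 + 2 * (norm (S e))\<^sup>2) has_sum 2 * (N T)\<^sup>2 + 2 * (N S)\<^sup>2) E0"
    by (intro has_sum_add has_sum_cmult_right hs_has_sum assms onb0)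
  have "(\<lambda>e. (norm ((T + S) e))\<^sup>2) summable_on E0"
    by (rule summable_on_comparison_test[OF has_sum_imp_summable[OF hs] le]) simp
  then show ?thesis
    using has_sum_imp_hs(1)[OF bounded_ops_add onb0 has_sum_infsum] assms hs_bounded_ops by blast
qed

lemma hs_uminus: "T \<in> hilbert_schmidt \<Longrightarrow> - T \<in> hilbert_schmidt" for T :: "'a \<Rightarrow>\<^sub>L 'a"
  using hs_scaleR(1)[of T "-1"] by simp

lemma hs_diff:
  fixes T S :: "'a \<Rightarrow>\<^sub>L 'a"
  assumes "T \<in> hilbert_schmidt" "S \<in> hilbert_schmidt"
  shows "T - S \<in> hilbert_schmidt"
  using hs_add[OF assms(1) hs_uminus[OF assms(2)]] by simp

text \<open>The real part of the Hilbert-Schmidt inner product. Through polarization it inherits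
  basis independence and invariance under adjoints from \<open>N\<close>.\<close>

definition ip :: "('a \<Rightarrow>\<^sub>L 'a) \<Rightarrow> ('a \<Rightarrow>\<^sub>L 'a) \<Rightarrow> real" where
  "ip T S = ((N (T + S))\<^sup>2 - (N (T - S))\<^sup>2) / 4"

lemma ip_has_sum:
  assumes "T \<in> hilbert_schmidt" "S \<in> hilbert_schmidt" "onb F"
  shows "((\<lambda>e. inner (blinfun_apply T e) (blinfun_apply S e)) has_sum ip T S) F"
  unfolding ip_def polarization
  by (intro has_sum_divide_const has_sum_diff)
     (use assms hs_has_sum[OF hs_add] hs_has_sum[OF hs_diff] in \<open>auto simp: blinfun_simps\<close>)

lemma ip_eqI:
  assumes "T \<in> hilbert_schmidt" "S \<in> hilbert_schmidt"
    "((\<lambda>e. inner (blinfun_apply T e) (blinfun_apply S e)) has_sum s) E0"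
  shows "ip T S = s"
  using ip_has_sum[OF assms(1,2) onb0] assms(3) has_sum_unique by blast

lemma ip_self: "T \<in> hilbert_schmidt \<Longrightarrow> ip T T = (N T)\<^sup>2"
  using hs_has_sum[OF _ onb0] by (intro ip_eqI) (auto simp: power2_norm_eq_inner)

lemma ip_commute: "T \<in> hilbert_schmidt \<Longrightarrow> S \<in> hilbert_schmidt \<Longrightarrow> ip T S = ip S T"
  using ip_has_sum[OF _ _ onb0, of S T] by (intro ip_eqI) (auto simp: inner_commute)

lemma ip_add_left:
  assumes "T \<in> hilbert_schmidt" "T' \<in> hilbert_schmidt" "S \<in> hilbert_schmidt"
  shows "ip (T + T') S = ip T S + ip T' S"
  using has_sum_add[OF ip_has_sum[OF assms(1,3) onb0] ip_has_sum[OF assms(2,3) onb0]]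
  by (intro ip_eqI hs_add assms) (simp add: blinfun_simps inner_add_left)

lemma ip_scaleR_left:
  assumes "T \<in> hilbert_schmidt" "S \<in> hilbert_schmidt"
  shows "ip (r *\<^sub>R T) S = r * ip T S"
  using has_sum_cmult_right[OF ip_has_sum[OF assms onb0], of r]
  by (intro ip_eqI hs_scaleR assms) (simp add: blinfun_simps)

lemma ip_adj:
  assumes T: "T \<in> hilbert_schmidt" "adjp T T'" and S: "S \<in> hilbert_schmidt" "adjp S S'"
  shows "ip T' S' = ip T S"
  unfolding ip_def
  by (simp add: hs_adj(2)[OF hs_add[OF T(1) S(1)] adjp_add[OF T(2) S(2)]]
      hs_adj(2)[OF hs_diff[OF T(1) S(1)] adjp_diff[OF T(2) S(2)]])

lemma N_add_sq:
  assumes "T \<in> hilbert_schmidt" "S \<in> hilbert_schmidt"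
  shows "(N (T + S))\<^sup>2 = (N T)\<^sup>2 + 2 * ip T S + (N S)\<^sup>2"
  using assms ip_add_left ip_commute hs_add
  by (simp add: ip_self[symmetric])

lemma N_diff_sq:
  assumes "T \<in> hilbert_schmidt" "S \<in> hilbert_schmidt"
  shows "(N (T - S))\<^sup>2 = (N T)\<^sup>2 - 2 * ip T S + (N S)\<^sup>2"
  using N_add_sq[OF assms(1) hs_scaleR(1)[OF assms(2), of "-1"]] assms
    hs_scaleR(2)[OF assms(2), of "-1"] ip_scaleR_left[of S T "-1"] ip_commute hs_uminus
  by simp

lemma ip_Cauchy_Schwarz:
  assumes "T \<in> hilbert_schmidt" "S \<in> hilbert_schmidt"
  shows "\<bar>ip T S\<bar> \<le> N T * N S"
proof -
  have "0 \<le> (N T)\<^sup>2 + 2 * t * ip T S + t\<^sup>2 * (N S)\<^sup>2" for t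
    using zero_le_power2[of "N (T + t *\<^sub>R S)"] N_add_sq[OF assms(1) hs_scaleR(1)[OF assms(2), of t]]
      hs_scaleR[OF assms(2), of t] ip_scaleR_left[OF assms(2,1), of t] assms ip_commute
    by (simp add: power_mult_distrib)
  then have "\<bar>ip T S\<bar> \<le> sqrt ((N T)\<^sup>2) * sqrt ((N S)\<^sup>2)" by (rule discriminant_nonneg) auto
  then show ?thesis by (simp add: N_nonneg)
qed

lemma N_triangle:
  assumes "T \<in> hilbert_schmidt" "S \<in> hilbert_schmidt"
  shows "N (T + S) \<le> N T + N S"
proof -
  have "(N (T + S))\<^sup>2 \<le> (N T + N S)\<^sup>2"
    using N_add_sq[OF assms] ip_Cauchy_Schwarz[OF assms] by (simp add: power2_sum)
  then show ?thesis by (rule power2_le_imp_le) (simp add: N_nonneg)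
qed

text \<open>Rows and columns refer to different bases, so that two operators can be compared in an
  eigenbasis of each.\<close>

lemma hs_coefficients_le:
  assumes A: "onb A" and B: "onb B" and S: "S \<in> bounded_ops" and T: "T \<in> hilbert_schmidt"
    and le: "\<And>a b. a \<in> A \<Longrightarrow> b \<in> B \<Longrightarrow>
      cmod (cinner (blinfun_apply S b) a) \<le> cmod (cinner (blinfun_apply T b) a)"
  shows "N S \<le> N T"
proof -
  have "norm (S b) \<le> 1 * norm (T b)" if b: "b \<in> B" for b
  proof -
    have "(norm (S b))\<^sup>2 \<le> (norm (T b))\<^sup>2"
      using parseval[OF A, of "S b"] parseval[OF A, of "T b"]
      by (rule has_sum_mono) (auto intro: power_mono le b)
    then show ?thesis by simp
  qed
  from hs_le(2)[OF S T B _ this] show ?thesis by simp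
qed

end

section \<open>The spectral theorem for self-adjoint Hilbert-Schmidt operators\<close>

lemma compact_finite_combinations:
  fixes F :: "'a::complex_hilbert set"
  assumes "finite F"
  shows "compact {\<Sum>f\<in>F. c f *\<^sub>C f | c. \<forall>f\<in>F. cmod (c f) \<le> R}"
  using assms
proof (induction F)
  case empty
  then show ?case by simp
next
  case (insert g F)
  let ?C = "\<lambda>F. {\<Sum>f\<in>F. c f *\<^sub>C f | c. \<forall>f\<in>F. cmod (c f) \<le> R}"
  \<comment> \<open>In real coordinates the dependence on z is visibly continuous, so the set is a
    continuous image of a disc times the previous one.\<close>
  have dec: "z *\<^sub>C g = Re z *\<^sub>R g + Im z *\<^sub>R (\<i> *\<^sub>C g)" for z
  proof -
    have "z *\<^sub>C g = (complex_of_real (Re z) + complex_of_real (Im z) * \<i>) *\<^sub>C g"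
      using complex_eq[of z] by (simp add: mult.commute)
    then show ?thesis by (simp add: scaleC_add_left scaleC_of_real flip: scaleC_scaleC)
  qed
  have "compact ((\<lambda>(z, y). (Re z *\<^sub>R g + Im z *\<^sub>R (\<i> *\<^sub>C g)) + y) ` (cball (0::complex) R \<times> ?C F))"
    by (intro compact_continuous_image compact_Times compact_cball insert.IH)
       (auto simp: case_prod_unfold intro!: continuous_intros)
  also have "(\<lambda>(z, y). (Re z *\<^sub>R g + Im z *\<^sub>R (\<i> *\<^sub>C g)) + y) ` (cball (0::complex) R \<times> ?C F) = ?C (insert g F)"
    (is "?L = ?R")
  proof (intro equalityI subsetI)
    fix u assume "u \<in> ?L"
    then obtain z c where u: "cmod z \<le> R" "\<forall>f\<in>F. cmod (c f) \<le> R"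
        "u = (Re z *\<^sub>R g + Im z *\<^sub>R (\<i> *\<^sub>C g)) + (\<Sum>f\<in>F. c f *\<^sub>C f)"
      by auto
    note u(3)[folded dec]
    moreover
    have "(\<Sum>f\<in>F. c f *\<^sub>C f) = (\<Sum>f\<in>F. (c(g := z)) f *\<^sub>C f)"
      using insert.hyps by (intro sum.cong) auto
    ultimately have "u = (\<Sum>f\<in>insert g F. (c(g := z)) f *\<^sub>C f)"
      using insert.hyps by simp
    then show "u \<in> ?R" using u by (intro CollectI exI[of _ "c(g := z)"]) auto
  next
    fix u assume "u \<in> ?R"
    then obtain c where c: "\<forall>f\<in>insert g F. cmod (c f) \<le> R" "u = (\<Sum>f\<in>insert g F. c f *\<^sub>C f)"
      by auto
    then have "u = (\<lambda>(z, y). (Re z *\<^sub>R g + Im z *\<^sub>R (\<i> *\<^sub>C g)) + y) (c g, \<Sum>f\<in>F. c f *\<^sub>C f)"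
      using insert.hyps by (simp add: dec[symmetric])
    then show "u \<in> ?L" using c(1)
      by (intro image_eqI[of _ _ "(c g, \<Sum>f\<in>F. c f *\<^sub>C f)"]) auto
  qed
  finally show ?case .
qed

context hs_space
begin

text \<open>By self-adjointness the coefficients of a x are at most |a f| on the unit ball, so a
  tail of the Hilbert-Schmidt sum bounds the error uniformly in x.\<close>

lemma hs_finite_rank_approximation:
  fixes a :: "'a \<Rightarrow>\<^sub>L 'a"
  assumes a: "a \<in> hilbert_schmidt" and sa: "adjp a a" and e: "e > 0"
  shows "\<exists>F. finite F \<and> F \<subseteq> E0 \<and> (\<forall>x. norm x \<le> 1 \<longrightarrow>
    norm (blinfun_apply a x - (\<Sum>f\<in>F. cinner (a x) f *\<^sub>C f)) \<le> e)"
proof -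
  have h: "((\<lambda>f. (norm (a f))\<^sup>2) has_sum (N a)\<^sup>2) E0" by (rule hs_has_sum[OF a onb0])
  obtain F where F: "finite F" "F \<subseteq> E0" "dist (\<Sum>f\<in>F. (norm (a f))\<^sup>2) ((N a)\<^sup>2) \<le> e\<^sup>2"
    using has_sum_finite_approximation[OF h, of "e\<^sup>2"] e by auto
  have "norm (a x - (\<Sum>f\<in>F. cinner (a x) f *\<^sub>C f)) \<le> e" if x: "norm x \<le> 1" for x
  proof -
    let ?p = "\<Sum>f\<in>F. cinner (a x) f *\<^sub>C f"
    have fin: "((\<lambda>f. if f \<in> F then (norm (a f))\<^sup>2 else 0) has_sum (\<Sum>f\<in>F. (norm (a f))\<^sup>2)) E0"
      using F by (intro has_sum_finite_neutralI[of F]) auto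
    have tail: "((\<lambda>f. (norm (a f))\<^sup>2 - (if f \<in> F then (norm (a f))\<^sup>2 else 0)) has_sum
        (N a)\<^sup>2 - (\<Sum>f\<in>F. (norm (a f))\<^sup>2)) E0"
      by (rule has_sum_diff[OF h fin])
    have "(norm (a x - ?p))\<^sup>2 \<le> (N a)\<^sup>2 - (\<Sum>f\<in>F. (norm (a f))\<^sup>2)"
      using parseval[OF onb0] tail
    proof (rule has_sum_mono)
      fix f assume f: "f \<in> E0"
      have "cinner ?p f = (if f \<in> F then cinner (a x) f else 0)"
        using onb0 F f by (intro cinner_orthonormal_sum) (auto simp: onb_def)
      moreover have "cmod (cinner x (a f)) \<le> norm (a f)"
        using cmod_cinner_le[of x "a f"] mult_right_mono[OF x norm_ge_zero[of "a f"]] by simp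
      ultimately show "(cmod (cinner (a x - ?p) f))\<^sup>2 \<le> (norm (a f))\<^sup>2 - (if f \<in> F then (norm (a f))\<^sup>2 else 0)"
        by (auto simp: cinner_diff_left adjpD[OF sa] intro: power_mono)
    qed
    also have "\<dots> \<le> e\<^sup>2" using F(3) by (simp add: dist_real_def)
    finally show ?thesis by (rule power2_le_imp_le) (use e in simp)
  qed
  then show ?thesis using F by blast
qed

lemma compact_hs_image:
  fixes a :: "'a \<Rightarrow>\<^sub>L 'a"
  assumes a: "a \<in> hilbert_schmidt" and sa: "adjp a a"
  shows "compact (closure (blinfun_apply a ` cball 0 1))"
  unfolding compact_eq_totally_bounded
proof (intro conjI allI impI)
  show "complete (closure (blinfun_apply a ` cball 0 1))"
    by (simp add: complete_eq_closed)
  fix e :: real assume e: "e > 0"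
  obtain F where F: "finite F" "F \<subseteq> E0" and
    app: "\<And>x. norm x \<le> 1 \<Longrightarrow> norm (a x - (\<Sum>f\<in>F. cinner (a x) f *\<^sub>C f)) \<le> e/4"
    using hs_finite_rank_approximation[OF a sa, of "e/4"] e by auto
  let ?C = "{\<Sum>f\<in>F. c f *\<^sub>C f | c. \<forall>f\<in>F. cmod (c f) \<le> norm a}"
  have "\<exists>k. finite k \<and> ?C \<subseteq> (\<Union>x\<in>k. ball x (e/2))"
    using compact_finite_combinations[OF F(1), of "norm a"] e
    unfolding compact_eq_totally_bounded by (meson half_gt_zero)
  then obtain k where k: "finite k" "?C \<subseteq> (\<Union>x\<in>k. ball x (e/2))" by blast
  \<comment> \<open>The radius is e/2 from the net plus e/4 from the approximation. Closed balls
    still cover the closure and fit into open balls of radius e.\<close>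
  have "blinfun_apply a ` cball 0 1 \<subseteq> (\<Union>x\<in>k. cball x (3*e/4))"
  proof
    fix y assume "y \<in> blinfun_apply a ` cball 0 1"
    then obtain x where x: "norm x \<le> 1" "y = a x" by auto
    have "cmod (cinner (a x) f) \<le> norm a" if "f \<in> F" for f
    proof -
      have "norm f = 1" using onb0 F that by (auto simp: onb_def intro: orthonormal_norm)
      then have "cmod (cinner (a x) f) \<le> norm (a x)" using cmod_cinner_le[of "a x" f] by simp
      also have "\<dots> \<le> norm a * norm x" by (rule norm_blinfun)
      also have "\<dots> \<le> norm a" using x(1) by (simp add: mult_left_le)
      finally show ?thesis .
    qed
    then have "(\<Sum>f\<in>F. cinner (a x) f *\<^sub>C f) \<in> ?C" by auto
    then obtain c where c: "c \<in> k" "dist c (\<Sum>f\<in>F. cinner (a x) f *\<^sub>C f) < e/2"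
      using k(2) by auto
    then have "dist c y \<le> e/2 + e/4"
      using app[OF x(1)] dist_triangle[of c y "\<Sum>f\<in>F. cinner (a x) f *\<^sub>C f"] x(2)
      by (simp add: dist_norm norm_minus_commute)
    then show "y \<in> (\<Union>x\<in>k. cball x (3*e/4))" using c(1) by auto
  qed
  then have "closure (blinfun_apply a ` cball 0 1) \<subseteq> (\<Union>x\<in>k. cball x (3*e/4))"
    using k(1) by (intro closure_minimal closed_UN) auto
  also have "\<dots> \<subseteq> (\<Union>x\<in>k. ball x e)" using e by auto
  finally show "\<exists>k. finite k \<and> closure (blinfun_apply a ` cball 0 1) \<subseteq> (\<Union>x\<in>k. ball x e)"
    using k(1) by blast
qed

text \<open>On an invariant subspace, a maximizing sequence for \<open>\<bar>ax\<bar>\<close> has a limit \<open>w\<close> with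
  \<open>a\<^sup>2w = s\<^sup>2w\<close>; then \<open>aw + sw\<close> or \<open>w\<close> is an eigenvector of \<open>a\<close>.\<close>

lemma hs_eigenvector:
  fixes a :: "'a \<Rightarrow>\<^sub>L 'a"
  assumes a: "a \<in> hilbert_schmidt" and sa: "adjp a a"
    and V: "subspace V" "closed V" and inv: "\<And>x. x \<in> V \<Longrightarrow> blinfun_apply a x \<in> V"
    and y: "y \<in> V" "y \<noteq> 0"
  shows "\<exists>v\<in>V. norm v = 1 \<and> (\<exists>r. blinfun_apply a v = r *\<^sub>R v)"
proof -
  have normalize: ?thesis if "u \<in> V" "u \<noteq> 0" "a u = r *\<^sub>R u" for u r
    using that subspace_scale[OF V(1), of u "inverse (norm u)"]
    by (intro bexI[of _ "inverse (norm u) *\<^sub>R u"]) (auto simp: blinfun_simps intro!: exI[of _ r])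
  have sym: "inner (a x) z = inner x (a z)" for x z
    using adjpD[OF sa, of x z] by (metis Re_cinner)
  show ?thesis
  proof (cases "a y = 0")
    case True
    then show ?thesis using normalize[of y 0] y by simp
  next
    case False
    let ?S = "(\<lambda>x. norm (a x)) ` {x\<in>V. norm x \<le> 1}"
    define s where "s = Sup ?S"
    have bdd: "bdd_above ?S"
    proof (rule bdd_aboveI2)
      fix x assume "x \<in> {x\<in>V. norm x \<le> 1}"
      then show "norm (a x) \<le> norm a"
        using norm_blinfun[of a x] mult_left_mono[of "norm x" 1 "norm a"] by auto
    qed
    have le: "norm (a x) \<le> s * norm x" if x: "x \<in> V" for x
    proof (cases "x = 0")
      case False
      have "norm (a (inverse (norm x) *\<^sub>R x)) \<le> s"
        unfolding s_def using x False subspace_scale[OF V(1) x]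
        by (intro cSup_upper[OF _ bdd]) auto
      then show ?thesis using False by (simp add: blinfun_simps field_simps)
    qed simp
    have s0: "s > 0"
    proof (rule ccontr)
      assume "\<not> s > 0"
      then have "s * norm y \<le> 0" by (intro mult_nonpos_nonneg) auto
      then show False using le[OF y(1)] False by (smt (verit) zero_less_norm_iff)
    qed
    have "\<exists>x. x \<in> V \<and> norm x \<le> 1 \<and> s - 1 / real (Suc n) < norm (a x)" for n
    proof -
      have "s - 1 / real (Suc n) < Sup ?S" by (simp add: s_def)
      then show ?thesis using less_cSup_iff[OF _ bdd] subspace_0[OF V(1)] by fastforce
    qed
    then obtain x where x: "\<And>n. x n \<in> V" "\<And>n. norm (x n) \<le> 1"
      "\<And>n. s - 1 / real (Suc n) < norm (a (x n))" by metis
    have "\<forall>n. a (x n) \<in> closure (blinfun_apply a ` cball 0 1)"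
      using x(2) closure_subset by fastforce
    then obtain z r where r: "strict_mono r" and z: "((\<lambda>n. a (x n)) \<circ> r) \<longlonglongrightarrow> z"
      using compact_imp_seq_compact[OF compact_hs_image[OF a sa]] unfolding seq_compact_def by metis
    define X where "X n = x (r n)" for n
    have X: "X n \<in> V" "norm (X n) \<le> 1" for n using x by (auto simp: X_def)
    have zX: "(\<lambda>n. a (X n)) \<longlonglongrightarrow> z" using z by (simp add: X_def o_def)
    have up: "norm (a (X n)) \<le> s" for n
      using le[OF X(1)[of n]] mult_left_mono[OF X(2)[of n] less_imp_le[OF s0]] by simp
    have lim_s: "(\<lambda>n. norm (a (X n))) \<longlonglongrightarrow> s"
    proof (rule tendsto_sandwich)
      show "\<forall>\<^sub>F n in sequentially. s - 1 / real (Suc n) \<le> norm (a (X n))"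
      proof (intro always_eventually allI)
        fix n
        have "real (Suc n) \<le> real (Suc (r n))" using seq_suble[OF r, of n] by simp
        then have "1 / real (Suc (r n)) \<le> 1 / real (Suc n)" by (intro divide_left_mono) auto
        then show "s - 1 / real (Suc n) \<le> norm (a (X n))" using x(3)[of "r n"] by (simp add: X_def)
      qed
      show "(\<lambda>n. s - 1 / real (Suc n)) \<longlonglongrightarrow> s"
        using tendsto_diff[OF tendsto_const LIMSEQ_inverse_real_of_nat, of s]
        by (simp add: inverse_eq_divide)
    qed (use up in auto)
    \<comment> \<open>Expanding the square with |a(ax)| <= s |ax| shows that a maximizing sequence
      is asymptotically in the kernel of a^2 - s^2.\<close>
    have sq: "(norm (a (a (X n)) - s\<^sup>2 *\<^sub>R X n))\<^sup>2 \<le> s\<^sup>2 * (s\<^sup>2 - (norm (a (X n)))\<^sup>2)" for n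
    proof -
      have "(norm (a (a (X n)) - s\<^sup>2 *\<^sub>R X n))\<^sup>2
          = (norm (a (a (X n))))\<^sup>2 - 2 * s\<^sup>2 * (norm (a (X n)))\<^sup>2 + s\<^sup>2 * s\<^sup>2 * (norm (X n))\<^sup>2"
        using sym[of "a (X n)" "X n"]
        by (simp add: power2_norm_eq_inner inner_diff inner_commute algebra_simps)
      moreover have "(norm (a (a (X n))))\<^sup>2 \<le> s\<^sup>2 * (norm (a (X n)))\<^sup>2"
        using power_mono[OF le[OF inv[OF X(1)[of n]]] norm_ge_zero, of 2] by (simp add: power_mult_distrib)
      moreover have "s\<^sup>2 * s\<^sup>2 * (norm (X n))\<^sup>2 \<le> s\<^sup>2 * s\<^sup>2 * 1"
        using power_mono[OF X(2)[of n] norm_ge_zero, of 2] by (intro mult_left_mono) auto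
      ultimately show ?thesis by (simp add: algebra_simps)
    qed
    have "(\<lambda>n. s\<^sup>2 * (s\<^sup>2 - (norm (a (X n)))\<^sup>2)) \<longlonglongrightarrow> s\<^sup>2 * (s\<^sup>2 - s\<^sup>2)"
      by (intro tendsto_intros lim_s)
    then have "(\<lambda>n. s\<^sup>2 * (s\<^sup>2 - (norm (a (X n)))\<^sup>2)) \<longlonglongrightarrow> 0" by simp
    then have "(\<lambda>n. (norm (a (a (X n)) - s\<^sup>2 *\<^sub>R X n))\<^sup>2) \<longlonglongrightarrow> 0"
      by (rule tendsto_sandwich[OF always_eventually always_eventually tendsto_const, rotated 2])
         (use sq in auto)
    then have "(\<lambda>n. sqrt ((norm (a (a (X n)) - s\<^sup>2 *\<^sub>R X n))\<^sup>2)) \<longlonglongrightarrow> sqrt 0"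
      by (rule tendsto_real_sqrt)
    then have l0: "(\<lambda>n. a (a (X n)) - s\<^sup>2 *\<^sub>R X n) \<longlonglongrightarrow> 0"
      by (simp add: tendsto_norm_zero_iff)
    \<comment> \<open>Compactness gives convergence of a (X n) only; that of \<open>X\<close> itself
      follows through \<open>l0\<close>, as s is nonzero.\<close>
    have "(\<lambda>n. a (a (X n))) \<longlonglongrightarrow> a z" by (intro tendsto_intros zX)
    from tendsto_diff[OF this l0] have "(\<lambda>n. s\<^sup>2 *\<^sub>R X n) \<longlonglongrightarrow> a z" by simp
    from tendsto_scaleR[OF tendsto_const this, of "inverse (s\<^sup>2)"]
    have XL: "X \<longlonglongrightarrow> inverse (s\<^sup>2) *\<^sub>R a z" using s0 by simp
    define w where "w = inverse (s\<^sup>2) *\<^sub>R a z"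
    have Xw: "X \<longlonglongrightarrow> w" using XL by (simp add: w_def)
    have w: "w \<in> V" using X(1) closed_sequentially[OF V(2)] Xw by blast
    have "(\<lambda>n. a (X n)) \<longlonglongrightarrow> a w" by (intro tendsto_intros Xw)
    then have aw: "a w = z" using zX LIMSEQ_unique by blast
    have "a z = s\<^sup>2 *\<^sub>R w" using s0 by (simp add: w_def)
    then have aaw: "a (a w) = s\<^sup>2 *\<^sub>R w" by (simp only: aw)
    have "norm (a w) = s"
      using tendsto_norm[OF zX] lim_s LIMSEQ_unique aw by blast
    then have w0: "w \<noteq> 0" using s0 by auto
    show ?thesis
    proof (cases "a w + s *\<^sub>R w = 0")
      case True
      then have "a w = (- s) *\<^sub>R w" by (simp add: eq_neg_iff_add_eq_0)
      then show ?thesis using normalize w w0 by blast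
    next
      case False
      have "a (a w + s *\<^sub>R w) = s *\<^sub>R (a w + s *\<^sub>R w)"
        by (simp add: blinfun_simps aaw power2_eq_square algebra_simps)
      moreover have "a w + s *\<^sub>R w \<in> V"
        by (intro subspace_add subspace_scale V(1) inv w)
      ultimately show ?thesis using normalize False by blast
    qed
  qed
qed

text \<open>Zorn's lemma gives a maximal orthonormal set of eigenvectors. Its orthogonal complement
  is invariant, so a nonzero complement would contain a further eigenvector.\<close>

theorem hs_diagonalizable:
  fixes a :: "'a \<Rightarrow>\<^sub>L 'a"
  assumes a: "a \<in> hilbert_schmidt" and sa: "adjp a a"
  shows "\<exists>F \<phi>. onb F \<and> diag F \<phi> a"
proof -
  define \<A> where "\<A> = {F :: 'a set. orthonormal F \<and> (\<forall>e\<in>F. \<exists>r. a e = r *\<^sub>R e)}"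
  have "\<exists>M\<in>\<A>. \<forall>X\<in>\<A>. M \<subseteq> X \<longrightarrow> X = M"
  proof (rule subset_Zorn_nonempty)
    show "\<A> \<noteq> {}" by (auto simp: \<A>_def orthonormal_def intro!: exI[of _ "{}"])
    fix \<C> assume C: "\<C> \<noteq> {}" "subset.chain \<A> \<C>"
    have CA: "\<C> \<subseteq> \<A>" using C(2) by (simp add: subset_chain_def)
    have "cinner x y = (if x = y then 1 else 0)" if xy: "x \<in> \<Union>\<C>" "y \<in> \<Union>\<C>" for x y
    proof -
      obtain X Y where "x \<in> X" "y \<in> Y" "X \<in> \<C>" "Y \<in> \<C>" using xy by blast
      then obtain Z where "Z \<in> \<C>" "x \<in> Z" "y \<in> Z"
        using C(2) unfolding subset_chain_def by (meson subsetD)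
      then have "Z \<in> \<A>" "x \<in> Z" "y \<in> Z" using CA by auto
      then show ?thesis by (simp add: \<A>_def orthonormal_def)
    qed
    moreover have "\<exists>r. a e = r *\<^sub>R e" if "e \<in> \<Union>\<C>" for e
      using that CA by (auto simp: \<A>_def)
    ultimately show "\<Union>\<C> \<in> \<A>" by (simp add: \<A>_def orthonormal_def)
  qed
  then obtain F where F: "F \<in> \<A>" and max: "\<And>X. X \<in> \<A> \<Longrightarrow> F \<subseteq> X \<Longrightarrow> X = F" by blast
  have on: "orthonormal F" and eig: "\<And>e. e \<in> F \<Longrightarrow> \<exists>r. a e = r *\<^sub>R e" using F by (auto simp: \<A>_def)
  obtain \<phi> where \<phi>: "\<And>e. e \<in> F \<Longrightarrow> a e = \<phi> e *\<^sub>R e" using eig by metis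
  have dg: "diag F \<phi> a"
    by (simp add: diag_def adjpD[OF sa] \<phi> cinner_scaleR_right scaleR_conv_of_real)
  have "x = 0" if x: "\<forall>e\<in>F. cinner x e = 0" for x
  proof (rule ccontr)
    assume "x \<noteq> 0"
    let ?V = "{x. \<forall>e\<in>F. cinner x e = 0}"
    have "?V = (\<Inter>e\<in>F. {x. cinner x e = 0})" by auto
    moreover have "closed {x. cinner x e = 0}" for e :: 'a
      by (intro closed_Collect_eq continuous_intros linear_continuous_on[OF bounded_linear_cinner_left])
    ultimately have "closed ?V" by (simp add: closed_INT)
    moreover have "subspace ?V"
      by (auto simp: subspace_def cinner_add_left cinner_scaleR_left)
    moreover have "a y \<in> ?V" if "y \<in> ?V" for y
      using that by (simp add: diagD[OF dg])
    ultimately obtain v where v: "v \<in> ?V" "norm v = 1" "\<exists>r. a v = r *\<^sub>R v"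
      using hs_eigenvector[OF a sa, of ?V x] x \<open>x \<noteq> 0\<close> by blast
    have vv: "cinner v v = 1" using v(2) by (simp add: cinner_self)
    have "cinner e v = 0" if "e \<in> F" for e
      using v(1) that cinner_commute[of e v] by simp
    then have "insert v F \<in> \<A>"
      using F v vv by (auto simp: \<A>_def orthonormal_def)
    then have "v \<in> F" using max[of "insert v F"] by blast
    then show False using v(1) vv by auto
  qed
  then have "onb F" using on by (simp add: onb_def)
  then show ?thesis using dg by blast
qed

end

section \<open>Functional calculus of diagonalizable operators\<close>

lemma diag_op_power: "diag E \<alpha> T \<Longrightarrow> diag E (\<lambda>e. \<alpha> e ^ n) (op_power T n)"
  by (induction n) (auto simp: diag_id dest: diag_compose)

lemma diag_op_poly:
  assumes "diag E \<alpha> T" shows "diag E (\<lambda>e. poly P (\<alpha> e)) (op_poly P T)"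
  unfolding op_poly_def poly_altdef by (intro diag_sum diag_scaleR diag_op_power assms)

text \<open>Through this inclusion uniform convergence on the spectrum controls the
  eigenvalues.\<close>

lemma op_spectrum_eigenvalue:
  assumes E: "onb E" and D: "diag E \<alpha> T" and e: "e \<in> E"
  shows "complex_of_real (\<alpha> e) \<in> op_spectrum T"
proof -
  have "(T - scalar_op (complex_of_real (\<alpha> e))) e = 0"
    using diag_apply[OF E D e] by (simp add: scalar_op_of_real blinfun_simps)
  moreover have "e \<noteq> 0" using E e orthonormal_norm[of E e] by (auto simp: onb_def)
  ultimately have "S o\<^sub>L (T - scalar_op (complex_of_real (\<alpha> e))) \<noteq> id_blinfun" for S
    by (metis blinfun.zero_right blinfun_apply_blinfun_compose blinfun_apply_id_blinfun)
  then show ?thesis by (auto simp: op_spectrum_def op_invertible_def)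
qed

text \<open>Outside the interval the resolvent is diagonal with entries bounded by 1/d. An interval
  suffices because polynomials approximate f on all of it.\<close>

lemma op_spectrum_bounds:
  assumes E: "onb E" and D: "diag E \<alpha> T" and b: "\<forall>e\<in>E. \<alpha> e \<in> {m..M}"
    and x: "complex_of_real x \<in> op_spectrum T"
  shows "x \<in> {m..M}"
proof (rule ccontr)
  assume nx: "x \<notin> {m..M}"
  define d where "d = max (m - x) (x - M)"
  have d: "d > 0" using nx by (auto simp: d_def)
  have lb: "d \<le> \<bar>\<alpha> e - x\<bar>" if "e \<in> E" for e using b[rule_format, OF that] nx by (auto simp: d_def)
  have D': "diag E (\<lambda>e. \<alpha> e - x) (T - scalar_op (complex_of_real x))"
    unfolding scalar_op_of_real using diag_diff[OF D diag_scaleR[OF diag_id]] by simp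
  have "\<bar>1 / (\<alpha> e - x)\<bar> \<le> 1 / d" if "e \<in> E" for e
    unfolding abs_divide using lb[rule_format, OF that] d by (intro frac_le) auto
  from diag_exists[where \<phi> = "\<lambda>e. 1 / (\<alpha> e - x)", OF E this] obtain R where R: "diag E (\<lambda>e. 1 / (\<alpha> e - x)) R"
    by blast
  have nz: "\<alpha> e - x \<noteq> 0" if "e \<in> E" for e using lb[rule_format, OF that] d by auto
  have "R o\<^sub>L (T - scalar_op (complex_of_real x)) = id_blinfun"
    by (rule diag_unique[OF E diag_compose[OF R D'] diag_id]) (use nz in auto)
  moreover have "(T - scalar_op (complex_of_real x)) o\<^sub>L R = id_blinfun"
    by (rule diag_unique[OF E diag_compose[OF D' R] diag_id]) (use nz in auto)
  ultimately show False
    using x diag_bounded_ops[OF E R] by (auto simp: op_spectrum_def op_invertible_def)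
qed

lemma weierstrass_poly:
  fixes f :: "real \<Rightarrow> real"
  assumes "continuous_on {m..M} f"
  shows "\<exists>P :: nat \<Rightarrow> real poly. uniform_limit {m..M} (\<lambda>n x. poly (P n) x) f sequentially"
proof -
  have "\<exists>P :: real poly. \<forall>x\<in>{m..M}. \<bar>f x - poly P x\<bar> < 1 / real (Suc n)" for n
  proof -
    obtain g where g: "real_polynomial_function g" "\<And>x. x \<in> {m..M} \<Longrightarrow> \<bar>f x - g x\<bar> < 1 / real (Suc n)"
      using Stone_Weierstrass_real_polynomial_function[OF _ assms, of "1 / real (Suc n)"] by auto
    obtain a k where "g = (\<lambda>x. \<Sum>i\<le>k. a i * x ^ i)"
      using g(1) unfolding real_polynomial_function_iff_sum by blast
    then have "g x = poly (\<Sum>i\<le>k. monom (a i) i) x" for x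
      by (simp add: poly_sum poly_monom)
    then show ?thesis using g(2) by metis
  qed
  then obtain P where P: "\<And>n x. x \<in> {m..M} \<Longrightarrow> \<bar>f x - poly (P n) x\<bar> < 1 / real (Suc n)"
    by metis
  have "uniform_limit {m..M} (\<lambda>n x. poly (P n) x) f sequentially"
  proof (rule uniform_limitI)
    fix r :: real assume "r > 0"
    then have "\<forall>\<^sub>F n in sequentially. inverse (real (Suc n)) < r"
      by (intro order_tendstoD(2)[OF LIMSEQ_inverse_real_of_nat])
    then show "\<forall>\<^sub>F n in sequentially. \<forall>x\<in>{m..M}. dist (poly (P n) x) (f x) < r"
    proof eventually_elim
      case (elim n)
      then show ?case using P[of _ n]
        by (force simp: dist_real_def inverse_eq_divide abs_minus_commute)
    qed
  qed
  then show ?thesis by blast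
qed

text \<open>Every admissible sequence of polynomials converges to the diagonal operator. Weierstrass
  provides one such sequence, without which the description in \<open>op_fun\<close> would be
  satisfied vacuously by any operator.\<close>

theorem diag_op_fun:
  assumes E: "onb E" and D: "diag E \<alpha> T" and b: "\<forall>e\<in>E. \<alpha> e \<in> {m..M}"
    and f: "continuous_on {m..M} f"
  shows "diag E (\<lambda>e. f (\<alpha> e)) (op_fun f T)"
proof -
  let ?S = "{x. complex_of_real x \<in> op_spectrum T}"
  obtain K where K: "\<forall>x\<in>{m..M}. \<bar>f x\<bar> \<le> K"
    using compact_imp_bounded[OF compact_continuous_image[OF f compact_Icc]]
    unfolding bounded_iff by auto
  have "\<bar>f (\<alpha> e)\<bar> \<le> K" if "e \<in> E" for e using K b[rule_format, OF that] by blast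
  then obtain S where S: "diag E (\<lambda>e. f (\<alpha> e)) S" using diag_exists[OF E] by metis
  have conv: "(\<lambda>n. op_poly (P n) T) \<longlonglongrightarrow> S"
    if P: "uniform_limit ?S (\<lambda>n x. poly (P n) x) f sequentially" for P
  proof (rule tendstoI)
    fix r :: real assume "r > 0"
    then have "\<forall>\<^sub>F n in sequentially. \<forall>x\<in>?S. dist (poly (P n) x) (f x) < r / 2"
      by (intro uniform_limitD[OF P]) simp
    then show "\<forall>\<^sub>F n in sequentially. dist (op_poly (P n) T) S < r"
    proof eventually_elim
      case (elim n)
      have "norm (op_poly (P n) T - S) \<le> r / 2"
      proof (rule norm_diag_le[OF E diag_diff[OF diag_op_poly[OF D] S]])
        show "\<bar>poly (P n) (\<alpha> e) - f (\<alpha> e)\<bar> \<le> r / 2" if "e \<in> E" for e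
          using elim op_spectrum_eigenvalue[OF E D that] by (force simp: dist_real_def)
      qed (use \<open>r > 0\<close> in simp)
      then show ?case using \<open>r > 0\<close> by (simp add: dist_norm)
    qed
  qed
  obtain P0 :: "nat \<Rightarrow> real poly" where "uniform_limit {m..M} (\<lambda>n x. poly (P0 n) x) f sequentially"
    using weierstrass_poly[OF f] by blast
  then have P0: "uniform_limit ?S (\<lambda>n x. poly (P0 n) x) f sequentially"
    by (rule uniform_limit_on_subset) (use op_spectrum_bounds[OF E D b] in auto)
  have "op_fun f T = S"
    unfolding op_fun_def
    by (rule the_equality) (use conv P0 LIMSEQ_unique in blast)+
  then show ?thesis using S by simp
qed

lemma diag_op_powr:
  assumes "onb E" "diag E \<alpha> T" "\<forall>e\<in>E. \<alpha> e \<in> {m..M}" "0 < m"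
  shows "diag E (\<lambda>e. \<alpha> e powr t) (op_powr T t)"
  unfolding op_powr_def
  by (rule diag_op_fun[OF assms(1-3)]) (use assms(4) in \<open>auto intro!: continuous_intros\<close>)

lemma diag_op_ln:
  assumes "onb E" "diag E \<alpha> T" "\<forall>e\<in>E. \<alpha> e \<in> {m..M}" "0 < m"
  shows "diag E (\<lambda>e. ln (\<alpha> e)) (op_fun ln T)"
  by (rule diag_op_fun[OF assms(1-3)]) (use assms(4) in \<open>auto intro!: continuous_intros\<close>)

lemma diag_lower_bound:
  assumes E: "onb E" and D: "diag E \<alpha> T" and le: "\<And>e. e \<in> E \<Longrightarrow> k \<le> \<alpha> e"
  shows "k * (norm x)\<^sup>2 \<le> inner (blinfun_apply T x) x"
proof (rule has_sum_mono[OF has_sum_cmult_right[OF parseval[OF E]] inner_has_sum[OF E]])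
  fix e assume e: "e \<in> E"
  have "Re (cinner (T x) e * cnj (cinner x e)) = \<alpha> e * (cmod (cinner x e))\<^sup>2"
    unfolding diagD[OF D e] cmod_power2 by (simp add: power2_eq_square algebra_simps)
  then show "k * (cmod (cinner x e))\<^sup>2 \<le> Re (cinner (T x) e * cnj (cinner x e))"
    using le[OF e] by (simp add: mult_right_mono)
qed

text \<open>A Lipschitz bound |f x - f 1| <= L |x - 1| on eigenvalues is what makes f(P) - f(1)
  Hilbert-Schmidt along with P - 1.\<close>

lemma C1_imp_lipschitz:
  fixes f f' :: "real \<Rightarrow> real"
  assumes d: "\<And>z. z \<in> {m..M} \<Longrightarrow> (f has_real_derivative f' z) (at z)"
    and c: "continuous_on {m..M} f'"
  shows "\<exists>L\<ge>0. \<forall>x\<in>{m..M}. \<forall>y\<in>{m..M}. \<bar>f x - f y\<bar> \<le> L * \<bar>x - y\<bar>"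
proof -
  obtain L where L: "\<forall>x\<in>{m..M}. \<bar>f' x\<bar> \<le> L"
    using compact_imp_bounded[OF compact_continuous_image[OF c compact_Icc]]
    unfolding bounded_iff by auto
  \<comment> \<open>On an empty interval L may be negative.\<close>
  have "\<bar>f x - f y\<bar> \<le> max 0 L * \<bar>x - y\<bar>" if "x \<in> {m..M}" "y \<in> {m..M}" for x y
    using field_differentiable_bound[of "{m..M}" f f' "max 0 L" x y] that L
      has_field_derivative_at_within[OF d]
    by (force simp: max.coboundedI2)
  then show ?thesis by (intro exI[of _ "max 0 L"]) auto
qed

lemma powr_lipschitz:
  assumes "0 < m"
  shows "\<exists>L\<ge>0. \<forall>x\<in>{m..M}. \<forall>y\<in>{m..M}. \<bar>x powr t - y powr t\<bar> \<le> L * \<bar>x - y :: real\<bar>"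
  by (rule C1_imp_lipschitz[where f' = "\<lambda>z. t * z powr (t - 1)"])
     (use assms in \<open>auto intro!: continuous_intros derivative_eq_intros simp: powr_diff field_simps\<close>)

lemma ln_lipschitz:
  assumes "0 < m"
  shows "\<exists>L\<ge>0. \<forall>x\<in>{m..M}. \<forall>y\<in>{m..M}. \<bar>ln x - ln y\<bar> \<le> L * \<bar>x - y :: real\<bar>"
  by (rule C1_imp_lipschitz[where f' = "\<lambda>z. 1 / z"])
     (use assms in \<open>auto intro!: continuous_intros derivative_eq_intros\<close>)

section \<open>Positive invertible Hilbert-Schmidt perturbations of the identity\<close>

context hs_space
begin

text \<open>The part of \<open>Sigma_mfd\<close> with scalar part 1. The uniform lower bound encodes
  positivity together with invertibility.\<close>

definition hs_pos :: "('a \<Rightarrow>\<^sub>L 'a) \<Rightarrow> bool" where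
  "hs_pos P \<longleftrightarrow> P - id_blinfun \<in> hilbert_schmidt \<and> adjp P P \<and>
     (\<exists>m>0. \<forall>x. m * (norm x)\<^sup>2 \<le> inner (blinfun_apply P x) x)"

lemma hs_posD:
  assumes "hs_pos P"
  shows "P - id_blinfun \<in> hilbert_schmidt" "adjp P P" "P \<in> bounded_ops"
  using assms adjp_bounded_ops by (auto simp: hs_pos_def)

lemma hs_pos_diag:
  assumes "hs_pos P"
  obtains F \<alpha> m M where "onb F" "diag F \<alpha> P" "0 < m" "m \<le> 1" "1 \<le> M"
    "\<forall>e\<in>F. \<alpha> e \<in> {m..M}"
proof -
  obtain m where m: "m > 0" "\<And>x. m * (norm x)\<^sup>2 \<le> inner (P x) x" using assms by (auto simp: hs_pos_def)
  obtain F \<phi> where F: "onb F" "diag F \<phi> (P - id_blinfun)"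
    using hs_diagonalizable[OF hs_posD(1)[OF assms] adjp_diff[OF hs_posD(2)[OF assms] adjp_id]] by blast
  have D: "diag F (\<lambda>e. \<phi> e + 1) P" using diag_add[OF F(2) diag_id] by simp
  \<comment> \<open>The interval is widened to contain 1, the point with which Lipschitz estimates
    compare.\<close>
  have "\<phi> e + 1 \<in> {min m 1..max (norm P) 1}" if e: "e \<in> F" for e
  proof -
    have Pe: "P e = (\<phi> e + 1) *\<^sub>R e" and ne: "norm e = 1"
      using diag_apply[OF F(1) D e] F(1) e orthonormal_norm by (auto simp: onb_def)
    have "inner (P e) e = \<phi> e + 1" using ne by (simp add: Pe flip: power2_norm_eq_inner)
    then have "m \<le> \<phi> e + 1" using m(2)[of e] ne by simp
    moreover have "\<phi> e + 1 \<le> norm P"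
      using norm_blinfun[of P e] ne by (simp add: Pe)
    ultimately show ?thesis by auto
  qed
  then show thesis using that[OF F(1) D, of "min m 1" "max (norm P) 1"] m(1) by auto
qed

text \<open>In applications \<open>\<beta>\<close> is f of \<open>\<alpha>\<close> and b is f 1, the
  scalar part of f(P).\<close>

lemma diag_hs_lipschitz:
  assumes F: "onb F" and A: "diag F \<alpha> P" and P: "P - id_blinfun \<in> hilbert_schmidt"
    and B: "diag F \<beta> B" and L: "0 \<le> L" and le: "\<And>e. e \<in> F \<Longrightarrow> \<bar>\<beta> e - b\<bar> \<le> L * \<bar>\<alpha> e - 1\<bar>"
  shows "B - b *\<^sub>R id_blinfun \<in> hilbert_schmidt" "N (B - b *\<^sub>R id_blinfun) \<le> L * N (P - id_blinfun)"
proof -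
  have D: "diag F (\<lambda>e. \<beta> e - b * 1) (B - b *\<^sub>R id_blinfun)"
    by (intro diag_diff B diag_scaleR diag_id)
  have D': "diag F (\<lambda>e. \<alpha> e - 1) (P - id_blinfun)"
    by (intro diag_diff A diag_id)
  have "norm ((B - b *\<^sub>R id_blinfun) e) \<le> L * norm ((P - id_blinfun) e)" if "e \<in> F" for e
    unfolding diag_apply[OF F D that] diag_apply[OF F D' that]
    using le[OF that] by (simp add: mult.assoc[symmetric] mult_right_mono)
  note H = hs_le[OF diag_bounded_ops[OF F D] P F L this]
  show "B - b *\<^sub>R id_blinfun \<in> hilbert_schmidt" "N (B - b *\<^sub>R id_blinfun) \<le> L * N (P - id_blinfun)"
    by (rule H; assumption)+
qed

lemma hs_pos_powr:
  assumes P: "hs_pos P"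
  shows "hs_pos (op_powr P t)"
proof -
  obtain F \<alpha> m M where F: "onb F" "diag F \<alpha> P" "0 < m" "m \<le> 1" "1 \<le> M"
    "\<forall>e\<in>F. \<alpha> e \<in> {m..M}" by (rule hs_pos_diag[OF P])
  note D = diag_op_powr[OF F(1,2) F(6) F(3), of t]
  obtain L where L: "L \<ge> 0" "\<And>x y. x \<in> {m..M} \<Longrightarrow> y \<in> {m..M} \<Longrightarrow> \<bar>x powr t - y powr t\<bar> \<le> L * \<bar>x - y\<bar>"
    using powr_lipschitz[OF F(3), of M t] by blast
  have "\<bar>\<alpha> e powr t - 1\<bar> \<le> L * \<bar>\<alpha> e - 1\<bar>" if "e \<in> F" for e
    using L(2)[OF F(6)[rule_format, OF that], of 1] F(4,5) by simp
  then have hs: "op_powr P t - id_blinfun \<in> hilbert_schmidt"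
    using diag_hs_lipschitz(1)[OF F(1,2) hs_posD(1)[OF P] D L(1), of 1] by simp
  \<comment> \<open>The power increases or decreases with the sign of t, so its minimum sits at one
    of the two ends.\<close>
  define k where "k = min (m powr t) (M powr t)"
  have k: "k > 0" using F(3-5) by (simp add: k_def)
  have kle: "k \<le> \<alpha> e powr t" if "e \<in> F" for e
    using F(6)[rule_format, OF that] F(3) powr_mono2[of t m "\<alpha> e"] powr_mono2'[of t "\<alpha> e" M]
    by (cases "t \<ge> 0") (auto simp: k_def intro: min.coboundedI1 min.coboundedI2)
  have "k * (norm x)\<^sup>2 \<le> inner (op_powr P t x) x" for x
    using D kle by (rule diag_lower_bound[OF F(1)])
  then show ?thesis using hs k diag_selfadj[OF F(1) D] by (auto simp: hs_pos_def)
qed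

lemma hs_pos_powr_add:
  assumes P: "hs_pos P"
  shows "op_powr P s o\<^sub>L op_powr P t = op_powr P (s + t)"
proof -
  obtain F \<alpha> m M where F: "onb F" "diag F \<alpha> P" "0 < m" "\<forall>e\<in>F. \<alpha> e \<in> {m..M}"
    using hs_pos_diag[OF P] by metis
  note D = diag_op_powr[OF F(1,2) F(4) F(3)]
  show ?thesis by (rule diag_unique[OF F(1) diag_compose[OF D D] D]) (simp add: powr_add)
qed

lemma hs_pos_powr_0_1:
  assumes P: "hs_pos P"
  shows "op_powr P 0 = id_blinfun" "op_powr P 1 = P"
proof -
  obtain F \<alpha> m M where F: "onb F" "diag F \<alpha> P" "0 < m" "\<forall>e\<in>F. \<alpha> e \<in> {m..M}"
    using hs_pos_diag[OF P] by metis
  note D = diag_op_powr[OF F(1,2) F(4) F(3)]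
  have pos: "\<alpha> e > 0" if "e \<in> F" for e using F(3) F(4)[rule_format, OF that] by simp
  show "op_powr P 0 = id_blinfun"
    by (rule diag_unique[OF F(1) D diag_id]) (use pos in force)
  show "op_powr P 1 = P"
    by (rule diag_unique[OF F(1) D F(2)]) (use pos in force)
qed

lemma hs_pos_ln:
  assumes P: "hs_pos P"
  shows "op_fun ln P \<in> hilbert_schmidt" "adjp (op_fun ln P) (op_fun ln P)"
proof -
  obtain F \<alpha> m M where F: "onb F" "diag F \<alpha> P" "0 < m" "m \<le> 1" "1 \<le> M"
    "\<forall>e\<in>F. \<alpha> e \<in> {m..M}" by (rule hs_pos_diag[OF P])
  note D = diag_op_ln[OF F(1,2) F(6) F(3)]
  obtain L where L: "L \<ge> 0" "\<And>x y. x \<in> {m..M} \<Longrightarrow> y \<in> {m..M} \<Longrightarrow> \<bar>ln x - ln y\<bar> \<le> L * \<bar>x - y\<bar>"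
    using ln_lipschitz[OF F(3), of M] by blast
  have "\<bar>ln (\<alpha> e) - 0\<bar> \<le> L * \<bar>\<alpha> e - 1\<bar>" if "e \<in> F" for e
    using L(2)[OF F(6)[rule_format, OF that], of 1] F(4,5) by simp
  then show "op_fun ln P \<in> hilbert_schmidt"
    using diag_hs_lipschitz(1)[OF F(1,2) hs_posD(1)[OF P] D L(1), of 0] by simp
  show "adjp (op_fun ln P) (op_fun ln P)" by (rule diag_selfadj[OF F(1) D])
qed

lemma hs_id_compose:
  fixes A B :: "'a \<Rightarrow>\<^sub>L 'a"
  assumes A: "A - id_blinfun \<in> hilbert_schmidt" and B: "B - id_blinfun \<in> hilbert_schmidt"
  shows "(A o\<^sub>L B) - id_blinfun \<in> hilbert_schmidt"
proof -
  have "A \<in> bounded_ops" using bounded_ops_add[OF hs_bounded_ops[OF A] bounded_ops_id] by simp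
  then have "(A o\<^sub>L (B - id_blinfun)) + (A - id_blinfun) \<in> hilbert_schmidt"
    by (intro hs_add A hs_compose_left(1)[OF _ B])
  moreover have "(A o\<^sub>L (B - id_blinfun)) + (A - id_blinfun) = (A o\<^sub>L B) - id_blinfun"
    by (rule blinfun_eqI) (simp add: blinfun_simps)
  ultimately show ?thesis by simp
qed

text \<open>The left inverse of H keeps |H x| bounded below by a multiple of |x|, which transports
  the lower bound of K.\<close>

lemma hs_pos_congruence:
  assumes K: "hs_pos K" and G: "G - id_blinfun \<in> hilbert_schmidt" and GH: "adjp G H"
    and H': "H' o\<^sub>L H = id_blinfun"
  shows "hs_pos (G o\<^sub>L K o\<^sub>L H)"
  unfolding hs_pos_def
proof (intro conjI)
  have H: "H - id_blinfun \<in> hilbert_schmidt"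
    by (rule hs_adj(1)[OF G adjp_diff[OF GH adjp_id]])
  show "(G o\<^sub>L K o\<^sub>L H) - id_blinfun \<in> hilbert_schmidt"
    by (intro hs_id_compose G H hs_posD(1)[OF K])
  show "adjp (G o\<^sub>L K o\<^sub>L H) (G o\<^sub>L K o\<^sub>L H)"
    using adjp_compose[OF adjp_compose[OF GH hs_posD(2)[OF K]] adjp_sym[OF GH]]
    by (simp add: blinfun_compose_assoc)
  obtain m where m: "m > 0" "\<And>x. m * (norm x)\<^sup>2 \<le> inner (K x) x"
    using K by (auto simp: hs_pos_def)
  \<comment> \<open>The added 1 keeps the denominator positive.\<close>
  define c where "c = m / (norm H' + 1)\<^sup>2"
  have c: "c > 0"
    unfolding c_def using m(1) by (intro divide_pos_pos zero_less_power add_nonneg_pos) auto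
  have "c * (norm x)\<^sup>2 \<le> inner ((G o\<^sub>L K o\<^sub>L H) x) x" for x
  proof -
    have "H' (H x) = x" using H' by (metis blinfun_apply_blinfun_compose blinfun_apply_id_blinfun)
    then have "norm x \<le> norm H' * norm (H x)" using norm_blinfun[of H' "H x"] by simp
    also have "\<dots> \<le> (norm H' + 1) * norm (H x)" by (intro mult_right_mono) auto
    finally have "(norm x)\<^sup>2 \<le> ((norm H' + 1) * norm (H x))\<^sup>2" by (rule power_mono) simp
    then have "c * (norm x)\<^sup>2 \<le> c * ((norm H' + 1) * norm (H x))\<^sup>2"
      by (rule mult_left_mono) (use c in simp)
    also have "\<dots> = m * (norm (H x))\<^sup>2"
      using norm_ge_zero[of H'] unfolding c_def power_mult_distrib by (simp add: add_nonneg_eq_0_iff)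
    also have "\<dots> \<le> inner (K (H x)) (H x)" by (rule m(2))
    also have "\<dots> = inner ((G o\<^sub>L K o\<^sub>L H) x) x"
      using adjpD[OF GH, of "K (H x)" x] by (simp add: Re_cinner[symmetric])
    finally show ?thesis .
  qed
  then show "\<exists>m>0. \<forall>x. m * (norm x)\<^sup>2 \<le> inner ((G o\<^sub>L K o\<^sub>L H) x) x" using c by blast
qed

end

section \<open>The exponential metric increasing property\<close>

text \<open>With u = exp s this is s <= sinh s for s >= 0; the difference has a square as
  derivative.\<close>

lemma two_ln_le:
  fixes u :: real assumes "1 \<le> u" shows "2 * ln u \<le> u - 1 / u"
proof -
  have "(\<lambda>u. u - 1 / u - 2 * ln u) 1 \<le> (\<lambda>u. u - 1 / u - 2 * ln u) u"
  proof (rule DERIV_nonneg_imp_nondecreasing[OF assms])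
    fix x :: real assume x: "1 \<le> x" "x \<le> u"
    have "((\<lambda>u. u - 1 / u - 2 * ln u) has_real_derivative (1 - 1 / x)\<^sup>2) (at x)"
      using x by (auto intro!: derivative_eq_intros simp: power2_eq_square field_simps)
    then show "\<exists>y. ((\<lambda>u. u - 1 / u - 2 * ln u) has_real_derivative y) (at x) \<and> 0 \<le> y" by force
  qed
  then show ?thesis by simp
qed

text \<open>The logarithmic mean of two positive numbers is at least their geometric mean.\<close>

lemma abs_ln_diff_le:
  fixes x y :: real assumes "0 < x" "0 < y"
  shows "\<bar>ln y - ln x\<bar> \<le> x powr (-1/2) * y powr (-1/2) * \<bar>y - x\<bar>"
proof -
  have main: "ln y - ln x \<le> x powr (-1/2) * y powr (-1/2) * (y - x)" if "0 < x" "x \<le> y" for x y :: real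
  proof -
    have y: "y > 0" using that by simp
    let ?u = "sqrt y / sqrt x"
    have "1 \<le> ?u" using that y by simp
    from two_ln_le[OF this] have "2 * (ln y / 2 - ln x / 2) \<le> ?u - 1 / ?u"
      using that y by (simp add: ln_div ln_sqrt)
    also have "?u - 1 / ?u = (1 / sqrt x) * (1 / sqrt y) * (sqrt y * sqrt y - sqrt x * sqrt x)"
      using that y by (simp add: field_simps del: real_sqrt_mult_self)
    also have "\<dots> = x powr (-1/2) * y powr (-1/2) * (y - x)"
      using that y by (simp add: powr_minus powr_half_sqrt inverse_eq_divide)
    finally show ?thesis by simp
  qed
  show ?thesis
    using main[of x y] main[of y x] assms by (cases "x \<le> y") (auto simp: abs_if algebra_simps)
qed

text \<open>A bound for |2 sinh w|. The crude factor exp |w| is close to 1 for small w, and only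
  short steps of the geodesic use it.\<close>

lemma abs_exp_diff_le: "\<bar>exp w - exp (- w)\<bar> \<le> 2 * \<bar>w\<bar> * exp \<bar>w\<bar>" for w :: real
proof -
  have main: "exp w - exp (- w) \<le> 2 * w * exp w" "exp (- w) \<le> exp w" if "0 \<le> w" for w :: real
  proof -
    have "exp w * (1 - 2 * w) \<le> exp w * exp (- (2 * w))"
      using exp_ge_add_one_self[of "- (2 * w)"] by (intro mult_left_mono) auto
    also have "\<dots> = exp (- w)" by (simp add: mult_exp_exp)
    finally show "exp w - exp (- w) \<le> 2 * w * exp w" by (simp add: algebra_simps)
    show "exp (- w) \<le> exp w" using that by simp
  qed
  show ?thesis using main[of w] main[of "- w"] by (cases "0 \<le> w") auto
qed

context hs_space
begin

text \<open>In a pair of eigenbases the matrix of \<open>ln B - ln A\<close> is that of \<open>B - A\<close> multiplied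
  by difference quotients of the logarithm, so the comparison is entrywise.\<close>

lemma N_ln_diff_le:
  assumes A: "hs_pos A" and B: "hs_pos B"
  shows "N (op_fun ln B - op_fun ln A) \<le> N (op_powr A (-1/2) o\<^sub>L (B - A) o\<^sub>L op_powr B (-1/2))"
proof -
  obtain F \<alpha> m M where F: "onb F" "diag F \<alpha> A" "0 < m" "\<forall>e\<in>F. \<alpha> e \<in> {m..M}"
    using hs_pos_diag[OF A] by metis
  obtain G \<beta> k K where G: "onb G" "diag G \<beta> B" "0 < k" "\<forall>e\<in>G. \<beta> e \<in> {k..K}"
    using hs_pos_diag[OF B] by metis
  note lA = diag_op_ln[OF F(1,2,4,3)] and lB = diag_op_ln[OF G(1,2,4,3)]
  note pA = diag_op_powr[OF F(1,2,4,3), of "-1/2"] and pB = diag_op_powr[OF G(1,2,4,3), of "-1/2"]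
  let ?T = "op_powr A (-1/2) o\<^sub>L (B - A) o\<^sub>L op_powr B (-1/2)"
  have "(B - id_blinfun) - (A - id_blinfun) \<in> hilbert_schmidt"
    by (intro hs_diff hs_posD A B)
  then have hs: "?T \<in> hilbert_schmidt"
    by (intro hs_compose_right(1)[OF hs_compose_left(1) diag_selfadj[OF G(1) pB]]
        diag_bounded_ops[OF F(1) pA]) simp
  show ?thesis
  proof (rule hs_coefficients_le[OF F(1) G(1) _ hs])
    show "op_fun ln B - op_fun ln A \<in> bounded_ops"
      by (intro hs_bounded_ops hs_diff hs_pos_ln A B)
    fix a b assume a: "a \<in> F" and b: "b \<in> G"
    have pos: "\<alpha> a > 0" "\<beta> b > 0" using F(3,4) G(3,4) a b by force+
    have "cinner ((op_fun ln B - op_fun ln A) b) a = complex_of_real (ln (\<beta> b) - ln (\<alpha> a)) * cinner b a"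
      by (simp add: blinfun_simps cinner_diff_left diag_apply[OF G(1) lB b] diagD[OF lA a]
          cinner_scaleR_left scaleR_conv_of_real algebra_simps)
    moreover have "cinner (?T b) a
        = complex_of_real (\<alpha> a powr (-1/2) * \<beta> b powr (-1/2) * (\<beta> b - \<alpha> a)) * cinner b a"
      unfolding blinfun_apply_blinfun_compose diag_apply[OF G(1) pB b] diagD[OF pA a]
      by (simp add: blinfun_simps cinner_diff_left diag_apply[OF G(1,2) b] diagD[OF F(2) a]
          cinner_scaleR_left scaleR_conv_of_real algebra_simps)
    moreover have "\<bar>ln (\<beta> b) - ln (\<alpha> a)\<bar> \<le> \<bar>\<alpha> a powr (-1/2) * \<beta> b powr (-1/2) * (\<beta> b - \<alpha> a)\<bar>"
      using abs_ln_diff_le[OF pos] by (simp add: abs_mult)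
    ultimately show "cmod (cinner ((op_fun ln B - op_fun ln A) b) a) \<le> cmod (cinner (?T b) a)"
      by (simp only: norm_mult norm_of_real mult_right_mono norm_ge_zero)
  qed
qed

text \<open>The operator is the isometric factor in the polar decomposition of G, since A is G times
  its adjoint.\<close>

lemma polar_isometry:
  assumes A: "hs_pos A" "A = G o\<^sub>L H" and GH: "adjp G H" and H': "H o\<^sub>L H' = id_blinfun"
  shows "norm ((op_powr A (-1/2) o\<^sub>L G) x) = norm x"
proof -
  let ?S = "op_powr A (-1/2)"
  have S: "adjp ?S ?S" by (intro hs_posD hs_pos_powr A)
  have SS: "?S (?S y) = op_powr A (-1) y" for y
    using arg_cong[OF hs_pos_powr_add[OF A(1), of "-1/2" "-1/2"], of "\<lambda>T. T y"] by simp
  have "op_powr A (-1) o\<^sub>L A = id_blinfun"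
    using hs_pos_powr_add[OF A(1), of "-1" 1] hs_pos_powr_0_1[OF A(1)] by simp
  then have inv: "op_powr A (-1) (G (H y)) = y" for y
    by (metis A(2) blinfun_apply_blinfun_compose blinfun_apply_id_blinfun)
  have HH': "H (H' y) = y" for y
    using H' by (metis blinfun_apply_blinfun_compose blinfun_apply_id_blinfun)
  \<comment> \<open>\<open>inv\<close> covers only the range of H; the right inverse shows that this
    is the whole space.\<close>
  have "H (op_powr A (-1) (G x)) = x"
    using inv[of "H' x"] by (simp add: HH')
  then have "cinner (?S (G x)) (?S (G x)) = cinner x x"
    by (simp only: adjpD[OF S] adjpD[OF GH] SS)
  then have "(norm (?S (G x)))\<^sup>2 = (norm x)\<^sup>2"
    unfolding cinner_self of_real_eq_iff .
  then show ?thesis by simp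
qed

text \<open>With \<open>D'\<close> inverse to D, D D - 1 = (D - D') D. Hence A^(-1/2) (B - A)
  B^(-1/2) is U (D - D') times the adjoint of V, where U and V are the polar isometries of G and of
  G D.\<close>

lemma N_ln_congruence_step:
  assumes D: "hs_pos D" "D o\<^sub>L D' = id_blinfun" "adjp D' D'" "D - D' \<in> hilbert_schmidt"
    and A: "hs_pos A" "A = G o\<^sub>L H" and B: "hs_pos B" "B = G o\<^sub>L D o\<^sub>L D o\<^sub>L H"
    and GH: "adjp G H" and H': "H o\<^sub>L H' = id_blinfun"
  shows "N (op_fun ln B - op_fun ln A) \<le> N (D - D')"
proof -
  note Dadj = hs_posD(2)[OF D(1)]
  have DD': "D (D' y) = y" for y using D(2) by (metis blinfun_apply_blinfun_compose blinfun_apply_id_blinfun)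
  have HH': "H (H' y) = y" for y using H' by (metis blinfun_apply_blinfun_compose blinfun_apply_id_blinfun)
  have D'D: "D' (D y) = y" for y
  proof -
    have "D' o\<^sub>L D = id_blinfun"
      using adjp_unique[OF adjp_compose[OF Dadj D(3)]] D(2) adjp_id by metis
    then show ?thesis by (metis blinfun_apply_blinfun_compose blinfun_apply_id_blinfun)
  qed
  define U where "U = op_powr A (-1/2) o\<^sub>L G"
  define V where "V = op_powr B (-1/2) o\<^sub>L (G o\<^sub>L D)"
  define V' where "V' = (D o\<^sub>L H) o\<^sub>L op_powr B (-1/2)"
  have GD: "adjp (G o\<^sub>L D) (D o\<^sub>L H)" by (rule adjp_compose[OF GH Dadj])
  have U: "norm (U x) = norm x" for x
    unfolding U_def by (rule polar_isometry[OF A GH H'])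
  have V: "norm (V x) = norm x" for x
    unfolding V_def
  proof (rule polar_isometry[OF B(1) _ GD])
    show "B = (G o\<^sub>L D) o\<^sub>L (D o\<^sub>L H)" using B(2) by (simp add: blinfun_compose_assoc)
    show "(D o\<^sub>L H) o\<^sub>L (H' o\<^sub>L D') = id_blinfun" by (rule blinfun_eqI) (simp add: HH' DD')
  qed
  have VV': "adjp V V'"
    unfolding V_def V'_def by (rule adjp_compose[OF hs_posD(2)[OF hs_pos_powr[OF B(1)]] GD])
  have Gb: "G \<in> bounded_ops" by (rule adjp_bounded_ops[OF GH])
  have eq: "op_powr A (-1/2) o\<^sub>L (B - A) o\<^sub>L op_powr B (-1/2) = U o\<^sub>L ((D - D') o\<^sub>L V')"
    by (rule blinfun_eqI) (simp add: U_def V'_def A(2) B(2) blinfun_simps D'D)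
  note hsV = hs_compose_right(1)[OF D(4) adjp_sym[OF VV']]
  have "N (U o\<^sub>L ((D - D') o\<^sub>L V')) = N ((D - D') o\<^sub>L V')"
    using bounded_ops_compose[OF hs_posD(3)[OF hs_pos_powr[OF A(1)]] Gb]
    by (intro N_isometry_left[OF U _ hsV]) (simp add: U_def)
  also have "\<dots> = N (V o\<^sub>L (D - D'))"
    using hs_adj(2)[OF hsV adjp_compose[OF adjp_diff[OF Dadj D(3)] adjp_sym[OF VV']]] by simp
  also have "\<dots> = N (D - D')"
    by (rule N_isometry_left[OF V adjp_bounded_ops[OF VV'] D(4)])
  finally show ?thesis using N_ln_diff_le[OF A(1) B(1)] unfolding eq by simp
qed

text \<open>An eigenvalue of the difference is 2 sinh (h/2 ln c) for an eigenvalue c of C. The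
  constant bounds all |ln c| and does not depend on h, so it serves every subdivision.\<close>

lemma N_powr_diff_le:
  assumes C: "hs_pos C"
  shows "\<exists>M\<ge>0. \<forall>h\<ge>0. op_powr C (h/2) - op_powr C (-h/2) \<in> hilbert_schmidt \<and>
    N (op_powr C (h/2) - op_powr C (-h/2)) \<le> h * exp (h * M) * N (op_fun ln C)"
proof -
  obtain F \<gamma> m M where F: "onb F" "diag F \<gamma> C" "0 < m" "m \<le> 1" "1 \<le> M" "\<forall>e\<in>F. \<gamma> e \<in> {m..M}"
    by (rule hs_pos_diag[OF C])
  define K where "K = max (- ln m) (ln M)"
  have K: "K \<ge> 0" using F by (simp add: K_def le_max_iff_disj)
  have K': "\<bar>ln (\<gamma> e)\<bar> \<le> K" if "e \<in> F" for e
  proof -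
    have "m \<le> \<gamma> e" "\<gamma> e \<le> M" using F(6) that by auto
    then have "ln m \<le> ln (\<gamma> e)" "ln (\<gamma> e) \<le> ln M" using F(3) by auto
    then show ?thesis by (auto simp: K_def abs_if)
  qed
  note pD = diag_op_powr[OF F(1,2,6,3)] and lD = diag_op_ln[OF F(1,2,6,3)]
  have "op_powr C (h/2) - op_powr C (-h/2) \<in> hilbert_schmidt \<and>
    N (op_powr C (h/2) - op_powr C (-h/2)) \<le> h * exp (h * K) * N (op_fun ln C)" if h: "h \<ge> 0" for h
  proof -
    note dD = diag_diff[OF pD[of "h/2"] pD[of "-h/2"]]
    have "norm ((op_powr C (h/2) - op_powr C (-h/2)) e) \<le> (h * exp (h * K)) * norm (op_fun ln C e)"
      if e: "e \<in> F" for e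
    proof -
      have pos: "\<gamma> e > 0" using F(3,6) e by force
      define w where "w = h / 2 * ln (\<gamma> e)"
      have "\<gamma> e powr (h/2) - \<gamma> e powr (-h/2) = exp w - exp (- w)"
        using pos by (simp add: powr_def w_def)
      also have "\<bar>\<dots>\<bar> \<le> 2 * \<bar>w\<bar> * exp \<bar>w\<bar>" by (rule abs_exp_diff_le)
      also have "\<dots> = h * \<bar>ln (\<gamma> e)\<bar> * exp (h / 2 * \<bar>ln (\<gamma> e)\<bar>)"
        using h by (simp add: w_def abs_mult)
      also have "\<dots> \<le> h * \<bar>ln (\<gamma> e)\<bar> * exp (h * K)"
      proof -
        have "h / 2 * \<bar>ln (\<gamma> e)\<bar> \<le> h * K"
          using K'[OF e] h K by (intro mult_mono) auto
        then show ?thesis using h by (intro mult_left_mono) auto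
      qed
      finally have "\<bar>\<gamma> e powr (h/2) - \<gamma> e powr (-h/2)\<bar> * norm e
          \<le> h * \<bar>ln (\<gamma> e)\<bar> * exp (h * K) * norm e" by (rule mult_right_mono) simp
      then show ?thesis
        unfolding diag_apply[OF F(1) dD e] diag_apply[OF F(1) lD e] norm_scaleR by (simp only: mult_ac)
    qed
    note H = hs_le[OF diag_bounded_ops[OF F(1) dD] hs_pos_ln(1)[OF C] F(1) _ this]
    show ?thesis using H h by simp
  qed
  then show ?thesis using K by blast
qed

lemma N_ln_congruence_le:
  assumes C: "hs_pos C" and g: "g - id_blinfun \<in> hilbert_schmidt" and gg: "adjp g g'"
    and inv: "g' o\<^sub>L gi = id_blinfun" "gi o\<^sub>L g' = id_blinfun"
  shows "N (op_fun ln (g o\<^sub>L C o\<^sub>L g') - op_fun ln (g o\<^sub>L g')) \<le> N (op_fun ln C)"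
proof -
  define \<Gamma> where "\<Gamma> s = g o\<^sub>L op_powr C s o\<^sub>L g'" for s
  define L where "L s = op_fun ln (\<Gamma> s)" for s
  have \<Gamma>: "hs_pos (\<Gamma> s)" for s
    unfolding \<Gamma>_def by (rule hs_pos_congruence[OF hs_pos_powr[OF C] g gg inv(2)])
  have hsL: "L s \<in> hilbert_schmidt" for s unfolding L_def by (rule hs_pos_ln(1)[OF \<Gamma>])
  have pw: "op_powr C s (op_powr C t x) = op_powr C (s + t) x" for s t x
    using hs_pos_powr_add[OF C] by (metis blinfun_apply_blinfun_compose)
  have pw0: "op_powr C 0 x = x" for x by (simp add: hs_pos_powr_0_1[OF C])
  have g'gi: "g' (gi x) = x" for x
    using inv(1) by (metis blinfun_apply_blinfun_compose blinfun_apply_id_blinfun)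
  obtain M where M: "M \<ge> 0" "\<And>h. h \<ge> 0 \<Longrightarrow> op_powr C (h/2) - op_powr C (-h/2) \<in> hilbert_schmidt"
    "\<And>h. h \<ge> 0 \<Longrightarrow> N (op_powr C (h/2) - op_powr C (-h/2)) \<le> h * exp (h * M) * N (op_fun ln C)"
    using N_powr_diff_le[OF C] by blast
  have step: "N (L (s + h) - L s) \<le> h * exp (h * M) * N (op_fun ln C)" if h: "h \<ge> 0" for s h
  proof -
    have "N (L (s + h) - L s) \<le> N (op_powr C (h/2) - op_powr C (-h/2))"
      unfolding L_def
    \<comment> \<open>Restart at the parameter s: half of the power C^s is absorbed into each outer
      factor, and C^(h/2) plays the role of D.\<close>
    proof (rule N_ln_congruence_step[where G = "g o\<^sub>L op_powr C (s/2)" and H = "op_powr C (s/2) o\<^sub>L g'"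
          and H' = "gi o\<^sub>L op_powr C (-s/2)"])
      show "op_powr C (h/2) o\<^sub>L op_powr C (-h/2) = id_blinfun"
        by (rule blinfun_eqI) (simp add: pw pw0)
      show "\<Gamma> s = (g o\<^sub>L op_powr C (s/2)) o\<^sub>L (op_powr C (s/2) o\<^sub>L g')"
        by (rule blinfun_eqI) (simp add: pw \<Gamma>_def)
      show "\<Gamma> (s + h) = (g o\<^sub>L op_powr C (s/2)) o\<^sub>L op_powr C (h/2) o\<^sub>L op_powr C (h/2)
          o\<^sub>L (op_powr C (s/2) o\<^sub>L g')"
        by (rule blinfun_eqI) (simp add: pw \<Gamma>_def add.commute)
      show "(op_powr C (s/2) o\<^sub>L g') o\<^sub>L (gi o\<^sub>L op_powr C (-s/2)) = id_blinfun"
        by (rule blinfun_eqI) (simp add: pw pw0 g'gi)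
    qed (intro hs_pos_powr C hs_posD(2) M(2) h \<Gamma> adjp_compose gg)+
    also have "\<dots> \<le> h * exp (h * M) * N (op_fun ln C)" by (rule M(3)[OF h])
    finally show ?thesis .
  qed
  have n: "N (L 1 - L 0) \<le> exp (1 / real (Suc n) * M) * N (op_fun ln C)" for n
  proof -
    define h where "h = 1 / real (Suc n)"
    have h: "h \<ge> 0" by (simp add: h_def)
    define c where "c = h * exp (h * M) * N (op_fun ln C)"
    have "N (L (real k * h) - L 0) \<le> real k * c" for k
    proof (induction k)
      case 0
      then show ?case by (simp add: hs_zero)
    next
      case (Suc k)
      have "L (real (Suc k) * h) - L 0 = (L (real k * h + h) - L (real k * h)) + (L (real k * h) - L 0)"
        by (simp add: algebra_simps)
      also have "N \<dots> \<le> N (L (real k * h + h) - L (real k * h)) + N (L (real k * h) - L 0)"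
        by (intro N_triangle hs_diff hsL)
      also have "\<dots> \<le> c + real k * c"
        unfolding c_def by (intro add_mono step[OF h] Suc.IH[unfolded c_def])
      finally show ?case by (simp add: algebra_simps)
    qed
    \<comment> \<open>The number of steps cancels the step length, leaving only the exponential
      factor.\<close>
    from this[of "Suc n"] show ?thesis by (simp add: c_def h_def)
  qed
  have "(\<lambda>n. exp (inverse (real (Suc n)) * M) * N (op_fun ln C)) \<longlonglongrightarrow> exp (0 * M) * N (op_fun ln C)"
    by (intro tendsto_intros LIMSEQ_inverse_real_of_nat)
  then have "N (L 1 - L 0) \<le> exp (0 * M) * N (op_fun ln C)"
    by (rule LIMSEQ_le_const) (use n in \<open>auto simp: inverse_eq_divide\<close>)
  moreover have "\<Gamma> 1 = g o\<^sub>L C o\<^sub>L g'" "\<Gamma> 0 = g o\<^sub>L g'"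
    by (simp_all add: \<Gamma>_def hs_pos_powr_0_1[OF C] blinfun_compose_assoc) (rule blinfun_eqI, simp)
  ultimately show ?thesis by (simp add: L_def)
qed

text \<open>Its logarithm is the direction from P to Q, transported to the tangent space at the
  identity.\<close>

definition transition :: "('a \<Rightarrow>\<^sub>L 'a) \<Rightarrow> ('a \<Rightarrow>\<^sub>L 'a) \<Rightarrow> ('a \<Rightarrow>\<^sub>L 'a)" where
  "transition P Q = op_powr P (-1/2) o\<^sub>L Q o\<^sub>L op_powr P (-1/2)"

lemma hs_pos_powr_apply:
  assumes "hs_pos P"
  shows "op_powr P s (op_powr P t x) = op_powr P (s + t) x" "op_powr P 0 x = x" "op_powr P 1 x = P x"
  using arg_cong[OF hs_pos_powr_add[OF assms, of s t], of "\<lambda>T. T x"] hs_pos_powr_0_1[OF assms]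
  by simp_all

lemma hs_pos_transition:
  assumes P: "hs_pos P" and Q: "hs_pos Q"
  shows "hs_pos (transition P Q)"
  unfolding transition_def
proof (rule hs_pos_congruence[OF Q])
  show "op_powr P (1/2) o\<^sub>L op_powr P (-1/2) = id_blinfun"
    by (rule blinfun_eqI) (simp add: hs_pos_powr_apply[OF P])
qed (intro hs_posD hs_pos_powr P)+

text \<open>Congruence by P^(-1/2) Q^(1/2) carries the identity to \<open>transition P Q\<close> and
  \<open>transition Q R\<close> to \<open>transition P R\<close>.\<close>

theorem exponential_metric_increasing:
  assumes P: "hs_pos P" and Q: "hs_pos Q" and R: "hs_pos R"
  shows "N (op_fun ln (transition P R) - op_fun ln (transition P Q)) \<le> N (op_fun ln (transition Q R))"
proof -
  define g where "g = op_powr P (-1/2) o\<^sub>L op_powr Q (1/2)"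
  define g' where "g' = op_powr Q (1/2) o\<^sub>L op_powr P (-1/2)"
  define gi where "gi = op_powr P (1/2) o\<^sub>L op_powr Q (-1/2)"
  note simps = hs_pos_powr_apply[OF P] hs_pos_powr_apply[OF Q]
  have "N (op_fun ln (g o\<^sub>L transition Q R o\<^sub>L g') - op_fun ln (g o\<^sub>L g')) \<le> N (op_fun ln (transition Q R))"
  proof (rule N_ln_congruence_le[OF hs_pos_transition[OF Q R]])
    show "g - id_blinfun \<in> hilbert_schmidt"
      unfolding g_def by (intro hs_id_compose hs_posD hs_pos_powr P Q)
    show "adjp g g'" unfolding g_def g'_def by (intro adjp_compose hs_posD hs_pos_powr P Q)
    show "g' o\<^sub>L gi = id_blinfun" "gi o\<^sub>L g' = id_blinfun"
      by (rule blinfun_eqI, simp add: g'_def gi_def simps)+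
  qed
  moreover have "g o\<^sub>L transition Q R o\<^sub>L g' = transition P R" "g o\<^sub>L g' = transition P Q"
    by (rule blinfun_eqI, simp add: g'_def g_def transition_def simps)+
  ultimately show ?thesis by simp
qed

end

section \<open>The manifold of positive invertible operators\<close>

context hs_space
begin

section \<open>Scalar parts, traces and the norm \<open>norm2\<close>\<close>

abbreviation (input) scal :: "real \<Rightarrow> ('a \<Rightarrow>\<^sub>L 'a)" where
  "scal r \<equiv> r *\<^sub>R id_blinfun"

text \<open>Every basis vector contributes the same |c|^2, and there are infinitely many of
  them.\<close>

lemma scalar_op_hs_imp_0:
  assumes "scalar_op c \<in> (hilbert_schmidt :: ('a \<Rightarrow>\<^sub>L 'a) set)" shows "c = 0"
proof (rule ccontr)
  assume "c \<noteq> 0"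
  define T :: "'a \<Rightarrow>\<^sub>L 'a" where "T = scalar_op c"
  have n: "(norm (T e))\<^sup>2 = (cmod c)\<^sup>2" if "e \<in> E0" for e
    using that onb0 orthonormal_norm[of E0 e] by (simp add: T_def scalar_op.rep_eq norm_scaleC onb_def)
  obtain k where k: "(N T)\<^sup>2 / (cmod c)\<^sup>2 < real k" using reals_Archimedean2 by blast
  obtain F where F: "finite F" "card F = k" "F \<subseteq> E0"
    using infinite_arbitrarily_large[OF infinite_basis] by metis
  have "(\<Sum>e\<in>F. (norm (T e))\<^sup>2) \<le> (N T)\<^sup>2"
    using hs_has_sum[OF _ onb0, of T] assms F by (intro finite_sum_le_has_sum) (auto simp: T_def)
  moreover have "(\<Sum>e\<in>F. (norm (T e))\<^sup>2) = real k * (cmod c)\<^sup>2"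
    using n F by (simp add: subset_iff)
  ultimately show False using k \<open>c \<noteq> 0\<close> by (simp add: field_simps)
qed

lemma scalar_part_eq:
  fixes a :: "'a \<Rightarrow>\<^sub>L 'a"
  assumes "a \<in> hilbert_schmidt"
  shows "scalar_part (a + scalar_op c) = c" "hs_part (a + scalar_op c) = a"
proof -
  show c: "scalar_part (a + scalar_op c) = c"
    unfolding scalar_part_def
  proof (rule the_equality)
    show "(a + scalar_op c) - scalar_op c \<in> hilbert_schmidt" using assms by simp
    fix d assume "(a + scalar_op c) - scalar_op d \<in> hilbert_schmidt"
    then have "(a + scalar_op c) - scalar_op d - a \<in> hilbert_schmidt"
      by (rule hs_diff[OF _ assms])
    also have "(a + scalar_op c) - scalar_op d - a = scalar_op (c - d)"
    proof (rule blinfun_eqI)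
      show "blinfun_apply ((a + scalar_op c) - scalar_op d - a) x = blinfun_apply (scalar_op (c - d)) x" for x
        using scaleC_add_left[of "c - d" d x] by (simp add: blinfun_simps scalar_op.rep_eq)
    qed
    finally have "scalar_op (c - d) \<in> (hilbert_schmidt :: ('a \<Rightarrow>\<^sub>L 'a) set)" .
    then show "d = c" using scalar_op_hs_imp_0 by fastforce
  qed
  show "hs_part (a + scalar_op c) = a" by (simp add: hs_part_def c)
qed

text \<open>Moving a to the other side writes the diagonal entries as inner products of adjoints.
  Their real and imaginary parts are two \<open>ip\<close> families, summable over every basis as
  \<open>op_trace\<close> demands.\<close>

lemma op_trace_compose:
  assumes a: "a \<in> hilbert_schmidt" and b: "b \<in> hilbert_schmidt"
  shows "Re (op_trace (a o\<^sub>L adj b)) = ip a b"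
proof -
  define a' where "a' = adj a"
  define b' where "b' = adj b"
  have A: "adjp a a'" "adjp b b'"
    unfolding a'_def b'_def by (intro adjp_adj hs_bounded_ops a b)+
  have hs: "a' \<in> hilbert_schmidt" "b' \<in> hilbert_schmidt" using hs_adj(1) a b A by blast+
  have hs_i: "scalar_op \<i> o\<^sub>L a' \<in> hilbert_schmidt"
    by (intro hs_compose_left(1) bounded_ops_scalar hs)
  define z where "z = complex_of_real (ip b' a') + \<i> * complex_of_real (ip b' (scalar_op \<i> o\<^sub>L a'))"
  have z: "((\<lambda>e. cinner ((a o\<^sub>L b') e) e) has_sum z) E" if "orthonormal_basis E" for E
  proof -
    note E = orthonormal_basis_imp_onb[OF that]
    have "((\<lambda>e. complex_of_real (inner (b' e) (a' e)) + \<i> * complex_of_real (inner (b' e) ((scalar_op \<i> o\<^sub>L a') e)))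
        has_sum z) E"
      unfolding z_def
      by (intro has_sum_add has_sum_cmult_right has_sum_of_real ip_has_sum hs hs_i E)
    moreover have "complex_of_real (inner (b' e) (a' e)) + \<i> * complex_of_real (inner (b' e) ((scalar_op \<i> o\<^sub>L a') e))
        = cinner ((a o\<^sub>L b') e) e" for e
      by (simp add: adjpD[OF A(1)] complex_eq_iff Re_cinner Im_cinner scalar_op.rep_eq)
    ultimately show ?thesis by simp
  qed
  have "op_trace (a o\<^sub>L b') = z"
    unfolding op_trace_def
    by (rule the_equality) (use z basis has_sum_unique in blast)+
  then have "Re (op_trace (a o\<^sub>L b')) = ip b' a'" by (simp add: z_def)
  also have "\<dots> = ip b a" by (rule ip_adj[OF b A(2) a A(1)])
  finally show ?thesis using ip_commute[OF a b] by (simp add: b'_def)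
qed

lemma Re_inner2:
  assumes "a \<in> hilbert_schmidt" "b \<in> hilbert_schmidt"
  shows "Re (inner2 (a + scal r) (b + scal s)) = 4 * ip a b + r * s"
  unfolding scalar_op_of_real[symmetric]
  by (simp add: inner2_def scalar_part_eq assms op_trace_compose)

lemma norm2_eq:
  assumes "a \<in> hilbert_schmidt"
  shows "norm2 (a + scal r) = sqrt ((2 * N a)\<^sup>2 + r\<^sup>2)"
  using assms by (simp add: norm2_def Re_inner2 ip_self power_mult_distrib power2_eq_square)

lemma norm2_triangle:
  assumes a: "a \<in> hilbert_schmidt" and b: "b \<in> hilbert_schmidt"
  shows "norm2 ((a + scal r) + (b + scal s)) \<le> norm2 (a + scal r) + norm2 (b + scal s)"
proof -
  have "(a + scal r) + (b + scal s) = (a + b) + scal (r + s)"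
    by (simp add: scaleR_add_left)
  then have "norm2 ((a + scal r) + (b + scal s)) = sqrt ((2 * N (a + b))\<^sup>2 + (r + s)\<^sup>2)"
    by (simp only: norm2_eq[OF hs_add[OF a b]])
  also have "\<dots> \<le> sqrt ((2 * N a + 2 * N b)\<^sup>2 + (r + s)\<^sup>2)"
    using N_triangle[OF a b] N_nonneg[of "a + b"]
    by (intro real_sqrt_le_mono add_right_mono power_mono) auto
  also have "\<dots> \<le> sqrt ((2 * N a)\<^sup>2 + r\<^sup>2) + sqrt ((2 * N b)\<^sup>2 + s\<^sup>2)"
    by (rule real_sqrt_sum_squares_triangle_ineq)
  finally show ?thesis by (simp add: norm2_eq a b)
qed

lemma HR_I:
  assumes "a \<in> hilbert_schmidt" "adjp a a"
  shows "a + scal r \<in> HR"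
  unfolding scalar_op_of_real[symmetric] using assms adj_eqI unfolding HR_def by blast

lemma HR_cases:
  assumes "x \<in> HR"
  obtains a r where "a \<in> hilbert_schmidt" "adjp a a" "x = a + scal r"
  using assms adjp_adj[OF hs_bounded_ops] unfolding HR_def scalar_op_of_real by fastforce

section \<open>Splitting off the scalar factor\<close>

lemma op_inv_eqI:
  fixes T S :: "'a \<Rightarrow>\<^sub>L 'a"
  assumes "S \<in> bounded_ops" "S o\<^sub>L T = id_blinfun" "T o\<^sub>L S = id_blinfun"
  shows "op_inv T = S"
  unfolding op_inv_def
proof (rule the_equality)
  show "R = S" if R: "R \<in> bounded_ops \<and> R o\<^sub>L T = id_blinfun \<and> T o\<^sub>L R = id_blinfun" for R
  proof -
    have "R = R o\<^sub>L (T o\<^sub>L S)" unfolding assms(3) by (rule blinfun_eqI) simp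
    also have "\<dots> = (R o\<^sub>L T) o\<^sub>L S" by (simp only: blinfun_compose_assoc)
    also have "\<dots> = S" using R by (simp only:) (rule blinfun_eqI, simp)
    finally show ?thesis .
  qed
qed (use assms in blast)

text \<open>The scalar part l is positive: the Hilbert-Schmidt part is small on some basis vector,
  where the quadratic form of p, bounded below, is close to l. Dividing by l normalizes the scalar
  part to 1.\<close>

lemma Sigma_mfd_cases:
  assumes "p \<in> Sigma_mfd"
  obtains l P where "l > 0" "hs_pos P" "p = l *\<^sub>R P"
proof -
  have p: "p \<in> HR" "op_positive p" "op_invertible p" using assms by (auto simp: Sigma_mfd_def)
  obtain a l where a: "a \<in> hilbert_schmidt" "adjp a a" "p = a + scal l"
    using HR_cases[OF p(1)] by metis
  obtain F \<phi> where F: "onb F" "diag F \<phi> a" using hs_diagonalizable[OF a(1,2)] by blast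
  have D: "diag F (\<lambda>e. \<phi> e + l * 1) p"
    unfolding a(3) by (intro diag_add F diag_scaleR diag_id)
  obtain S where S: "S o\<^sub>L p = id_blinfun" using p(3) by (auto simp: op_invertible_def)
  \<comment> \<open>S inverts p, so \<open>norm S\<close> times an eigenvalue is at least 1; the
    added 1 avoids a zero denominator.\<close>
  define m where "m = 1 / (norm S + 1)"
  have m: "m > 0" by (simp add: m_def add_nonneg_pos)
  have "m \<le> \<phi> e + l * 1" if e: "e \<in> F" for e
  proof -
    have ne: "norm e = 1" using F(1) e orthonormal_norm by (auto simp: onb_def)
    have pe: "p e = (\<phi> e + l * 1) *\<^sub>R e" by (rule diag_apply[OF F(1) D e])
    have "inner (p e) e \<ge> 0" using p(2) by (auto simp: op_positive_def Re_cinner)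
    then have pos: "0 \<le> \<phi> e + l * 1" using ne by (simp add: pe flip: power2_norm_eq_inner)
    have "S (p e) = e" using S by (metis blinfun_apply_blinfun_compose blinfun_apply_id_blinfun)
    then have "1 \<le> norm S * (\<phi> e + l * 1)"
      using norm_blinfun[of S "p e"] ne pos by (simp add: pe)
    also have "\<dots> \<le> (norm S + 1) * (\<phi> e + l * 1)" using pos by (intro mult_right_mono) auto
    finally show ?thesis
      by (simp add: m_def divide_le_eq add_nonneg_pos mult.commute)
  qed
  then have low: "m * (norm x)\<^sup>2 \<le> inner (p x) x" for x
    by (rule diag_lower_bound[OF F(1) D])
  \<comment> \<open>Otherwise a would dominate the scalar m/2 on the basis and make it
    Hilbert-Schmidt.\<close>
  have "\<exists>e\<in>E0. norm (a e) < m / 2"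
  proof (rule ccontr)
    assume small: "\<not> ?thesis"
    have le: "norm (scal (m / 2) e) \<le> 1 * norm (a e)" if e: "e \<in> E0" for e
    proof -
      have "norm e = 1" using onb0 e orthonormal_norm by (auto simp: onb_def)
      moreover have "m / 2 \<le> norm (a e)" using small e by (meson not_le)
      ultimately show ?thesis using m by (simp add: blinfun_simps)
    qed
    have "scal (m / 2) \<in> (hilbert_schmidt :: ('a \<Rightarrow>\<^sub>L 'a) set)"
      by (rule hs_le(1)[OF bounded_ops_scaleR[OF bounded_ops_id] a(1) onb0 _ le]) auto
    then have "scalar_op (complex_of_real (m / 2)) \<in> (hilbert_schmidt :: ('a \<Rightarrow>\<^sub>L 'a) set)"
      by (simp only: scalar_op_of_real)
    then have "complex_of_real (m / 2) = 0" by (rule scalar_op_hs_imp_0)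
    then show False using m by simp
  qed
  then obtain e where e: "e \<in> E0" "norm (a e) < m / 2" by blast
  have ne: "norm e = 1" using onb0 e(1) orthonormal_norm by (auto simp: onb_def)
  have "inner (p e) e = inner (a e) e + l"
    using ne by (simp add: a(3) blinfun_simps inner_add_left flip: power2_norm_eq_inner)
  moreover have "inner (a e) e \<le> norm (a e)" using norm_cauchy_schwarz[of "a e" e] ne by simp
  ultimately have l: "l > 0" using low[of e] ne e(2) m by simp
  define P where "P = (1 / l) *\<^sub>R p"
  have P: "P - id_blinfun = (1 / l) *\<^sub>R a"
    using l by (simp add: P_def a(3) scaleR_add_right)
  have "(m / l) * (norm x)\<^sup>2 \<le> inner (P x) x" for x
    using low[of x] l by (simp add: P_def blinfun_simps field_simps)
  moreover have "m / l > 0" using l m by simp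
  moreover have "P - id_blinfun \<in> hilbert_schmidt"
    unfolding P by (rule hs_scaleR(1)[OF a(1)])
  moreover have "adjp P P"
    unfolding P_def by (rule diag_selfadj[OF F(1) diag_scaleR[OF D]])
  ultimately have "hs_pos P" unfolding hs_pos_def by metis
  moreover have "p = l *\<^sub>R P" using l by (simp add: P_def)
  ultimately show thesis by (rule that[OF l])
qed

lemma op_powr_scaleR:
  assumes P: "hs_pos P" and l: "l > 0"
  shows "op_powr (l *\<^sub>R P) t = l powr t *\<^sub>R op_powr P t"
proof -
  obtain F \<alpha> m M where F: "onb F" "diag F \<alpha> P" "0 < m" "\<forall>e\<in>F. \<alpha> e \<in> {m..M}"
    using hs_pos_diag[OF P] by metis
  have D: "diag F (\<lambda>e. (l * \<alpha> e) powr t) (op_powr (l *\<^sub>R P) t)"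
    by (rule diag_op_powr[OF F(1) diag_scaleR[OF F(2)], where m = "l * m" and M = "l * M"])
       (use F(3,4) l in auto)
  show ?thesis
    by (rule diag_unique[OF F(1) D diag_scaleR[OF diag_op_powr[OF F(1,2,4,3)]]])
       (use F(3,4) l in \<open>force simp: powr_mult\<close>)
qed

lemma op_inv_scaleR:
  assumes P: "hs_pos P" and l: "l > 0"
  shows "op_inv (l *\<^sub>R P) = (1 / l) *\<^sub>R op_powr P (-1)"
proof (rule op_inv_eqI)
  show "(1 / l) *\<^sub>R op_powr P (-1) \<in> bounded_ops"
    by (intro bounded_ops_scaleR hs_posD hs_pos_powr P)
  note pw = hs_pos_powr_apply[OF P]
  have "op_powr P (-1) (P x) = x" "P (op_powr P (-1) x) = x" for x
    using pw(1)[of "-1" 1 x] pw(1)[of 1 "-1" x] by (simp_all add: pw(2,3))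
  then show "((1 / l) *\<^sub>R op_powr P (-1)) o\<^sub>L (l *\<^sub>R P) = id_blinfun"
    "(l *\<^sub>R P) o\<^sub>L ((1 / l) *\<^sub>R op_powr P (-1)) = id_blinfun"
    using l by (intro blinfun_eqI; simp add: blinfun_simps)+
qed

text \<open>Scalars commute with everything, so the geodesic is the product of the scalar one, l
  (k/l)^t, and the one from P to Q.\<close>

lemma geodesic_eq:
  assumes P: "hs_pos P" and Q: "hs_pos Q" and l: "l > 0" and k: "k > 0"
  shows "geodesic (l *\<^sub>R P) (k *\<^sub>R Q) t
    = (l * (k / l) powr t) *\<^sub>R (op_powr P (1/2) o\<^sub>L op_powr (transition P Q) t o\<^sub>L op_powr P (1/2))"
proof -
  have l2: "l powr (1/2) * l powr (1/2) = l" "l powr (-1/2) * l powr (-1/2) = 1 / l"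
    using l by (simp_all add: powr_add[symmetric] powr_minus inverse_eq_divide)
  have "op_powr (l *\<^sub>R P) (-1/2) o\<^sub>L (k *\<^sub>R Q) o\<^sub>L op_powr (l *\<^sub>R P) (-1/2)
      = (l powr (-1/2) * l powr (-1/2) * k) *\<^sub>R transition P Q"
    unfolding op_powr_scaleR[OF P l] transition_def
    by (rule blinfun_eqI) (simp add: blinfun_simps mult_ac)
  also have "\<dots> = (k / l) *\<^sub>R transition P Q" unfolding l2 by simp
  finally have c: "op_powr (l *\<^sub>R P) (-1/2) o\<^sub>L (k *\<^sub>R Q) o\<^sub>L op_powr (l *\<^sub>R P) (-1/2)
      = (k / l) *\<^sub>R transition P Q" .
  have kl: "k / l > 0" using k l by simp
  have "geodesic (l *\<^sub>R P) (k *\<^sub>R Q) t = (l powr (1/2) * l powr (1/2) * (k / l) powr t) *\<^sub>R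
      (op_powr P (1/2) o\<^sub>L op_powr (transition P Q) t o\<^sub>L op_powr P (1/2))"
    unfolding geodesic_def c
    unfolding op_powr_scaleR[OF hs_pos_transition[OF P Q] kl] op_powr_scaleR[OF P l]
    by (rule blinfun_eqI) (simp add: blinfun_simps mult_ac)
  then show ?thesis unfolding l2 .
qed

end

section \<open>Comparison with Euclidean triangles\<close>

text \<open>With u, v, w the three cosines, (1 - u^2) (1 - v^2) = (u v + w)^2 turns the addition
  formula into the cosine of the first two angles' sum being -w. Degenerate triangles are
  included.\<close>

lemma arccos_euclidean_triangle_sum:
  fixes a b c :: real
  assumes pos: "0 < a" "0 < b" "0 < c" and tri: "a \<le> b + c" "b \<le> c + a" "c \<le> a + b"
  shows "arccos ((b\<^sup>2 + c\<^sup>2 - a\<^sup>2) / (2 * b * c)) + arccos ((c\<^sup>2 + a\<^sup>2 - b\<^sup>2) / (2 * c * a))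
    + arccos ((a\<^sup>2 + b\<^sup>2 - c\<^sup>2) / (2 * a * b)) = pi"
proof -
  have cosine_bounds: "\<bar>(y\<^sup>2 + z\<^sup>2 - x\<^sup>2) / (2 * y * z)\<bar> \<le> 1"
    if "0 < y" "0 < z" "x \<le> y + z" "y \<le> z + x" "z \<le> x + y" for x y z :: real
  proof -
    have "(y + z - x) * (x + y + z) \<ge> 0" "(x + y - z) * (x + z - y) \<ge> 0"
      using that by (auto intro!: mult_nonneg_nonneg)
    then have "\<bar>y\<^sup>2 + z\<^sup>2 - x\<^sup>2\<bar> \<le> 2 * y * z"
      by (auto simp: abs_le_iff power2_eq_square algebra_simps)
    then show ?thesis using that by (simp add: abs_divide abs_mult)
  qed
  define u where "u = (b\<^sup>2 + c\<^sup>2 - a\<^sup>2) / (2 * b * c)"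
  define v where "v = (c\<^sup>2 + a\<^sup>2 - b\<^sup>2) / (2 * c * a)"
  define w where "w = (a\<^sup>2 + b\<^sup>2 - c\<^sup>2) / (2 * a * b)"
  have u: "\<bar>u\<bar> \<le> 1" and v: "\<bar>v\<bar> \<le> 1" and w: "\<bar>w\<bar> \<le> 1"
    unfolding u_def v_def w_def by (rule cosine_bounds; use pos tri in linarith)+
  have nz: "a \<noteq> 0" "b \<noteq> 0" "c \<noteq> 0" using pos by auto
  \<comment> \<open>Places the sum of the first two angles below pi, so that \<open>arccos\<close>
    inverts the cosine.\<close>
  have uv: "u + v \<ge> 0"
  proof -
    have "u + v = (a + b) * ((c + a - b) * (b + c - a)) / (2 * a * b * c)"
      unfolding u_def v_def using nz by (simp add: field_simps power2_eq_square)
    then show ?thesis using pos tri by simp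
  qed
  have prod: "(1 - u\<^sup>2) * (1 - v\<^sup>2) = (u * v + w)\<^sup>2"
    unfolding u_def v_def w_def using nz by (simp add: field_simps power2_eq_square)
  \<comment> \<open>Decides the sign of the square root; the numerator is Heron's product.\<close>
  have uvw: "u * v + w \<ge> 0"
  proof -
    have "u * v + w = (a + b + c) * (b + c - a) * ((a + c - b) * (a + b - c)) / (4 * a * b * c\<^sup>2)"
      unfolding u_def v_def w_def using nz by (simp add: field_simps power2_eq_square)
    moreover have "\<dots> \<ge> 0" using pos tri by (intro divide_nonneg_pos mult_nonneg_nonneg) auto
    ultimately show ?thesis by simp
  qed
  have "sin (arccos u) * sin (arccos v) = sqrt ((u * v + w)\<^sup>2)"
    using u v by (simp add: sin_arccos_abs real_sqrt_mult[symmetric] prod)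
  then have "cos (arccos u + arccos v) = - w"
    using u v uvw by (simp add: cos_add)
  then have cosw: "cos (pi - (arccos u + arccos v)) = w" by (simp add: cos_diff)
  have "arccos v \<le> arccos (- u)"
    using u v uv by (intro arccos_le_mono[THEN iffD2]) auto
  also have "\<dots> = pi - arccos u" using u by (intro arccos_minus) auto
  finally have "0 \<le> pi - (arccos u + arccos v)" by simp
  moreover have "pi - (arccos u + arccos v) \<le> pi"
    using arccos_lbound[of u] arccos_lbound[of v] u v by (simp add: abs_le_iff)
  ultimately have "arccos w = pi - (arccos u + arccos v)"
    using arccos_cos[of "pi - (arccos u + arccos v)"] cosw by simp
  then show ?thesis by (simp add: u_def v_def w_def)
qed

text \<open>If the law of cosines holds with \<open>\<ge>\<close>, every angle is at most its Euclidean comparison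
  angle.\<close>

lemma angle_sum_le_pi:
  fixes a b c x y z :: real
  assumes pos: "0 < a" "0 < b" "0 < c"
    and x: "\<bar>x\<bar> \<le> b * c" "b\<^sup>2 + c\<^sup>2 - 2 * x \<le> a\<^sup>2"
    and y: "\<bar>y\<bar> \<le> c * a" "c\<^sup>2 + a\<^sup>2 - 2 * y \<le> b\<^sup>2"
    and z: "\<bar>z\<bar> \<le> a * b" "a\<^sup>2 + b\<^sup>2 - 2 * z \<le> c\<^sup>2"
  shows "arccos (x / (b * c)) + arccos (y / (c * a)) + arccos (z / (a * b)) \<le> pi"
proof -
  \<comment> \<open>The comparison triangle exists: with Cauchy-Schwarz, the cosine inequality gives
    (q - r)^2 <= p^2.\<close>
  have triangle: "q \<le> r + p" if "0 < p" "\<bar>s\<bar> \<le> q * r" "q\<^sup>2 + r\<^sup>2 - 2 * s \<le> p\<^sup>2" "0 < q" "0 < r"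
    for p q r s :: real
  proof -
    have "(q - r)\<^sup>2 \<le> p\<^sup>2" using that(2,3) by (simp add: power2_eq_square algebra_simps abs_le_iff)
    then have "\<bar>q - r\<bar> \<le> \<bar>p\<bar>" by (simp add: abs_le_square_iff)
    then show ?thesis using that by auto
  qed
  have tri: "a \<le> b + c" "b \<le> c + a" "c \<le> a + b"
    using triangle[OF pos(3) z pos(1,2)] triangle[OF pos(1) x pos(2,3)] triangle[OF pos(2) y pos(3,1)]
    by auto
  have compare: "arccos (s / (q * r)) \<le> arccos ((q\<^sup>2 + r\<^sup>2 - p\<^sup>2) / (2 * q * r))"
    if "\<bar>s\<bar> \<le> q * r" "q\<^sup>2 + r\<^sup>2 - 2 * s \<le> p\<^sup>2" "0 < q" "0 < r" "p \<le> q + r" "0 < p" for p q r s :: real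
  proof -
    have "(q\<^sup>2 + r\<^sup>2 - p\<^sup>2) / (2 * q * r) \<le> (2 * s) / (2 * q * r)"
      using that by (intro divide_right_mono) auto
    also have "\<dots> = s / (q * r)" by simp
    finally have le: "(q\<^sup>2 + r\<^sup>2 - p\<^sup>2) / (2 * q * r) \<le> s / (q * r)" .
    have s1: "s / (q * r) \<le> 1" using that by (simp add: abs_le_iff)
    show ?thesis
    \<comment> \<open>\<open>arccos\<close> is controlled only on [-1, 1]; a comparison cosine below
      -1 would contradict the triangle inequality.\<close>
    proof (cases "- 1 \<le> (q\<^sup>2 + r\<^sup>2 - p\<^sup>2) / (2 * q * r)")
      case True
      show ?thesis
        by (rule arccos_le_arccos) (use True le s1 in auto)
    next
      case False
      then have "q\<^sup>2 + r\<^sup>2 - p\<^sup>2 < - (2 * q * r)" using that(3,4) by (simp add: field_simps)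
      then have "(q + r)\<^sup>2 < p\<^sup>2" by (simp add: power2_sum)
      then have "q + r < p" using that(6) by (rule power_less_imp_less_base[OF _ less_imp_le])
      then show ?thesis using that(5) by simp
    qed
  qed
  have "arccos (x / (b * c)) + arccos (y / (c * a)) + arccos (z / (a * b))
     \<le> arccos ((b\<^sup>2 + c\<^sup>2 - a\<^sup>2) / (2 * b * c)) + arccos ((c\<^sup>2 + a\<^sup>2 - b\<^sup>2) / (2 * c * a))
    + arccos ((a\<^sup>2 + b\<^sup>2 - c\<^sup>2) / (2 * a * b))"
    using tri by (intro add_mono compare x y z pos) auto
  then show ?thesis using arccos_euclidean_triangle_sum[OF pos tri] by simp
qed


section \<open>Geodesics and their angles\<close>

lemma tendsto_powr_difference_quotient:
  fixes r :: real assumes "r > 0"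
  shows "((\<lambda>t. (r powr t - 1) / t) \<longlongrightarrow> ln r) (at_right 0)"
proof -
  have "((\<lambda>t. r powr t) has_real_derivative ln r) (at 0)"
    using assms by (auto intro!: derivative_eq_intros)
  then have "((\<lambda>t. (r powr t - 1) / t) \<longlongrightarrow> ln r) (at 0)"
    using assms by (simp add: has_field_derivative_iff)
  then show ?thesis by (rule filterlim_mono) (simp_all add: at_within_le_at)
qed

text \<open>Lipschitz constant of \<open>z \<mapsto> ((\<rho>z)\<^sup>t - 1)/t - ln (\<rho>z)\<close>, from its derivative
  \<open>((\<rho>z)\<^sup>t - 1)/z\<close>.\<close>

lemma powr_quotient_lipschitz:
  fixes r m M A t z :: real
  assumes r: "r > 0" and m: "0 < m" "m \<le> 1" "1 \<le> M" and A: "r * M \<le> A" "1 / A \<le> r * m" "1 \<le> A"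
    and t: "0 < t" and z: "z \<in> {m..M}"
  shows "\<bar>((r powr t * z powr t - 1) / t - ln r - ln z) - ((r powr t - 1) / t - ln r)\<bar>
    \<le> (A powr t - A powr (-t)) / m * \<bar>z - 1\<bar>"
proof -
  have "norm (((r powr t * z powr t - 1) / t - ln r - ln z) - ((r powr t * 1 powr t - 1) / t - ln r - ln 1))
    \<le> (A powr t - A powr (-t)) / m * norm (z - 1)"
  proof (rule field_differentiable_bound[where S = "{m..M}" and f' = "\<lambda>z. ((r * z) powr t - 1) / z"])
    fix y assume y: "y \<in> {m..M}"
    have y0: "y > 0" using y m by simp
    have "((\<lambda>z. (r powr t * z powr t - 1) / t - ln r - ln z) has_real_derivative
        (r powr t * y powr t - 1) / y) (at y within {m..M})"
      using y0 t by (auto intro!: derivative_eq_intros simp: powr_diff field_simps)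
    then show "((\<lambda>z. (r powr t * z powr t - 1) / t - ln r - ln z) has_real_derivative
        ((r * y) powr t - 1) / y) (at y within {m..M})"
      using r y0 by (simp add: powr_mult)
    have up: "(r * y) powr t \<le> A powr t"
      using y r y0 A t by (intro powr_mono2) (auto intro: order_trans[OF mult_left_mono])
    have "1 / A \<le> r * y" using y r by (intro order_trans[OF A(2) mult_left_mono]) auto
    then have "(1 / A) powr t \<le> (r * y) powr t"
      using A t by (intro powr_mono2) auto
    then have low: "A powr (-t) \<le> (r * y) powr t"
      using A by (simp add: powr_divide powr_minus inverse_eq_divide)
    have one: "A powr (-t) \<le> 1" "1 \<le> A powr t"
      using A t by (auto simp: ge_one_powr_ge_zero powr_minus inverse_le_1_iff)
    \<comment> \<open>Both (r y)^t and 1 lie between A^(-t) and A^t.\<close>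
    have "\<bar>(r * y) powr t - 1\<bar> \<le> A powr t - A powr (-t)"
      using up low one by linarith
    then show "norm (((r * y) powr t - 1) / y) \<le> (A powr t - A powr (-t)) / m"
      using y m y0 by (simp add: abs_divide) (intro frac_le, auto)
  qed (use z m in auto)
  then show ?thesis by simp
qed

context hs_space
begin

text \<open>\<open>HR\<close> without self-adjointness, which then need not be checked for
  difference quotients; \<open>norm2\<close> still separates points here and obeys the triangle
  inequality.\<close>

definition scalar_perturbations :: "('a \<Rightarrow>\<^sub>L 'a) set" where
  "scalar_perturbations = {a + scal r | a r. a \<in> hilbert_schmidt}"

lemma scalar_perturbations_I: "a \<in> hilbert_schmidt \<Longrightarrow> a + scal r \<in> scalar_perturbations"
  by (auto simp: scalar_perturbations_def)

lemma scalar_perturbations_diff: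
  assumes "x \<in> scalar_perturbations" "y \<in> scalar_perturbations"
  shows "x - y \<in> scalar_perturbations" "norm2 (x - y) \<le> norm2 x + norm2 y"
proof -
  obtain a r b s where a: "a \<in> hilbert_schmidt" "x = a + scal r"
    and b: "b \<in> hilbert_schmidt" "y = b + scal s"
    using assms by (auto simp: scalar_perturbations_def)
  have eq: "x - y = (a - b) + scal (r - s)" by (simp add: a(2) b(2) scaleR_diff_left)
  show "x - y \<in> scalar_perturbations" unfolding eq by (intro scalar_perturbations_I hs_diff a b)
  have "x - y = (a + scal r) + ((-1) *\<^sub>R b + scal (- s))" unfolding eq by (simp add: scaleR_diff_left)
  then have "norm2 (x - y) \<le> norm2 (a + scal r) + norm2 ((-1) *\<^sub>R b + scal (- s))"
    using norm2_triangle[OF a(1) hs_scaleR(1)[OF b(1)]] by metis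
  also have "norm2 ((-1) *\<^sub>R b + scal (- s)) = norm2 y"
    unfolding norm2_eq[OF hs_scaleR(1)[OF b(1)]] b(2) norm2_eq[OF b(1)] hs_scaleR(2)[OF b(1)] by simp
  finally show "norm2 (x - y) \<le> norm2 x + norm2 y" unfolding a(2) .
qed

lemma norm2_eq_0:
  assumes "x \<in> scalar_perturbations" "norm2 x = 0"
  shows "x = 0"
proof -
  obtain a r where a: "a \<in> hilbert_schmidt" "x = a + scal r"
    using assms(1) by (auto simp: scalar_perturbations_def)
  then have "(2 * N a)\<^sup>2 + r\<^sup>2 = 0" using assms(2) norm2_eq by (simp add: real_sqrt_eq_zero_cancel_iff)
  then have "2 * N a = 0 \<and> r = 0" by (simp only: sum_power2_eq_zero_iff)
  then show ?thesis using N_eq_0 a by simp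
qed

text \<open>As S S = P, a scalar w becomes w P, that is, w plus the Hilbert-Schmidt operator w (P -
  1).\<close>

lemma sandwich_decomposition:
  assumes P: "hs_pos P" and W: "W \<in> hilbert_schmidt" and l: "l \<ge> 0"
  defines "S \<equiv> op_powr P (1/2)"
  shows "\<exists>a. a \<in> hilbert_schmidt \<and> (adjp W W \<longrightarrow> adjp a a) \<and>
    l *\<^sub>R (S o\<^sub>L (W + scal w) o\<^sub>L S) = a + scal (l * w) \<and>
    N a \<le> l * (norm S * (norm S * N W) + \<bar>w\<bar> * N (P - id_blinfun))"
proof -
  have S: "adjp S S" "S \<in> bounded_ops" unfolding S_def by (intro hs_posD hs_pos_powr P)+
  have SS: "S (S x) = P x" for x
    using hs_pos_powr_apply(1)[OF P, of "1/2" "1/2"] hs_pos_powr_apply(3)[OF P] by (simp add: S_def)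
  define b where "b = S o\<^sub>L W o\<^sub>L S"
  define a where "a = l *\<^sub>R (b + w *\<^sub>R (P - id_blinfun))"
  note hsl = hs_compose_left[OF S(2) W]
  note hsb = hs_compose_right[OF hsl(1) S(1), folded b_def]
  note hsp = hs_scaleR[OF hs_posD(1)[OF P], of w]
  have hsa: "a \<in> hilbert_schmidt"
    unfolding a_def by (intro hs_scaleR hs_add hsb hs_posD P)
  have "N a \<le> l * (N b + N (w *\<^sub>R (P - id_blinfun)))"
    unfolding a_def hs_scaleR(2)[OF hs_add[OF hsb(1) hsp(1)]] abs_of_nonneg[OF l]
    by (intro mult_left_mono N_triangle hsb hsp l)
  also have "\<dots> \<le> l * (norm S * (norm S * N W) + \<bar>w\<bar> * N (P - id_blinfun))"
    unfolding hsp(2)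
    by (intro mult_left_mono add_right_mono order_trans[OF hsb(2)] hsl(2) l norm_ge_zero)
  finally have N: "N a \<le> l * (norm S * (norm S * N W) + \<bar>w\<bar> * N (P - id_blinfun))" .
  have "adjp a a" if "adjp W W"
  proof -
    have "adjp b b"
      unfolding b_def using adjp_compose[OF adjp_compose[OF S(1) that] S(1)]
      by (simp add: blinfun_compose_assoc)
    then show ?thesis
      unfolding a_def by (intro adjp_scaleR adjp_add adjp_diff adjp_id hs_posD(2)[OF P])
  qed
  moreover have "l *\<^sub>R (S o\<^sub>L (W + scal w) o\<^sub>L S) = a + scal (l * w)"
    by (rule blinfun_eqI) (simp add: a_def b_def blinfun_simps SS algebra_simps)
  ultimately show ?thesis using hsa N by blast
qed

text \<open>The formal derivative at 0 of the curve in \<open>geodesic_eq\<close>, one logarithm for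
  each of its two factors.\<close>

definition tangent :: "real \<Rightarrow> ('a \<Rightarrow>\<^sub>L 'a) \<Rightarrow> real \<Rightarrow> ('a \<Rightarrow>\<^sub>L 'a) \<Rightarrow> ('a \<Rightarrow>\<^sub>L 'a)" where
  "tangent l P k Q = l *\<^sub>R (op_powr P (1/2) o\<^sub>L
     (op_fun ln (transition P Q) + scal (ln (k / l))) o\<^sub>L op_powr P (1/2))"

lemma tangent_HR:
  assumes P: "hs_pos P" and Q: "hs_pos Q" and l: "l > 0"
  shows "tangent l P k Q \<in> HR"
proof -
  have l': "l \<ge> 0" using l by simp
  note X = hs_pos_ln[OF hs_pos_transition[OF P Q]]
  show ?thesis
    using sandwich_decomposition[OF P X(1) l', of "ln (k / l)"] X(2) HR_I
    unfolding tangent_def by metis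
qed

text \<open>W t is ((r C)^t - 1)/t - ln (r C). Its scalar part w t is the value at eigenvalue 1, and
  the rest is bounded by the Lipschitz constant L t times \<open>N (C - id_blinfun)\<close>. Both w
  and L tend to 0, which gives convergence in \<open>norm2\<close>.\<close>

lemma geodesic_difference_quotient:
  assumes P: "hs_pos P" and Q: "hs_pos Q" and l: "l > 0" and k: "k > 0"
  defines "g \<equiv> geodesic (l *\<^sub>R P) (k *\<^sub>R Q)"
  shows "\<exists>B. (B \<longlongrightarrow> 0) (at_right 0) \<and> (\<forall>t>0.
    (1 / t) *\<^sub>R (g t - g 0) - tangent l P k Q \<in> scalar_perturbations \<and>
    norm2 ((1 / t) *\<^sub>R (g t - g 0) - tangent l P k Q) \<le> B t)"
proof -
  define S where "S = op_powr P (1/2)"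
  define C where "C = transition P Q"
  define r where "r = k / l"
  have r: "r > 0" using k l by (simp add: r_def)
  have C: "hs_pos C" unfolding C_def by (rule hs_pos_transition[OF P Q])
  obtain F \<gamma> m M where F: "onb F" "diag F \<gamma> C" "0 < m" "m \<le> 1" "1 \<le> M" "\<forall>e\<in>F. \<gamma> e \<in> {m..M}"
    by (rule hs_pos_diag[OF C])
  \<comment> \<open>Chosen so that r times any eigenvalue of C lies between 1/A and A.\<close>
  define A where "A = max 1 (max (r * M) (1 / (r * m)))"
  have rm: "r * m > 0" using r F(3) by simp
  have A: "r * M \<le> A" "1 \<le> A" "1 / (r * m) \<le> A" by (auto simp: A_def)
  have A': "1 / A \<le> r * m" using A(2,3) rm by (simp add: field_simps)
  define w where "w t = (r powr t - 1) / t - ln r" for t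
  define L where "L t = (A powr t - A powr (-t)) / m" for t
  define W where "W t = (1 / t) *\<^sub>R (r powr t *\<^sub>R op_powr C t - id_blinfun) - scal (ln r) - op_fun ln C" for t
  define B where "B t = 2 * (l * (norm S * (norm S * (L t * N (C - id_blinfun))) + \<bar>w t\<bar> * N (P - id_blinfun)))
    + l * \<bar>w t\<bar>" for t
  have w0: "(w \<longlongrightarrow> 0) (at_right 0)"
    using tendsto_diff[OF tendsto_powr_difference_quotient[OF r] tendsto_const[of "ln r"]]
    by (simp add: w_def[abs_def])
  have "((\<lambda>t. (A powr t - A powr (-t)) / m) \<longlongrightarrow> (A powr 0 - A powr (-0)) / m) (at_right 0)"
    using A(2) F(3) by (intro tendsto_intros) auto
  then have L0: "(L \<longlongrightarrow> 0) (at_right 0)" using A(2) by (simp add: L_def[abs_def])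
  have "(B \<longlongrightarrow> 2 * (l * (norm S * (norm S * (0 * N (C - id_blinfun))) + \<bar>0\<bar> * N (P - id_blinfun)))
    + l * \<bar>0\<bar>) (at_right 0)"
    unfolding B_def by (intro tendsto_intros w0 L0)
  then have B0: "(B \<longlongrightarrow> 0) (at_right 0)" by simp
  have "(1 / t) *\<^sub>R (g t - g 0) - tangent l P k Q \<in> scalar_perturbations \<and>
    norm2 ((1 / t) *\<^sub>R (g t - g 0) - tangent l P k Q) \<le> B t" if t: "t > 0" for t
  proof -
    have D: "diag F (\<lambda>e. (1 / t) * (r powr t * \<gamma> e powr t - 1) - ln r * 1 - ln (\<gamma> e)) (W t)"
      unfolding W_def
      by (intro diag_diff diag_scaleR diag_id diag_op_powr[OF F(1,2,6,3)] diag_op_ln[OF F(1,2,6,3)])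
    have L: "0 \<le> L t"
      unfolding L_def using A(2) F(3) t by (intro divide_nonneg_pos) (auto intro: powr_mono)
    have "\<bar>((1 / t) * (r powr t * \<gamma> e powr t - 1) - ln r * 1 - ln (\<gamma> e)) - w t\<bar> \<le> L t * \<bar>\<gamma> e - 1\<bar>"
      if "e \<in> F" for e
      using powr_quotient_lipschitz[OF r F(3-5) A(1) A' A(2) t F(6)[rule_format, OF that]]
      by (simp add: w_def L_def)
    note W = diag_hs_lipschitz[OF F(1,2) hs_posD(1)[OF C] D L this]
    have l': "l \<ge> 0" using l by simp
    obtain a where a: "a \<in> hilbert_schmidt"
      "l *\<^sub>R (S o\<^sub>L ((W t - scal (w t)) + scal (w t)) o\<^sub>L S) = a + scal (l * w t)"
      "N a \<le> l * (norm S * (norm S * N (W t - scal (w t))) + \<bar>w t\<bar> * N (P - id_blinfun))"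
      using sandwich_decomposition[OF P W(1) l', of "w t"] unfolding S_def by blast
    have "(1 / t) *\<^sub>R (g t - g 0) - tangent l P k Q = l *\<^sub>R (S o\<^sub>L ((W t - scal (w t)) + scal (w t)) o\<^sub>L S)"
      unfolding g_def geodesic_eq[OF P Q l k] tangent_def C_def[symmetric] S_def[symmetric] r_def[symmetric]
      using r by (intro blinfun_eqI)
        (simp add: W_def blinfun_simps hs_pos_powr_0_1[OF C] algebra_simps)
    then have eq: "(1 / t) *\<^sub>R (g t - g 0) - tangent l P k Q = a + scal (l * w t)" unfolding a(2) .
    have "norm2 (a + scal (l * w t)) = sqrt ((2 * N a)\<^sup>2 + \<bar>l * w t\<bar>\<^sup>2)" by (simp add: norm2_eq[OF a(1)])
    also have "\<dots> \<le> 2 * N a + \<bar>l * w t\<bar>"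
      by (rule sqrt_sum_squares_le_sum) (simp_all add: N_nonneg)
    also have "\<dots> \<le> B t"
    proof -
      have "N a \<le> l * (norm S * (norm S * (L t * N (C - id_blinfun))) + \<bar>w t\<bar> * N (P - id_blinfun))"
        using l' by (intro order_trans[OF a(3)] mult_left_mono add_right_mono W(2) norm_ge_zero)
      then show ?thesis using l by (simp add: B_def abs_mult)
    qed
    finally show ?thesis unfolding eq using scalar_perturbations_I[OF a(1)] by blast
  qed
  then show ?thesis using B0 by blast
qed

lemma initial_velocity_geodesic:
  assumes P: "hs_pos P" and Q: "hs_pos Q" and l: "l > 0" and k: "k > 0"
  shows "initial_velocity (geodesic (l *\<^sub>R P) (k *\<^sub>R Q)) = tangent l P k Q"
proof -
  define g where "g = geodesic (l *\<^sub>R P) (k *\<^sub>R Q)"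
  define D where "D t = (1 / t) *\<^sub>R (g t - g 0)" for t
  define v where "v = tangent l P k Q"
  obtain B where B: "(B \<longlongrightarrow> 0) (at_right 0)" "\<And>t. t > 0 \<Longrightarrow> D t - v \<in> scalar_perturbations"
    "\<And>t. t > 0 \<Longrightarrow> norm2 (D t - v) \<le> B t"
    using geodesic_difference_quotient[OF P Q l k] unfolding D_def g_def v_def by blast
  have at0: "at 0 within {0..1} = at_right (0::real)" by (rule at_within_Icc_at_right) simp
  have pos: "\<forall>\<^sub>F t in at_right (0::real). 0 < t" by (rule eventually_at_right_less)
  have nonneg: "0 \<le> norm2 x" if x: "x \<in> scalar_perturbations" for x
  proof -
    obtain a r where "a \<in> hilbert_schmidt" "x = a + scal r" using x by (auto simp: scalar_perturbations_def)
    then show ?thesis by (simp add: norm2_eq)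
  qed
  have HRS: "x \<in> scalar_perturbations" if "x \<in> HR" for x
    using HR_cases[OF that] scalar_perturbations_I by metis
  have vHR: "v \<in> HR" unfolding v_def by (rule tangent_HR[OF P Q l])
  have lim: "((\<lambda>t. norm2 (D t - v)) \<longlongrightarrow> 0) (at_right 0)"
  proof (rule tendsto_sandwich[OF _ _ tendsto_const B(1)])
    show "\<forall>\<^sub>F t in at_right 0. 0 \<le> norm2 (D t - v)"
      using pos by eventually_elim (intro nonneg B(2))
    show "\<forall>\<^sub>F t in at_right 0. norm2 (D t - v) \<le> B t"
      using pos by eventually_elim (rule B(3))
  qed
  have "initial_velocity g = v"
    unfolding initial_velocity_def at0 D_def[symmetric]
  proof (rule the_equality)
    show "v \<in> HR \<and> ((\<lambda>t. norm2 (D t - v)) \<longlongrightarrow> 0) (at_right 0)" using vHR lim by blast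
    fix v' assume v': "v' \<in> HR \<and> ((\<lambda>t. norm2 (D t - v')) \<longlongrightarrow> 0) (at_right 0)"
    have mem: "v - v' \<in> scalar_perturbations"
      using scalar_perturbations_diff(1) HRS vHR v' by blast
    have le: "norm2 (v - v') \<le> norm2 (D t - v') + norm2 (D t - v)" if "t > 0" for t
    proof -
      have "D t - v' \<in> scalar_perturbations"
        using scalar_perturbations_diff(1)[OF B(2)[OF that] scalar_perturbations_diff(1)[OF HRS HRS]]
          v' vHR by (metis (no_types, lifting) diff_diff_eq2 diff_add_cancel)
      from scalar_perturbations_diff(2)[OF this B(2)[OF that]] show ?thesis by simp
    qed
    have "((\<lambda>t. norm2 (D t - v') + norm2 (D t - v)) \<longlongrightarrow> 0 + 0) (at_right 0)"
      using v' lim by (intro tendsto_add) auto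
    then have "norm2 (v - v') \<le> 0 + 0"
      by (rule tendsto_lowerbound[OF _ eventually_mono[OF pos le]]) simp_all
    then have "v - v' = 0" using norm2_eq_0[OF mem] nonneg[OF mem] by simp
    then show "v' = v" by simp
  qed
  then show ?thesis by (simp add: g_def v_def)
qed

end

context hs_space
begin

section \<open>The Riemannian metric on initial velocities\<close>

lemma ip_compose_left:
  assumes T: "T \<in> hilbert_schmidt" and R: "R \<in> hilbert_schmidt" and A: "adjp A A"
  shows "ip (A o\<^sub>L T) R = ip T (A o\<^sub>L R)"
proof (rule ip_eqI[OF _ R])
  note Ab = adjp_bounded_ops[OF A]
  show "A o\<^sub>L T \<in> hilbert_schmidt" by (rule hs_compose_left(1)[OF Ab T])
  have "inner (T e) ((A o\<^sub>L R) e) = inner ((A o\<^sub>L T) e) (R e)" for e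
    using adjpD[OF A, of "T e" "R e"] by (simp flip: Re_cinner)
  then show "((\<lambda>e. inner ((A o\<^sub>L T) e) (R e)) has_sum ip T (A o\<^sub>L R)) E0"
    using ip_has_sum[OF T hs_compose_left(1)[OF Ab R] onb0] by simp
qed

text \<open>Moving S across the inner product cancels \<open>S'\<close>; adjoints bring the
  remaining right factors to the left, where they cancel likewise.\<close>

lemma ip_similarity:
  assumes X: "X \<in> hilbert_schmidt" "adjp X X" and Y: "Y \<in> hilbert_schmidt" "adjp Y Y"
    and S: "adjp S S" and S': "adjp S' S'" and inv: "S o\<^sub>L S' = id_blinfun" "S' o\<^sub>L S = id_blinfun"
  shows "ip (S o\<^sub>L (X o\<^sub>L S')) (S' o\<^sub>L (Y o\<^sub>L S)) = ip X Y"
proof -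
  have SS': "S (S' x) = x" "S' (S x) = x" for x
    using inv by (metis blinfun_apply_blinfun_compose blinfun_apply_id_blinfun)+
  note XS' = hs_compose_right(1)[OF X(1) S'] and YS = hs_compose_right(1)[OF Y(1) S]
  note Sb = adjp_bounded_ops[OF S] and S'b = adjp_bounded_ops[OF S']
  have "ip (S o\<^sub>L (X o\<^sub>L S')) (S' o\<^sub>L (Y o\<^sub>L S)) = ip (X o\<^sub>L S') (S o\<^sub>L (S' o\<^sub>L (Y o\<^sub>L S)))"
    by (rule ip_compose_left[OF XS' hs_compose_left(1)[OF S'b YS] S])
  also have "S o\<^sub>L (S' o\<^sub>L (Y o\<^sub>L S)) = Y o\<^sub>L S" by (rule blinfun_eqI) (simp add: SS')
  also have "ip (X o\<^sub>L S') (Y o\<^sub>L S) = ip (S' o\<^sub>L X) (S o\<^sub>L Y)"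
    by (rule ip_adj[OF XS' adjp_compose[OF X(2) S'] YS adjp_compose[OF Y(2) S], symmetric])
  also have "\<dots> = ip X (S' o\<^sub>L (S o\<^sub>L Y))"
    by (rule ip_compose_left[OF X(1) hs_compose_left(1)[OF Sb Y(1)] S'])
  also have "S' o\<^sub>L (S o\<^sub>L Y) = Y" by (rule blinfun_eqI) (simp add: SS')
  finally show ?thesis .
qed

text \<open>Congruence by p^(1/2) is an isometry from the tangent space at 1 to that at p:
  multiplying by p^(-1) leaves similarities by S, under which the pairing is invariant.\<close>

lemma riem_metric_sandwich:
  assumes P: "hs_pos P" and l: "l > 0"
    and X: "X \<in> hilbert_schmidt" "adjp X X" and Y: "Y \<in> hilbert_schmidt" "adjp Y Y"
  defines "S \<equiv> op_powr P (1/2)"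
  shows "riem_metric (l *\<^sub>R P) (l *\<^sub>R (S o\<^sub>L (X + scal x) o\<^sub>L S)) (l *\<^sub>R (S o\<^sub>L (Y + scal y) o\<^sub>L S))
    = 4 * ip X Y + x * y"
proof -
  define S' where "S' = op_powr P (-1/2)"
  have S: "adjp S S" "S \<in> bounded_ops" and S': "adjp S' S'" "S' \<in> bounded_ops"
    unfolding S_def S'_def by (intro hs_posD hs_pos_powr P)+
  have simps: "S (op_powr P (-1) z) = S' z" "op_powr P (-1) (S z) = S' z" "S (S' z) = z" "S' (S z) = z" for z
    unfolding S_def S'_def by (simp_all add: hs_pos_powr_apply[OF P])
  have left: "l *\<^sub>R (S o\<^sub>L (X + scal x) o\<^sub>L S) o\<^sub>L op_inv (l *\<^sub>R P) = (S o\<^sub>L (X o\<^sub>L S')) + scal x"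
    unfolding op_inv_scaleR[OF P l] using l
    by (intro blinfun_eqI) (simp add: blinfun_simps simps)
  have right: "op_inv (l *\<^sub>R P) o\<^sub>L l *\<^sub>R (S o\<^sub>L (Y + scal y) o\<^sub>L S) = (S' o\<^sub>L (Y o\<^sub>L S)) + scal y"
    unfolding op_inv_scaleR[OF P l] using l
    by (intro blinfun_eqI) (simp add: blinfun_simps simps scaleR_add_right)
  have "Re (inner2 ((S o\<^sub>L (X o\<^sub>L S')) + scal x) ((S' o\<^sub>L (Y o\<^sub>L S)) + scal y))
      = 4 * ip (S o\<^sub>L (X o\<^sub>L S')) (S' o\<^sub>L (Y o\<^sub>L S)) + x * y"
    by (intro Re_inner2 hs_compose_left(1) S S' hs_compose_right(1)[OF X(1) S'(1)]
        hs_compose_right(1)[OF Y(1) S(1)])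
  also have "ip (S o\<^sub>L (X o\<^sub>L S')) (S' o\<^sub>L (Y o\<^sub>L S)) = ip X Y"
    by (intro ip_similarity X Y S S' blinfun_eqI) (simp_all add: simps)
  finally show ?thesis unfolding riem_metric_def left right .
qed

section \<open>Sides of a triangle and the law of cosines\<close>

text \<open>The length of the geodesic from \<open>l *\<^sub>R P\<close> to \<open>k *\<^sub>R Q\<close>.\<close>

definition side :: "real \<Rightarrow> ('a \<Rightarrow>\<^sub>L 'a) \<Rightarrow> real \<Rightarrow> ('a \<Rightarrow>\<^sub>L 'a) \<Rightarrow> real" where
  "side l P k Q = sqrt ((2 * N (op_fun ln (transition P Q)))\<^sup>2 + (ln (k / l))\<^sup>2)"

text \<open>The inner product at \<open>l *\<^sub>R P\<close> of the initial velocities towards the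
  two other vertices.\<close>

definition side_product :: "real \<Rightarrow> ('a \<Rightarrow>\<^sub>L 'a) \<Rightarrow> real \<Rightarrow> ('a \<Rightarrow>\<^sub>L 'a) \<Rightarrow> real \<Rightarrow> ('a \<Rightarrow>\<^sub>L 'a) \<Rightarrow> real" where
  "side_product l P k Q j R =
     4 * ip (op_fun ln (transition P Q)) (op_fun ln (transition P R)) + ln (k / l) * ln (j / l)"

lemma inner_angle_eq:
  assumes P: "hs_pos P" and Q: "hs_pos Q" and R: "hs_pos R" and pos: "l > 0" "k > 0" "j > 0"
  shows "inner_angle (l *\<^sub>R P) (k *\<^sub>R Q) (j *\<^sub>R R)
    = arccos (side_product l P k Q j R / (side l P k Q * side l P j R))"
proof -
  note X = hs_pos_ln[OF hs_pos_transition[OF P Q]] and Y = hs_pos_ln[OF hs_pos_transition[OF P R]]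
  have "riem_metric (l *\<^sub>R P) (tangent l P k Q) (tangent l P j R) = side_product l P k Q j R"
    unfolding tangent_def side_product_def by (rule riem_metric_sandwich[OF P pos(1) X Y])
  moreover have "riem_norm (l *\<^sub>R P) (tangent l P k Q) = side l P k Q"
    unfolding riem_norm_def tangent_def side_def riem_metric_sandwich[OF P pos(1) X X] ip_self[OF X(1)]
    by (simp add: power_mult_distrib power2_eq_square)
  moreover have "riem_norm (l *\<^sub>R P) (tangent l P j R) = side l P j R"
    unfolding riem_norm_def tangent_def side_def riem_metric_sandwich[OF P pos(1) Y Y] ip_self[OF Y(1)]
    by (simp add: power_mult_distrib power2_eq_square)
  ultimately show ?thesis
    by (simp add: inner_angle_def riem_angle_def initial_velocity_geodesic P Q R pos)
qed

lemma side_nonneg: "0 \<le> side l P k Q"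
  by (simp add: side_def)

text \<open>Cauchy-Schwarz in the sum of the Hilbert-Schmidt part and the real line, the latter step
  by Lagrange's identity.\<close>

lemma abs_side_product_le:
  assumes P: "hs_pos P" and Q: "hs_pos Q" and R: "hs_pos R"
  shows "\<bar>side_product l P k Q j R\<bar> \<le> side l P k Q * side l P j R"
proof -
  note X = hs_pos_ln(1)[OF hs_pos_transition[OF P Q]] and Y = hs_pos_ln(1)[OF hs_pos_transition[OF P R]]
  define a b c d where "a = 2 * N (op_fun ln (transition P Q))" and "b = ln (k / l)"
    and "c = 2 * N (op_fun ln (transition P R))" and "d = ln (j / l)"
  have "\<bar>4 * ip (op_fun ln (transition P Q)) (op_fun ln (transition P R))\<bar> \<le> a * c"
    using ip_Cauchy_Schwarz[OF X Y] by (simp add: a_def c_def abs_mult)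
  then have "\<bar>4 * ip (op_fun ln (transition P Q)) (op_fun ln (transition P R))\<bar> + \<bar>b * d\<bar>
      \<le> a * c + \<bar>b\<bar> * \<bar>d\<bar>" by (simp add: abs_mult)
  then have "\<bar>side_product l P k Q j R\<bar> \<le> a * c + \<bar>b\<bar> * \<bar>d\<bar>"
    unfolding side_product_def b_def d_def by (rule order_trans[OF abs_triangle_ineq])
  also have "\<dots> \<le> sqrt ((a\<^sup>2 + b\<^sup>2) * (c\<^sup>2 + d\<^sup>2))"
  proof (rule real_le_rsqrt)
    have "(a * c + \<bar>b\<bar> * \<bar>d\<bar>)\<^sup>2 + (a * \<bar>d\<bar> - \<bar>b\<bar> * c)\<^sup>2 = (a\<^sup>2 + \<bar>b\<bar>\<^sup>2) * (c\<^sup>2 + \<bar>d\<bar>\<^sup>2)"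
      by (simp only: power2_eq_square) algebra
    then have "(a * c + \<bar>b\<bar> * \<bar>d\<bar>)\<^sup>2 + (a * \<bar>d\<bar> - \<bar>b\<bar> * c)\<^sup>2 = (a\<^sup>2 + b\<^sup>2) * (c\<^sup>2 + d\<^sup>2)" by simp
    then show "(a * c + \<bar>b\<bar> * \<bar>d\<bar>)\<^sup>2 \<le> (a\<^sup>2 + b\<^sup>2) * (c\<^sup>2 + d\<^sup>2)"
      using zero_le_power2[of "a * \<bar>d\<bar> - \<bar>b\<bar> * c"] by linarith
  qed
  finally show ?thesis by (simp add: side_def a_def b_def c_def d_def real_sqrt_mult)
qed

text \<open>The left side is the squared norm of the difference of two initial velocities. Its
  scalar part is exactly ln (j/k); the operator part is where the metric increasing property
  enters.\<close>

lemma law_of_cosines: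
  assumes P: "hs_pos P" and Q: "hs_pos Q" and R: "hs_pos R" and pos: "l > 0" "k > 0" "j > 0"
  shows "(side l P k Q)\<^sup>2 + (side l P j R)\<^sup>2 - 2 * side_product l P k Q j R \<le> (side k Q j R)\<^sup>2"
proof -
  note X = hs_pos_ln(1)[OF hs_pos_transition[OF P Q]] and Y = hs_pos_ln(1)[OF hs_pos_transition[OF P R]]
  have ln: "ln (j / l) - ln (k / l) = ln (j / k)" using pos by (simp add: ln_div)
  have "(side l P k Q)\<^sup>2 + (side l P j R)\<^sup>2 - 2 * side_product l P k Q j R
      = 4 * (N (op_fun ln (transition P R) - op_fun ln (transition P Q)))\<^sup>2 + (ln (j / l) - ln (k / l))\<^sup>2"
    unfolding N_diff_sq[OF Y X] ip_commute[OF Y X]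
    by (simp add: side_def side_product_def power_mult_distrib power2_diff algebra_simps)
  also have "\<dots> \<le> 4 * (N (op_fun ln (transition Q R)))\<^sup>2 + (ln (j / k))\<^sup>2"
    unfolding ln
    by (intro add_right_mono mult_left_mono power_mono exponential_metric_increasing P Q R N_nonneg) simp
  also have "\<dots> = (side k Q j R)\<^sup>2" by (simp add: side_def power_mult_distrib)
  finally show ?thesis .
qed

lemma transition_self: "hs_pos P \<Longrightarrow> transition P P = id_blinfun"
proof (rule blinfun_eqI)
  fix x assume P: "hs_pos P"
  have "op_powr P (-1/2) (op_powr P 1 (op_powr P (-1/2) x)) = x"
    by (simp add: hs_pos_powr_apply(1,2)[OF P])
  then show "transition P P x = id_blinfun x" by (simp add: transition_def hs_pos_powr_apply(3)[OF P])
qed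

lemma op_fun_ln_id: "op_fun ln id_blinfun = (0 :: 'a \<Rightarrow>\<^sub>L 'a)"
  by (rule diag_unique[OF onb0 diag_op_ln[OF onb0 diag_id, where m = 1 and M = 1] diag_zero]) simp_all

text \<open>\<open>side\<close> is computed from one end, while a single comparison triangle has to
  serve all three vertices.\<close>

lemma side_commute:
  assumes P: "hs_pos P" and Q: "hs_pos Q" and pos: "l > 0" "k > 0"
  shows "side l P k Q = side k Q l P"
proof -
  have le: "N (op_fun ln (transition P Q)) \<le> N (op_fun ln (transition Q P))" if P: "hs_pos P" and Q: "hs_pos Q"
    for P Q
  proof -
    \<comment> \<open>the degenerate triangle \<open>P\<close>, \<open>Q\<close>, \<open>P\<close>\<close>
    have "N (op_fun ln (transition P P) - op_fun ln (transition P Q)) \<le> N (op_fun ln (transition Q P))"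
      by (rule exponential_metric_increasing[OF P Q P])
    then show ?thesis
      using hs_scaleR(2)[OF hs_pos_ln(1)[OF hs_pos_transition[OF P Q]], of "-1"]
      by (simp add: transition_self[OF P] op_fun_ln_id)
  qed
  have "N (op_fun ln (transition P Q)) = N (op_fun ln (transition Q P))"
    using le[OF P Q] le[OF Q P] by simp
  moreover have "(ln (k / l))\<^sup>2 = (ln (l / k))\<^sup>2"
    using pos by (simp add: ln_div power2_commute)
  ultimately show ?thesis by (simp add: side_def)
qed

text \<open>A vanishing side makes all eigenvalues of the transition operator 1 and the two scalars
  equal, so the vertices coincide.\<close>

lemma side_pos:
  assumes P: "hs_pos P" and Q: "hs_pos Q" and pos: "l > 0" "k > 0" and ne: "l *\<^sub>R P \<noteq> k *\<^sub>R Q"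
  shows "0 < side l P k Q"
proof (rule ccontr)
  assume "\<not> 0 < side l P k Q"
  then have "side l P k Q = 0" using side_nonneg[of l P k Q] by simp
  then have "(2 * N (op_fun ln (transition P Q)))\<^sup>2 + (ln (k / l))\<^sup>2 = 0" by (simp only: side_def real_sqrt_eq_zero_cancel_iff)
  then have "2 * N (op_fun ln (transition P Q)) = 0 \<and> ln (k / l) = 0" by (simp only: sum_power2_eq_zero_iff)
  then have N0: "N (op_fun ln (transition P Q)) = 0" and "ln (k / l) = 0" by auto
  then have kl: "k = l" using pos by (simp add: ln_div)
  note T = hs_pos_transition[OF P Q]
  have X0: "op_fun ln (transition P Q) = 0" by (rule N_eq_0[OF hs_pos_ln(1)[OF T] N0])
  obtain F \<gamma> m M where F: "onb F" "diag F \<gamma> (transition P Q)" "0 < m" "\<forall>e\<in>F. \<gamma> e \<in> {m..M}"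
    using hs_pos_diag[OF T] by metis
  have "\<gamma> e = 1" if e: "e \<in> F" for e
  proof -
    have "ln (\<gamma> e) *\<^sub>R e = 0"
      using diag_apply[OF F(1) diag_op_ln[OF F(1,2,4,3)] e] by (simp add: X0)
    moreover have "e \<noteq> 0" using F(1) e orthonormal_norm[of F e] by (auto simp: onb_def)
    moreover have "\<gamma> e > 0" using F(3,4) e by force
    ultimately show ?thesis by simp
  qed
  then have C: "transition P Q = id_blinfun" by (intro diag_unique[OF F(1,2) diag_id])
  have "Q = P"
  proof (rule blinfun_eqI)
    fix x
    have "op_powr P (1/2) (transition P Q (op_powr P (1/2) x)) = Q x"
      by (simp add: transition_def hs_pos_powr_apply[OF P])
    moreover have "op_powr P (1/2) (transition P Q (op_powr P (1/2) x)) = P x"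
      by (simp add: C hs_pos_powr_apply[OF P])
    ultimately show "Q x = P x" by simp
  qed
  then show False using ne kl by simp
qed

theorem inner_angle_sum_le_pi:
  fixes p q r :: "'a \<Rightarrow>\<^sub>L 'a"
  assumes "p \<in> Sigma_mfd" "q \<in> Sigma_mfd" "r \<in> Sigma_mfd" and ne: "p \<noteq> q" "q \<noteq> r" "r \<noteq> p"
  shows "inner_angle p q r + inner_angle q r p + inner_angle r p q \<le> pi"
proof -
  obtain l P where P: "l > 0" "hs_pos P" "p = l *\<^sub>R P" using Sigma_mfd_cases[OF assms(1)] .
  obtain k Q where Q: "k > 0" "hs_pos Q" "q = k *\<^sub>R Q" using Sigma_mfd_cases[OF assms(2)] .
  obtain j R where R: "j > 0" "hs_pos R" "r = j *\<^sub>R R" using Sigma_mfd_cases[OF assms(3)] .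
  define a where "a = side k Q j R"
  define b where "b = side l P j R"
  define c where "c = side l P k Q"
  have sym: "side j R k Q = a" "side j R l P = b" "side k Q l P = c"
    unfolding a_def b_def c_def by (rule side_commute; use P Q R in blast)+
  note folds = a_def[symmetric] b_def[symmetric] c_def[symmetric] sym
  have pos: "0 < a" "0 < b" "0 < c"
    unfolding a_def b_def c_def using P Q R ne by (auto intro!: side_pos)
  have "arccos (side_product l P k Q j R / (b * c)) + arccos (side_product k Q j R l P / (c * a))
      + arccos (side_product j R l P k Q / (a * b)) \<le> pi"
  proof (rule angle_sum_le_pi[OF pos])
    show "\<bar>side_product l P k Q j R\<bar> \<le> b * c"
      using abs_side_product_le[OF P(2) Q(2) R(2), of l k j] by (simp add: folds mult.commute)
    show "\<bar>side_product k Q j R l P\<bar> \<le> c * a"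
      using abs_side_product_le[OF Q(2) R(2) P(2), of k j l] by (simp add: folds mult.commute)
    show "\<bar>side_product j R l P k Q\<bar> \<le> a * b"
      using abs_side_product_le[OF R(2) P(2) Q(2), of j l k] by (simp add: folds mult.commute)
    show "b\<^sup>2 + c\<^sup>2 - 2 * side_product l P k Q j R \<le> a\<^sup>2"
      using law_of_cosines[OF P(2) Q(2) R(2) P(1) Q(1) R(1)] by (simp add: folds)
    show "c\<^sup>2 + a\<^sup>2 - 2 * side_product k Q j R l P \<le> b\<^sup>2"
      using law_of_cosines[OF Q(2) R(2) P(2) Q(1) R(1) P(1)] by (simp add: folds)
    show "a\<^sup>2 + b\<^sup>2 - 2 * side_product j R l P k Q \<le> c\<^sup>2"
      using law_of_cosines[OF R(2) P(2) Q(2) R(1) P(1) Q(1)] by (simp add: folds)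
  qed
  then show ?thesis
    unfolding P(3) Q(3) R(3)
    by (simp add: inner_angle_eq P Q R folds mult.commute)
qed

end

section \<open>Passage from a fixed basis to the Hilbert space\<close>

lemma infinite_orthonormal_basis:
  fixes E :: "'a::complex_hilbert set"
  assumes inf: "infinite_dimensional TYPE('a)" and E: "orthonormal_basis E"
  shows "infinite E"
proof
  assume fin: "finite E"
  interpret C: vector_space "scaleC :: complex \<Rightarrow> 'a \<Rightarrow> 'a" by (rule vector_space_scaleC)
  have onb: "onb E" by (rule orthonormal_basis_imp_onb[OF E])
  have "x \<in> cspan E" for x
  proof -
    have "x = (\<Sum>e\<in>E. cinner x e *\<^sub>C e)"
      using onb cinner_orthonormal_sum[OF _ fin subset_refl]
      by (intro onb_eqI[OF onb]) (simp add: onb_def)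
    also have "\<dots> \<in> cspan E"
      by (intro C.span_sum C.span_scale C.span_base)
    finally show ?thesis .
  qed
  then show False using inf fin unfolding infinite_dimensional_def by blast
qed

theorem corollary3p12:
  fixes p q r :: "'a::complex_hilbert \<Rightarrow>\<^sub>L 'a"
  assumes "infinite_dimensional TYPE('a)"
    and "separable TYPE('a)"
    and "geodesic_triangle p q r"
  shows "inner_angle p q r + inner_angle q r p + inner_angle r p q \<le> pi"
proof -
  have t: "p \<in> Sigma_mfd" "q \<in> Sigma_mfd" "r \<in> Sigma_mfd" "p \<noteq> q" "q \<noteq> r" "r \<noteq> p"
    using assms(3) by (auto simp: geodesic_triangle_def)
  \<comment> \<open>Membership of the vertices in \<open>Sigma_mfd\<close> supplies the basis,
    through the definition of \<open>hilbert_schmidt\<close>.\<close>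
  then obtain E :: "'a set" where E: "orthonormal_basis E"
    by (auto simp: Sigma_mfd_def HR_def hilbert_schmidt_def)
  interpret hs_space E
    using E infinite_orthonormal_basis[OF assms(1) E] by unfold_locales
  show ?thesis by (rule inner_angle_sum_le_pi[OF t])
qed

end
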